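(* Let $M$ be a matroid on a finite set $V$ of vertices with rank function $\rho$, and let $d$ be a positive integer. For each $v \in V$ let $F_v$ be a convex set in $\mathbb{R}^d$. Suppose that for each independent set $V' \subset V$ with at most $2d$ vertices, $\bigcap_{v \in V'} F_v$ has volume at least one. Then there exists a set $\tau \subset V$ such that $\rho(V \setminus \tau) \le \frac{d(d+3)}{2} - 1$ and the volume of $\bigcap_{v \in \tau} F_v$ is at least $d^{-3d/2 - o(1)}$.
   Context: A matroid $M$ on a finite set $V$ is a family of subsets of $V$ (called independent sets) such that $\emptyset \in M$; if $A \subset B$ and $B \in M$ then $A \in M$; and if $A, B \in M$ with $|B| > |A|$ there exists $a \in B \setminus A$ with $A \cup \{a\} \in M$. For $V' \subset V$, the rank $\rho(V')$ is the cardinality of the largest independent set contained in $V'$. Here $o(1)$ denotes a quantity depending only on $d$ that tends to $0$ as $d \to \infty$. *)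

theory Defs
  imports "HOL-Analysis.Analysis"
begin

definition matroid :: "'v set \<Rightarrow> 'v set set \<Rightarrow> bool" where
  "matroid V M \<longleftrightarrow> finite V \<and> M \<subseteq> Pow V \<and> {} \<in> M \<and>
     (\<forall>A B. A \<subseteq> B \<and> B \<in> M \<longrightarrow> A \<in> M) \<and>
     (\<forall>A B. A \<in> M \<and> B \<in> M \<and> card B > card A \<longrightarrow> (\<exists>a \<in> B - A. A \<union> {a} \<in> M))"

definition matroid_rank :: "'v set set \<Rightarrow> 'v set \<Rightarrow> nat" where
  "matroid_rank M W = Max (card ` {A \<in> M. A \<subseteq> W})"

text \<open>
  The dimension \<open>d\<close> is quantified inside the theorem, since the error term \<open>o(1)\<close> has to be
  uniform in everything but \<open>d\<close>. Hence the points of d-dimensional Euclidean space are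
  the extensional functions on \<open>{..<d}\<close>, rather than elements of a type whose
  cardinality is the dimension.
\<close>

definition Rn :: "nat \<Rightarrow> (nat \<Rightarrow> real) set" where
  "Rn d = (\<Pi>\<^sub>E i\<in>{..<d}. UNIV)"

definition convex_Rn :: "nat \<Rightarrow> (nat \<Rightarrow> real) set \<Rightarrow> bool" where
  "convex_Rn d S \<longleftrightarrow> S \<subseteq> Rn d \<and>
     (\<forall>x\<in>S. \<forall>y\<in>S. \<forall>u\<ge>0. \<forall>v\<ge>0. u + v = 1 \<longrightarrow> (\<lambda>i\<in>{..<d}. u * x i + v * y i) \<in> S)"

text \<open>
  Lebesgue measure. The completion matters because a convex set need not be Borel, and the
  values are extended reals because intersections may have infinite volume.
\<close>

definition vol_Rn :: "nat \<Rightarrow> (nat \<Rightarrow> real) set \<Rightarrow> ennreal" where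
  "vol_Rn d S = emeasure (completion (\<Pi>\<^sub>M i\<in>{..<d}. (lborel :: real measure))) S"

text \<open>The intersection over the empty index set is the whole space \<open>Rn d\<close>.\<close>

definition Inter_Rn :: "nat \<Rightarrow> ('v \<Rightarrow> (nat \<Rightarrow> real) set) \<Rightarrow> 'v set \<Rightarrow> (nat \<Rightarrow> real) set" where
  "Inter_Rn d F W = Rn d \<inter> (\<Inter>v\<in>W. F v)"

end

theory Submission
  imports Defs "HOL-Real_Asymp.Real_Asymp"
begin

text \<open>
  Let \<open>W\<close> be an independent set. The intersection of its sets contains a largest ellipsoid, which may be taken to be
  the unit ball. First-order optimality, tested against suitable quadratic forms, yields contact points
  \<open>u\<^sub>1, \<dots>, u\<^sub>d\<close> that are nearly orthogonal in the sense of Dvoretzky and Rogers, and shows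
  that the intersection lies in the ball of radius \<open>d\<close>. Each contact point singles out one set lying in the half-space
  \<open>u\<^sub>k \<bullet> z \<le> 1\<close>, and by Helly's theorem \<open>d\<close> further sets suffice to bound \<open>(\<Sum> u\<^sub>k) \<bullet> z\<close> from below.
  So \<open>2 d\<close> of the sets meet inside a simplex of controlled volume, and the hypothesis bounds the volume
  of the largest ellipsoid from below. The norm of \<open>\<Sum> u\<^sub>k\<close> is only about \<open>2 d / 3\<close> instead of the
  trivial \<open>d\<close>, and this gain absorbs all other factors exponential in \<open>d\<close>.

  Ellipsoids of a fixed volume in dimension \<open>d\<close> depend on \<open>d (d + 3) / 2 - 1\<close> parameters, and those inside a given convex set
  form a convex set of parameters. It remains to apply a matroid version of Helly's theorem in the
  parameter space: among the independent sets \<open>B\<close> of at most \<open>n\<close> elements, choose one for which the point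
  of least norm in the intersection has the largest norm. If that point missed sets of rank exceeding
  \<open>n\<close>, one of them could be added to \<open>B\<close>, and Helly's theorem would produce a better \<open>B\<close>.
\<close>

section \<open>Helly's theorem and its matroid version\<close>

text \<open>The error term is added to the exponent and not multiplied by \<open>d\<close>, so no
  loss \<open>c ^ d\<close> with \<open>c < 1\<close> is affordable. If the contact points have a
  sum of norm about \<open>s * d\<close>, the square of the final bound is, up to subexponential
  factors, the \<open>d\<close>-th power of \<open>2 * pi / (exp 2 * s^2)\<close> times
  \<open>d powr (- 3 * d)\<close>. For \<open>s = 1\<close> the base is about 0.85, for
  \<open>s = 2/3\<close> about 1.9. Hence the triangular form of the contact points is exploited
  twice, for the determinant and for the norm of the sum.

  The sets are neither closed nor bounded, and extremal arguments need compactness. In the parameter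
  space, hulls of finitely many chosen points take the place of the sets. For ellipsoids the sets
  are truncated, closed and contracted; this costs a factor \<open>\<kappa> < 1\<close>, which
  disappears at the end because \<open>V\<close> has finitely many subsets.

  Lower triangular matrices describe all ellipsoids without redundancy and are closed under
  products, so moving the largest ellipsoid to the unit ball stays within the class.\<close>

definition fconvex :: "('i \<Rightarrow> real) set \<Rightarrow> bool" where
  "fconvex S \<longleftrightarrow> (\<forall>x\<in>S. \<forall>y\<in>S. \<forall>t. 0 \<le> t \<and> t \<le> 1 \<longrightarrow> (\<lambda>i. (1 - t) * x i + t * y i) \<in> S)"

lemma fconvexI:
  "(\<And>x y t. x \<in> S \<Longrightarrow> y \<in> S \<Longrightarrow> 0 \<le> t \<Longrightarrow> t \<le> 1 \<Longrightarrow> (\<lambda>i. (1 - t) * x i + t * y i) \<in> S) \<Longrightarrow> fconvex S"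
  by (auto simp: fconvex_def)

lemma fconvexD:
  "fconvex S \<Longrightarrow> x \<in> S \<Longrightarrow> y \<in> S \<Longrightarrow> 0 \<le> t \<Longrightarrow> t \<le> 1 \<Longrightarrow> (\<lambda>i. (1 - t) * x i + t * y i) \<in> S"
  by (auto simp: fconvex_def)

lemma sum_square_convex:
  fixes x y :: "'i \<Rightarrow> real"
  assumes "0 \<le> t" "t \<le> 1"
  shows "(\<Sum>i\<in>I. ((1 - t) * x i + t * y i)\<^sup>2) \<le> (1 - t) * (\<Sum>i\<in>I. (x i)\<^sup>2) + t * (\<Sum>i\<in>I. (y i)\<^sup>2)"
proof -
  have "((1 - t) * a + t * b)\<^sup>2 = (1 - t) * a\<^sup>2 + t * b\<^sup>2 - t * (1 - t) * (a - b)\<^sup>2" for a b :: real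
    by (simp add: power2_eq_square algebra_simps)
  then have "((1 - t) * a + t * b)\<^sup>2 \<le> (1 - t) * a\<^sup>2 + t * b\<^sup>2" for a b :: real
    using assms by simp
  then show ?thesis unfolding sum_distrib_left sum.distrib[symmetric] by (intro sum_mono)
qed

lemma fconvex_Inter: "(\<And>j. j \<in> J \<Longrightarrow> fconvex (K j)) \<Longrightarrow> fconvex (\<Inter>j\<in>J. K j)"
  by (auto simp: fconvex_def)

lemma fconvex_Int: "fconvex A \<Longrightarrow> fconvex B \<Longrightarrow> fconvex (A \<inter> B)"
  by (auto simp: fconvex_def)

lemma fconvex_sum:
  fixes p :: "'j \<Rightarrow> 'i \<Rightarrow> real"
  assumes "finite J" "fconvex S" "\<And>j. j \<in> J \<Longrightarrow> p j \<in> S" "\<And>j. j \<in> J \<Longrightarrow> 0 \<le> c j" "sum c J = 1"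
  shows "(\<lambda>i. \<Sum>j\<in>J. c j * p j i) \<in> S"
  using assms(1,3-5)
proof (induction J arbitrary: c rule: finite_induct)
  case (insert k J)
  show ?case
  proof (cases "sum c J = 0")
    case True
    then have z: "c j = 0" if "j \<in> J" for j
      using that insert.hyps insert.prems(2) by (simp add: sum_nonneg_eq_0_iff)
    with insert show ?thesis by simp
  next
    case False
    define s where "s = sum c J"
    have s0: "s > 0" using False insert.prems(2) by (simp add: s_def order_less_le sum_nonneg)
    have ck: "c k = 1 - s" using insert.prems(3) insert.hyps by (simp add: s_def)
    have s1: "s \<le> 1" using insert.prems(2)[of k] ck by simp
    have "(\<lambda>i. \<Sum>j\<in>J. (c j / s) * p j i) \<in> S"
      using insert.prems s0 by (intro insert.IH) (auto simp: sum_divide_distrib[symmetric] s_def)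
    then have "(\<lambda>i. (1 - s) * p k i + s * (\<Sum>j\<in>J. (c j / s) * p j i)) \<in> S"
      using insert.prems(1)[of k] s0 s1 assms(2) by (intro fconvexD) auto
    also have "(\<lambda>i. (1 - s) * p k i + s * (\<Sum>j\<in>J. (c j / s) * p j i)) = (\<lambda>i. \<Sum>j\<in>insert k J. c j * p j i)"
      using insert.hyps s0 by (auto simp: sum_distrib_left ck)
    finally show ?thesis .
  qed
qed simp

text \<open>Gaussian elimination on the coordinates: a vector with nonzero \<open>k\<close>-th entry
  clears that entry from all the others, the shortened system is handled by induction, and the
  coefficient of the pivot vector is recovered at the end.\<close>

lemma linear_dependence:
  fixes a :: "'j \<Rightarrow> 'i \<Rightarrow> real"
  assumes "finite I" "finite J" "card I < card J"
  shows "\<exists>c. (\<exists>j\<in>J. c j \<noteq> 0) \<and> (\<forall>i\<in>I. (\<Sum>j\<in>J. c j * a j i) = 0)"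
  using assms
proof (induction I arbitrary: J a rule: finite_induct)
  case empty
  then obtain j where "j \<in> J" by fastforce
  then show ?case by (intro exI[of _ "\<lambda>_. 1"]) auto
next
  case (insert k I)
  show ?case
  proof (cases "\<forall>j\<in>J. a j k = 0")
    case True
    from insert.IH[of J a] insert.prems insert.hyps obtain c where
      "\<exists>j\<in>J. c j \<noteq> 0" "\<forall>i\<in>I. (\<Sum>j\<in>J. c j * a j i) = 0" by auto
    with True show ?thesis by (intro exI[of _ c]) auto
  next
    case False
    then obtain m where m: "m \<in> J" "a m k \<noteq> 0" by auto
    define b where "b = (\<lambda>j i. a j i - a j k / a m k * a m i)"
    have "card I < card (J - {m})" using insert.prems insert.hyps m by simp
    with insert.IH[of "J - {m}" b] insert.prems obtain c where
      c: "\<exists>j\<in>J - {m}. c j \<noteq> 0" "\<forall>i\<in>I. (\<Sum>j\<in>J - {m}. c j * b j i) = 0" by auto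
    define c' where "c' = c(m := - (\<Sum>j\<in>J - {m}. c j * (a j k / a m k)))"
    have eq: "(\<Sum>j\<in>J. c' j * a j i) = (\<Sum>j\<in>J - {m}. c j * b j i)" for i
    proof -
      have "(\<Sum>j\<in>J. c' j * a j i) = c' m * a m i + (\<Sum>j\<in>J - {m}. c' j * a j i)"
        using m insert.prems by (simp add: sum.remove)
      also have "(\<Sum>j\<in>J - {m}. c' j * a j i) = (\<Sum>j\<in>J - {m}. c j * a j i)"
        by (intro sum.cong) (auto simp: c'_def)
      finally show ?thesis
        by (simp add: c'_def b_def sum_distrib_right sum_subtractf right_diff_distrib mult.assoc)
    qed
    have "b j k = 0" for j using m by (simp add: b_def)
    then have "\<forall>i\<in>insert k I. (\<Sum>j\<in>J. c' j * a j i) = 0" using c(2) by (simp add: eq)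
    moreover have "\<exists>j\<in>J. c' j \<noteq> 0" using c(1) by (auto simp: c'_def)
    ultimately show ?thesis by blast
  qed
qed

text \<open>Radon's argument. An affine dependence among the points \<open>p j\<close> splits them
  by the sign of the coefficients into \<open>A\<close> and \<open>B\<close>, whose hulls share a
  point \<open>z\<close>. Every \<open>K k\<close> contains \<open>z\<close>: for \<open>k\<close>
  in \<open>A\<close> use the combination over \<open>B\<close>, otherwise the one over
  \<open>A\<close>, since \<open>p k\<close> itself is then avoided.\<close>

lemma Helly_step:
  fixes K :: "'j \<Rightarrow> ('i \<Rightarrow> real) set"
  assumes "finite I" "finite J" "card J > Suc (card I)"
    and cv: "\<And>j. j \<in> J \<Longrightarrow> fconvex (K j)"
    and p: "\<And>j k. j \<in> J \<Longrightarrow> k \<in> J \<Longrightarrow> j \<noteq> k \<Longrightarrow> p j \<in> K k"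
    and supp: "\<And>j i. j \<in> J \<Longrightarrow> i \<notin> I \<Longrightarrow> p j i = w i"
  shows "(\<Inter>j\<in>J. K j) \<noteq> {}"
proof -
  \<comment> \<open>The additional coordinate \<open>None\<close>, constantly 1, makes the
    dependence affine: its coefficients sum to 0.\<close>
  define a where "a = (\<lambda>j. case_option 1 (p j) :: 'i option \<Rightarrow> real)"
  have "card (insert None (Some ` I)) < card J"
    using assms(1,3) by (simp add: card_insert_if card_image)
  with linear_dependence[of "insert None (Some ` I)" J a] assms(1,2)
  obtain c where c: "\<exists>j\<in>J. c j \<noteq> 0" "\<forall>i\<in>insert None (Some ` I). (\<Sum>j\<in>J. c j * a j i) = 0"
    by auto
  have c0: "sum c J = 0" using c(2) by (auto simp: a_def)
  have c1: "(\<Sum>j\<in>J. c j * p j i) = 0" if "i \<in> I" for i using c(2) that by (auto simp: a_def)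
  define A where "A = {j\<in>J. c j > 0}"
  define B where "B = {j\<in>J. \<not> c j > 0}"
  have fin: "finite A" "finite B" using assms(2) by (auto simp: A_def B_def)
  have J: "J = A \<union> B" "A \<inter> B = {}" by (auto simp: A_def B_def)
  have splitJ: "sum f J = sum f A + sum f B" for f :: "'j \<Rightarrow> real"
    unfolding J(1) by (rule sum.union_disjoint) (use fin J in auto)
  define s where "s = sum c A"
  have sB: "sum c B = - s" using c0 splitJ[of c] by (simp add: s_def)
  have s0: "s > 0"
  proof (rule ccontr)
    assume "\<not> s > 0"
    then have "A = {}" unfolding s_def A_def by (smt (verit) A_def empty_iff fin(1) mem_Collect_eq sum_pos)
    then have "sum c J = 0 \<and> (\<forall>j\<in>J. c j \<le> 0)" using c0 by (auto simp: A_def)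
    then have "\<forall>j\<in>J. - c j = 0" using assms(2)
      by (subst sum_nonneg_eq_0_iff[symmetric]) (auto simp: sum_negf)
    with c(1) show False by auto
  qed
  define z where "z = (\<lambda>i. \<Sum>j\<in>A. (c j / s) * p j i)"
  have zB: "z = (\<lambda>i. \<Sum>j\<in>B. (- c j / s) * p j i)"
  proof
    fix i
    show "z i = (\<Sum>j\<in>B. (- c j / s) * p j i)"
    proof (cases "i \<in> I")
      case True
      then have "(\<Sum>j\<in>A. c j * p j i) = - (\<Sum>j\<in>B. c j * p j i)"
        using c1[OF True] splitJ[of "\<lambda>j. c j * p j i"] by simp
      then show ?thesis
        by (simp add: z_def sum_divide_distrib[symmetric] sum_negf)
    next
      \<comment> \<open>Outside \<open>I\<close> the dependence says nothing; there all points agree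
        with \<open>w\<close>, and both systems of weights sum to 1.\<close>
      case False
      have "z i = (\<Sum>j\<in>A. c j) / s * w i"
        using False supp by (auto simp: z_def sum_distrib_right sum_divide_distrib A_def intro!: sum.cong)
      moreover have "(\<Sum>j\<in>B. (- c j / s) * p j i) = - (\<Sum>j\<in>B. c j) / s * w i"
        using False supp by (auto simp: sum_distrib_right sum_divide_distrib sum_negf B_def intro!: sum.cong)
      ultimately show ?thesis using s0 sB by (simp add: s_def)
    qed
  qed
  have "z \<in> K k" if k: "k \<in> J" for k
  proof (cases "k \<in> A")
    case True
    show ?thesis unfolding zB
      by (rule fconvex_sum) (use fin cv k p True s0 sB in
        \<open>auto simp: B_def A_def sum_negf sum_divide_distrib[symmetric] divide_le_0_iff\<close>)
  next
    case False
    show ?thesis unfolding z_def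
      by (rule fconvex_sum) (use fin cv k p False s0 in
        \<open>auto simp: B_def A_def s_def sum_divide_distrib[symmetric]\<close>)
  qed
  then show ?thesis by blast
qed

text \<open>Omitting one set at a time yields, by induction, the points needed for Radon's argument.
  Only the coordinates in \<open>I\<close> count for the dimension; all others are frozen at
  \<open>w\<close>. So the same theorem serves \<open>Rn d\<close>, with \<open>undefined\<close>
  outside \<open>{..<d}\<close>, and the parameter space, with 0 outside its index set.\<close>

theorem Helly_fun:
  fixes K :: "'j \<Rightarrow> ('i \<Rightarrow> real) set"
  assumes "finite I" "finite J"
    and "\<And>j. j \<in> J \<Longrightarrow> fconvex (K j)"
    and "\<And>j x i. j \<in> J \<Longrightarrow> x \<in> K j \<Longrightarrow> i \<notin> I \<Longrightarrow> x i = w i"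
    and "\<And>J'. J' \<subseteq> J \<Longrightarrow> card J' \<le> Suc (card I) \<Longrightarrow> (\<Inter>j\<in>J'. K j) \<noteq> {}"
  shows "(\<Inter>j\<in>J. K j) \<noteq> {}"
  using assms(2-5)
proof (induction "card J" arbitrary: J rule: less_induct)
  case less
  show ?case
  proof (cases "card J \<le> Suc (card I)")
    case True
    then show ?thesis using less.prems(4) by blast
  next
    case False
    have "(\<Inter>k\<in>J - {j}. K k) \<noteq> {}" if "j \<in> J" for j
    proof (rule less.hyps)
      show "card (J - {j}) < card J" using that less.prems(1) by (intro card_Diff1_less)
      show "(\<Inter>k\<in>J'. K k) \<noteq> {}" if "J' \<subseteq> J - {j}" "card J' \<le> Suc (card I)" for J'
        using less.prems(4)[of J'] that by blast
    qed (use less.prems in auto)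
    then have "\<forall>j. \<exists>p. j \<in> J \<longrightarrow> p \<in> (\<Inter>k\<in>J - {j}. K k)" by blast
    then obtain p where p: "\<And>j. j \<in> J \<Longrightarrow> p j \<in> (\<Inter>k\<in>J - {j}. K k)" by metis
    \<comment> \<open>\<open>p j\<close> is controlled outside \<open>I\<close> only through
      membership in some \<open>K k\<close> with \<open>k\<close> different from
      \<open>j\<close>.\<close>
    have another: "\<exists>k\<in>J. k \<noteq> j" for j
    proof (rule ccontr)
      assume "\<not> ?thesis" then have "J \<subseteq> {j}" by auto
      then have "card J \<le> card {j}" by (intro card_mono) auto
      with False show False by simp
    qed
    show ?thesis
    proof (rule Helly_step[OF assms(1) less.prems(1)])
      show "p j \<in> K k" if "j \<in> J" "k \<in> J" "j \<noteq> k" for j k using p[OF that(1)] that by auto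
      show "p j i = w i" if "j \<in> J" "i \<notin> I" for j i
      proof -
        obtain k where "k \<in> J" "k \<noteq> j" using another by blast
        then have "p j \<in> K k" using p[OF that(1)] by auto
        then show ?thesis using less.prems(3)[OF \<open>k \<in> J\<close> _ that(2)] by blast
      qed
    qed (use False less.prems in auto)
  qed
qed


section \<open>Finite convex hulls and the matroid version of Helly's theorem\<close>

lemma compact_PiE_UNIV:
  fixes S :: "'i \<Rightarrow> 'a::topological_space set"
  assumes "\<And>i. compact (S i)"
  shows "compact (PiE UNIV S)"
proof -
  have "compactin (product_topology (\<lambda>_. euclidean) UNIV) (PiE UNIV S)"
    using assms by (subst compactin_PiE) auto
  then show ?thesis by (simp add: euclidean_product_topology)
qed

text \<open>The convex hull of a finite set. Such hulls replace convex sets without topological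
  properties by compact ones, on which a point of least norm exists.\<close>

definition fhull :: "('i \<Rightarrow> real) set \<Rightarrow> ('i \<Rightarrow> real) set" where
  "fhull X = (\<lambda>w i. \<Sum>x\<in>X. w x * x i) ` {w. (\<forall>x\<in>X. 0 \<le> w x) \<and> sum w X = 1}"

lemma fhull_subset: "finite X \<Longrightarrow> X \<subseteq> S \<Longrightarrow> fconvex S \<Longrightarrow> fhull X \<subseteq> S"
  unfolding fhull_def by (auto intro!: fconvex_sum[where p="\<lambda>x. x"])

lemma fhull_superset: "finite X \<Longrightarrow> X \<subseteq> fhull X"
  unfolding fhull_def
proof
  fix x assume x: "finite X" "x \<in> X"
  show "x \<in> (\<lambda>w i. \<Sum>x\<in>X. w x * x i) ` {w. (\<forall>x\<in>X. 0 \<le> w x) \<and> sum w X = 1}"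
    by (rule image_eqI[where x="\<lambda>y. if y = x then 1 else 0"])
      (use x in \<open>auto simp: if_distribR if_distrib[of "\<lambda>a. a * _"] cong: if_cong\<close>)
qed

lemma fconvex_fhull: "fconvex (fhull X)"
  unfolding fconvex_def
proof (intro ballI allI impI)
  fix x y t assume "x \<in> fhull X" "y \<in> fhull X" and t: "0 \<le> t \<and> t \<le> (1::real)"
  then obtain u v where u: "\<forall>x\<in>X. 0 \<le> u x" "sum u X = 1" "x = (\<lambda>i. \<Sum>x\<in>X. u x * x i)"
    and v: "\<forall>x\<in>X. 0 \<le> v x" "sum v X = 1" "y = (\<lambda>i. \<Sum>x\<in>X. v x * x i)"
    unfolding fhull_def by auto
  show "(\<lambda>i. (1 - t) * x i + t * y i) \<in> fhull X" unfolding fhull_def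
  proof (rule image_eqI[where x="\<lambda>z. (1 - t) * u z + t * v z"])
    show "(\<lambda>i. (1 - t) * x i + t * y i) = (\<lambda>i. \<Sum>x\<in>X. ((1 - t) * u x + t * v x) * x i)"
      by (simp add: u v sum_distrib_left sum.distrib distrib_right mult.assoc)
    have "(\<Sum>z\<in>X. (1 - t) * u z + t * v z) = (1 - t) * sum u X + t * sum v X"
      by (simp add: sum.distrib sum_distrib_left)
    then show "(\<lambda>z. (1 - t) * u z + t * v z) \<in> {w. (\<forall>x\<in>X. 0 \<le> w x) \<and> sum w X = 1}"
      using u v t by auto
  qed
qed

lemma compact_fhull:
  assumes "finite X" shows "compact (fhull X)"
proof -
  \<comment> \<open>Weights are normalised to vanish off \<open>X\<close>; \<open>fhull\<close>
    leaves them free there, and only the normalised ones form a compact set.\<close>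
  define Q where "Q = PiE UNIV (\<lambda>x. if x \<in> X then {0..1::real} else {0}) \<inter> {w. sum w X = 1}"
  have cont: "continuous_on A (\<lambda>w. w x)" for x and A :: "(('i \<Rightarrow> real) \<Rightarrow> real) set"
    by (rule continuous_on_product_then_coordinatewise[OF continuous_on_id])
  have "closed {w. sum w X = (1::real)}"
    by (intro closed_Collect_eq continuous_intros cont)
  then have "compact Q" unfolding Q_def
    by (intro compact_Int_closed compact_PiE_UNIV) auto
  moreover have "continuous_on Q (\<lambda>w i. \<Sum>x\<in>X. w x * x i)"
    by (intro continuous_on_coordinatewise_then_product continuous_intros cont)
  ultimately have "compact ((\<lambda>w i. \<Sum>x\<in>X. w x * x i) ` Q)" by (rule compact_continuous_image[rotated])
  also have "(\<lambda>w i. \<Sum>x\<in>X. w x * x i) ` Q = fhull X"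
  proof
    show "(\<lambda>w i. \<Sum>x\<in>X. w x * x i) ` Q \<subseteq> fhull X"
    proof
      fix y assume "y \<in> (\<lambda>w i. \<Sum>x\<in>X. w x * x i) ` Q"
      then obtain w where w: "w \<in> Q" "y = (\<lambda>i. \<Sum>x\<in>X. w x * x i)" by auto
      have "0 \<le> w x" if "x \<in> X" for x
        using w(1) that unfolding Q_def by (auto simp: PiE_iff dest!: spec[of _ x])
      then show "y \<in> fhull X" unfolding fhull_def using w by (auto simp: Q_def)
    qed
    show "fhull X \<subseteq> (\<lambda>w i. \<Sum>x\<in>X. w x * x i) ` Q"
    proof
      fix y assume "y \<in> fhull X"
      then obtain w where w: "\<forall>x\<in>X. 0 \<le> w x" "sum w X = 1" "y = (\<lambda>i. \<Sum>x\<in>X. w x * x i)"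
        unfolding fhull_def by auto
      have "w x \<le> 1" if "x \<in> X" for x
        using member_le_sum[of x X w] w that assms by auto
      with w show "y \<in> (\<lambda>w i. \<Sum>x\<in>X. w x * x i) ` Q"
        by (intro image_eqI[where x="\<lambda>x. if x \<in> X then w x else 0"]) (auto simp: Q_def)
    qed
  qed
  finally show ?thesis .
qed

text \<open>To contradict the choice of \<open>B\<close>, Helly's theorem is applied to the sets of
  the enlarged family \<open>D\<close> together with the open ball through \<open>m D\<close>. These
  have no common point, so some \<open>card I + 1\<close> of them have none, and the ball is among
  these. The at most \<open>card I\<close> other members form an independent \<open>E\<close> whose
  minimal norm is at least that of \<open>D\<close>, hence larger than that of
  \<open>B\<close>.\<close>

theorem matroid_Helly:
  fixes G :: "'v \<Rightarrow> ('i::countable \<Rightarrow> real) set"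
  assumes mat: "matroid V M" and I: "finite I"
    and cvU: "fconvex U" and cv: "\<And>v. v \<in> V \<Longrightarrow> fconvex (G v)"
    and supp: "\<And>x i. x \<in> U \<Longrightarrow> i \<notin> I \<Longrightarrow> x i = w i"
    and ne: "\<And>B. B \<in> M \<Longrightarrow> card B \<le> Suc (card I) \<Longrightarrow> U \<inter> (\<Inter>v\<in>B. G v) \<noteq> {}"
  shows "\<exists>\<tau>\<subseteq>V. (\<exists>x\<in>U. \<forall>v\<in>\<tau>. x \<in> G v) \<and> matroid_rank M (V - \<tau>) \<le> card I"
proof -
  from mat have finV: "finite V" and MV: "M \<subseteq> Pow V" and M0: "{} \<in> M"
    and Msub: "\<And>A B. A \<subseteq> B \<Longrightarrow> B \<in> M \<Longrightarrow> A \<in> M"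
    and Maug: "\<And>A B. A \<in> M \<Longrightarrow> B \<in> M \<Longrightarrow> card B > card A \<Longrightarrow> \<exists>a\<in>B - A. A \<union> {a} \<in> M"
    unfolding matroid_def by blast+
  have finM: "finite M" using MV finV by (meson finite_Pow_iff finite_subset)
  have finB: "finite B" if "B \<in> M" for B using that MV finV finite_subset by blast
  define S where "S = {B\<in>M. card B \<le> Suc (card I)}"
  have finS: "finite S" using finM by (simp add: S_def)
  from ne have "\<forall>B. \<exists>p. B \<in> S \<longrightarrow> p \<in> U \<inter> (\<Inter>v\<in>B. G v)" unfolding S_def by blast
  then obtain p where p: "\<And>B. B \<in> S \<Longrightarrow> p B \<in> U \<inter> (\<Inter>v\<in>B. G v)" by metis
  \<comment> \<open>One witness per small independent set generates everything: \<open>H v\<close>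
    is the hull of the witnesses of the sets containing \<open>v\<close>, so that \<open>C B\<close>
    is compact and still contains \<open>p B\<close>.\<close>
  define K where "K = fhull (p ` S)"
  define H where "H = (\<lambda>v. fhull (p ` {B\<in>S. v \<in> B}))"
  have KU: "K \<subseteq> U" unfolding K_def by (rule fhull_subset) (use finS p cvU in auto)
  have HG: "H v \<subseteq> G v" if "v \<in> V" for v
    unfolding H_def by (rule fhull_subset) (use finS p cv that in auto)
  define C where "C = (\<lambda>B. K \<inter> (\<Inter>v\<in>B. H v))"
  have Hcv: "fconvex (H v)" and Kcv: "fconvex K" for v by (simp_all add: H_def K_def fconvex_fhull)
  have Ccv: "fconvex (C B)" for B unfolding C_def
    by (intro fconvex_Int fconvex_Inter Hcv Kcv)
  have "closed (H v)" for v
    unfolding H_def using finS by (intro compact_imp_closed compact_fhull) auto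
  then have Ccomp: "compact (C B)" for B
    unfolding C_def K_def using finS by (intro compact_Int_closed closed_INT compact_fhull) auto
  have pC: "p B \<in> C B" if "B \<in> S" for B
    using that fhull_superset[of "p ` S"] fhull_superset[of "p ` {B\<in>S. v \<in> B}" for v] finS
    unfolding C_def K_def H_def by auto
  define nr where "nr = (\<lambda>x. \<Sum>i\<in>I. (x i)\<^sup>2 :: real)"
  have nrc: "continuous_on A nr" for A unfolding nr_def
    by (intro continuous_intros continuous_on_product_then_coordinatewise[OF continuous_on_id])
  have "\<exists>m\<in>C B. \<forall>y\<in>C B. nr m \<le> nr y" if "B \<in> S" for B
    using pC[OF that] by (intro continuous_attains_inf Ccomp nrc) auto
  then obtain m where m: "\<And>B. B \<in> S \<Longrightarrow> m B \<in> C B" "\<And>B y. B \<in> S \<Longrightarrow> y \<in> C B \<Longrightarrow> nr (m B) \<le> nr y"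
    by metis
  have uniq: "x = m B" if B: "B \<in> S" and x: "x \<in> C B" "nr x \<le> nr (m B)" for x B
  proof -
    \<comment> \<open>The midpoint: the parallelogram identity rules out a second minimiser.\<close>
    let ?z = "\<lambda>i. (1 - 1/2) * x i + 1/2 * m B i"
    have "?z \<in> C B" using Ccv x(1) m(1)[OF B] by (intro fconvexD) auto
    then have "nr (m B) \<le> nr ?z" using m(2)[OF B] by blast
    also have "nr ?z = (nr x + nr (m B)) / 2 - (\<Sum>i\<in>I. (x i - m B i)\<^sup>2) / 4"
      unfolding nr_def sum.distrib[symmetric] sum_divide_distrib sum_subtractf[symmetric]
      by (intro sum.cong) (auto simp: power2_eq_square field_simps)
    finally have le: "nr (m B) \<le> (nr x + nr (m B)) / 2 - (\<Sum>i\<in>I. (x i - m B i)\<^sup>2) / 4" .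
    have "s \<le> 0" if "b \<le> (a + b) / 2 - s / 4" "a \<le> b" for a b s :: real using that by argo
    from this[OF le x(2)] have "(\<Sum>i\<in>I. (x i - m B i)\<^sup>2) \<le> 0" .
    then have "(\<Sum>i\<in>I. (x i - m B i)\<^sup>2) = 0" by (intro antisym sum_nonneg) auto
    then have on: "x i = m B i" if "i \<in> I" for i using that I by (simp add: sum_nonneg_eq_0_iff)
    have "x \<in> U" "m B \<in> U" using x(1) m(1)[OF B] KU by (auto simp: C_def)
    with on supp show ?thesis by (metis ext)
  qed
  \<comment> \<open>One element fewer than in \<open>S\<close>: \<open>B\<close> must leave room for
    the added element \<open>a\<close>, and the ball will occupy one of the
    \<open>card I + 1\<close> places in Helly's theorem.\<close>
  define R where "R = {B\<in>M. card B \<le> card I}"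
  have RS: "R \<subseteq> S" by (auto simp: R_def S_def)
  have finR: "finite R" "R \<noteq> {}" using finM M0 by (auto simp: R_def)
  then have "Max ((\<lambda>B. nr (m B)) ` R) \<in> (\<lambda>B. nr (m B)) ` R" by (intro Max_in) auto
  then obtain B where B1: "B \<in> R" "nr (m B) = Max ((\<lambda>B. nr (m B)) ` R)" by auto
  have B: "B \<in> R" "\<And>B'. B' \<in> R \<Longrightarrow> nr (m B') \<le> nr (m B)"
    using B1 finR by (auto intro!: Max_ge)
  have BS: "B \<in> S" using B RS by auto
  define \<tau> where "\<tau> = {v\<in>V. m B \<in> H v}"
  have "card A \<le> card I" if A: "A \<in> M" "A \<subseteq> V - \<tau>" for A
  proof (rule ccontr)
    assume "\<not> card A \<le> card I"
    then have "card B < card A" using B(1) by (simp add: R_def)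
    with Maug[of B A] A B(1) obtain a where a: "a \<in> A - B" "B \<union> {a} \<in> M" by (auto simp: R_def)
    define D where "D = B \<union> {a}"
    have finD: "finite D" unfolding D_def by (rule finB[OF a(2)])
    have DS: "D \<in> S" using a B(1) finB[of B] by (auto simp: D_def S_def R_def card_insert_if)
    have "m D \<in> C B" using m(1)[OF DS] by (auto simp: C_def D_def)
    \<comment> \<open>\<open>a\<close> lies outside \<open>\<tau>\<close>, so \<open>H a\<close>
      contains \<open>m D\<close> but not \<open>m B\<close>.\<close>
    moreover have "m D \<noteq> m B"
      using m(1)[OF DS] a(1) A(2) by (auto simp: C_def D_def \<tau>_def)
    ultimately have gt: "nr (m D) > nr (m B)" using uniq[OF BS] by force
    define L where "L = case_option {x\<in>K. nr x < nr (m D)} (\<lambda>v. K \<inter> H v)"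
    define J where "J = insert None (Some ` D)"
    have "(\<Inter>j\<in>J. L j) = {}"
    proof (rule ccontr)
      assume "(\<Inter>j\<in>J. L j) \<noteq> {}"
      then obtain x where "x \<in> C D" "nr x < nr (m D)" by (auto simp: J_def L_def C_def split: if_splits)
      with m(2)[OF DS] show False by force
    qed
    have ballcv: "fconvex {x\<in>K. nr x < r}" for r
        proof (rule fconvexI)
      fix x y and t :: real assume xy: "x \<in> {x\<in>K. nr x < r}" "y \<in> {x\<in>K. nr x < r}" and t: "0 \<le> t" "t \<le> 1"
      let ?z = "\<lambda>i. (1 - t) * x i + t * y i"
      have "nr ?z \<le> (1 - t) * nr x + t * nr y"
        unfolding nr_def using t by (intro sum_square_convex) auto
      also have "\<dots> < r"
      proof (cases "t = 0")
        case False
        then have "t * nr y < t * r" "(1 - t) * nr x \<le> (1 - t) * r"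
          using xy t by (auto intro!: mult_left_mono)
        then show ?thesis by (simp add: algebra_simps)
      qed (use xy in simp)
      finally show "?z \<in> {x\<in>K. nr x < r}" using fconvexD[OF Kcv] xy t by auto
    qed
    have "\<exists>J'\<subseteq>J. card J' \<le> Suc (card I) \<and> (\<Inter>j\<in>J'. L j) = {}"
    proof (rule ccontr)
      assume small: "\<not> ?thesis"
      have "(\<Inter>j\<in>J. L j) \<noteq> {}"
      proof (rule Helly_fun[where I=I and w=w])
        show "finite J" using finD by (simp add: J_def)
        show "fconvex (L j)" for j
          unfolding L_def by (cases j) (simp_all add: ballcv fconvex_Int Kcv Hcv)
        show "x i = w i" if "x \<in> L j" "i \<notin> I" for j x i
        proof -
          have "x \<in> K" using that(1) by (cases j) (auto simp: L_def)
          then show ?thesis using KU supp that(2) by blast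
        qed
        show "(\<Inter>j\<in>J'. L j) \<noteq> {}" if "J' \<subseteq> J" "card J' \<le> Suc (card I)" for J'
          using small that by blast
      qed (rule I)
      with \<open>(\<Inter>j\<in>J. L j) = {}\<close> show False by simp
    qed
    then obtain J' where J': "J' \<subseteq> J" "card J' \<le> Suc (card I)" "(\<Inter>j\<in>J'. L j) = {}" by blast
    \<comment> \<open>Without the ball, \<open>m D\<close> would be a common point.\<close>
    have "None \<in> J'"
    proof (rule ccontr)
      assume "None \<notin> J'"
      then have "m D \<in> (\<Inter>j\<in>J'. L j)" using J'(1) m(1)[OF DS] by (auto simp: J_def L_def C_def)
      with J'(3) show False by simp
    qed
    define E where "E = {v. Some v \<in> J'}"
    have J'E: "J' = insert None (Some ` E)" 
    proof (rule set_eqI)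
      show "j \<in> J' \<longleftrightarrow> j \<in> insert None (Some ` E)" for j
        using \<open>None \<in> J'\<close> by (cases j) (auto simp: E_def)
    qed
    have ED: "E \<subseteq> D" using J'(1) by (auto simp: J_def E_def)
    then have "finite E" using finD finite_subset by blast
    then have "card E \<le> card I" using J'(2) by (simp add: J'E card_image card_insert_if)
    then have ER: "E \<in> R" using ED Msub[of E D] a(2) by (auto simp: R_def D_def)
    have "m E \<in> C E" using m(1) ER RS by blast
    then have "m E \<in> L j" if "j \<in> J'" "nr (m E) < nr (m D)" for j
      using that by (auto simp: J'E L_def C_def)
    then have "nr (m E) < nr (m D) \<Longrightarrow> m E \<in> (\<Inter>j\<in>J'. L j)" by auto
    then have "nr (m E) \<ge> nr (m D)" unfolding J'(3) by (cases "nr (m E) < nr (m D)") auto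
    with B(2)[OF ER] gt show False by simp
  qed
  moreover have "finite {A\<in>M. A \<subseteq> V - \<tau>}" "{A\<in>M. A \<subseteq> V - \<tau>} \<noteq> {}" using finM M0 by auto
  ultimately have "matroid_rank M (V - \<tau>) \<le> card I" unfolding matroid_rank_def
    by (subst Max_le_iff) auto
  moreover have "m B \<in> U" using m(1)[OF BS] KU by (auto simp: C_def)
  moreover have "\<forall>v\<in>\<tau>. m B \<in> G v" using HG by (auto simp: \<tau>_def)
  moreover have "\<tau> \<subseteq> V" by (auto simp: \<tau>_def)
  ultimately show ?thesis by blast
qed

section \<open>Volume of affine images\<close>

abbreviation leb_Rn :: "nat \<Rightarrow> (nat \<Rightarrow> real) measure" where
  "leb_Rn d \<equiv> (\<Pi>\<^sub>M i\<in>{..<d}. (lborel :: real measure))"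

abbreviation lvol :: "nat \<Rightarrow> (nat \<Rightarrow> real) set \<Rightarrow> ennreal" where
  "lvol d \<equiv> emeasure (leb_Rn d)"

lemma space_leb_Rn [simp]: "space (leb_Rn d) = Rn d"
  by (simp add: space_PiM Rn_def)

lemma Rn_outside: "x \<in> Rn d \<Longrightarrow> \<not> i < d \<Longrightarrow> x i = undefined"
  by (auto simp: Rn_def PiE_iff extensional_def)

lemma Rn_I: "(\<And>i. \<not> i < d \<Longrightarrow> x i = undefined) \<Longrightarrow> x \<in> Rn d"
  by (auto simp: Rn_def PiE_iff extensional_def)

lemma Rn_eqI: "x \<in> Rn d \<Longrightarrow> y \<in> Rn d \<Longrightarrow> (\<And>i. i < d \<Longrightarrow> x i = y i) \<Longrightarrow> x = y"
  by (metis Rn_outside ext)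

lemma Rn_fun_upd: "x \<in> Rn d \<Longrightarrow> i < d \<Longrightarrow> x(i := t) \<in> Rn d"
  by (rule Rn_I) (auto simp: Rn_outside)

lemma fconvex_Rn: "fconvex (Rn d)"
  unfolding fconvex_def by (auto intro!: Rn_I simp: Rn_outside algebra_simps)

lemma restrict_in_Rn [simp]: "restrict f {..<d} \<in> Rn d"
  by (simp add: Rn_I)

lemma coordinate_measurable: "i < d \<Longrightarrow> (\<lambda>z. z i) \<in> borel_measurable (leb_Rn d)"
  using measurable_component_singleton[of i "{..<d}" "\<lambda>_. lborel :: real measure"] by simp

text \<open>\<open>g\<close> multiplies volumes by \<open>c\<close>; phrased with preimages, so that measurability is automatic.\<close>

definition scales :: "nat \<Rightarrow> ((nat \<Rightarrow> real) \<Rightarrow> (nat \<Rightarrow> real)) \<Rightarrow> real \<Rightarrow> bool" where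
  "scales d g c \<longleftrightarrow> c > 0 \<and> g \<in> measurable (leb_Rn d) (leb_Rn d) \<and>
     (\<forall>S\<in>sets (leb_Rn d). lvol d (g -` S \<inter> Rn d) * ennreal c = lvol d S)"

lemma scalesD:
  assumes "scales d g c"
  shows "c > 0" "g \<in> measurable (leb_Rn d) (leb_Rn d)"
    "S \<in> sets (leb_Rn d) \<Longrightarrow> lvol d (g -` S \<inter> Rn d) * ennreal c = lvol d S"
  using assms by (auto simp: scales_def)

lemma scales_cong:
  assumes "scales d g c" "\<And>z. z \<in> Rn d \<Longrightarrow> g z = h z"
  shows "scales d h c"
proof -
  have "h -` S \<inter> Rn d = g -` S \<inter> Rn d" for S using assms(2) by auto
  moreover have "h \<in> measurable (leb_Rn d) (leb_Rn d)"
    using assms by (subst measurable_cong[where g=g]) (auto simp: scales_def)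
  ultimately show ?thesis using assms(1) by (simp add: scales_def)
qed

lemma scales_id: "scales d (\<lambda>z. z) 1"
proof -
  have "(\<lambda>z. z) -` S \<inter> Rn d = S" if "S \<in> sets (leb_Rn d)" for S
    using sets.sets_into_space[OF that] by auto
  then show ?thesis by (simp add: scales_def)
qed

lemma scales_comp:
  assumes "scales d g b" "scales d h c"
  shows "scales d (\<lambda>z. g (h z)) (b * c)"
  unfolding scales_def
proof (intro conjI ballI)
  note g = scalesD[OF assms(1)] and h = scalesD[OF assms(2)]
  show "b * c > 0" using g h by simp
  show "(\<lambda>z. g (h z)) \<in> measurable (leb_Rn d) (leb_Rn d)"
    using measurable_comp[OF h(2) g(2)] by (simp add: comp_def)
  fix S assume S: "S \<in> sets (leb_Rn d)"
  have T: "g -` S \<inter> Rn d \<in> sets (leb_Rn d)" using measurable_sets[OF g(2) S] by simp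
  have "(\<lambda>z. g (h z)) -` S \<inter> Rn d = h -` (g -` S \<inter> Rn d) \<inter> Rn d"
    using measurable_space[OF h(2)] by auto
  then have "lvol d ((\<lambda>z. g (h z)) -` S \<inter> Rn d) * ennreal (b * c)
      = lvol d (h -` (g -` S \<inter> Rn d) \<inter> Rn d) * ennreal c * ennreal b"
    using g(1) h(1) by (simp add: ennreal_mult mult_ac)
  also have "\<dots> = lvol d S" unfolding h(3)[OF T] by (rule g(3)[OF S])
  finally show "lvol d ((\<lambda>z. g (h z)) -` S \<inter> Rn d) * ennreal (b * c) = lvol d S" .
qed

text \<open>Fubini with coordinate \<open>i\<close> integrated first: when the others are fixed, the
  map is affine on a line with slope \<open>a\<close>. As \<open>\<phi>\<close> ignores coordinate
  \<open>i\<close>, both dilations of one coordinate and shears are covered, and the linear maps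
  below are composed of these.\<close>

lemma scales_coordinate:
  assumes i: "i < d" and a: "a \<noteq> 0"
    and \<phi>: "\<phi> \<in> borel_measurable (leb_Rn d)" "\<And>z t. \<phi> (z(i := t)) = \<phi> z"
  shows "scales d (\<lambda>z. z(i := a * z i + \<phi> z)) \<bar>a\<bar>"
  unfolding scales_def
proof (intro conjI ballI)
  show "\<bar>a\<bar> > 0" using a by simp
  note [measurable] = \<phi>(1)
  let ?g = "\<lambda>z::nat \<Rightarrow> real. z(i := a * z i + \<phi> z)"
  show g [measurable]: "?g \<in> measurable (leb_Rn d) (leb_Rn d)"
  proof (rule measurable_PiM_single')
    fix j assume "j \<in> {..<d}"
    then have "(\<lambda>z. ?g z j) \<in> borel_measurable (leb_Rn d)"
      using i coordinate_measurable[of i d] coordinate_measurable[of j d] by (cases "j = i") simp_all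
    then show "(\<lambda>z. ?g z j) \<in> measurable (leb_Rn d) lborel" by simp
  qed (use i in \<open>auto simp: space_PiM PiE_iff extensional_def\<close>)
  fix S assume S: "S \<in> sets (leb_Rn d)"
  define J where "J = {..<d} - {i}"
  have J: "{..<d} = insert i J" "finite J" "i \<notin> J" using i by (auto simp: J_def)
  interpret product_sigma_finite "\<lambda>_::nat. lborel :: real measure" by standard
  have iS [measurable]: "indicator S \<in> borel_measurable (leb_Rn d)" using S by simp
  have iG [measurable]: "(\<lambda>z. indicator S (?g z) :: ennreal) \<in> borel_measurable (leb_Rn d)"
    using measurable_comp[OF g iS] by (simp add: comp_def)
  have "lvol d S = (\<integral>\<^sup>+z. indicator S z \<partial>leb_Rn d)" using S by simp
  also have "\<dots> = (\<integral>\<^sup>+x. (\<integral>\<^sup>+y. indicator S (x(i := y)) \<partial>lborel) \<partial>PiM J (\<lambda>_. lborel))"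
    unfolding J(1) by (rule product_nn_integral_insert) (use J iS in auto)
  also have "\<dots> = (\<integral>\<^sup>+x. \<bar>a\<bar> * (\<integral>\<^sup>+y. indicator S (?g (x(i := y))) \<partial>lborel) \<partial>PiM J (\<lambda>_. lborel))"
  proof (rule nn_integral_cong)
    fix x assume x: "x \<in> space (PiM J (\<lambda>_. lborel :: real measure))"
    have [measurable]: "(\<lambda>y. x(i := y)) \<in> measurable lborel (leb_Rn d)"
      unfolding J(1) using x J by (intro measurable_component_update) auto
    have "(\<integral>\<^sup>+y. indicator S (x(i := y)) \<partial>lborel) = \<bar>a\<bar> * (\<integral>\<^sup>+y. indicator S (x(i := \<phi> x + a * y)) \<partial>lborel)"
      by (rule nn_integral_real_affine[where t="\<phi> x"]) (use a in measurable)
    also have "(\<lambda>y. indicator S (x(i := \<phi> x + a * y)) :: ennreal) = (\<lambda>y. indicator S (?g (x(i := y))))"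
      by (simp add: \<phi>(2) add.commute)
    finally show "(\<integral>\<^sup>+y. indicator S (x(i := y)) \<partial>lborel) = \<bar>a\<bar> * (\<integral>\<^sup>+y. indicator S (?g (x(i := y))) \<partial>lborel)" .
  qed
  also have "\<dots> = \<bar>a\<bar> * (\<integral>\<^sup>+x. (\<integral>\<^sup>+y. indicator S (?g (x(i := y))) \<partial>lborel) \<partial>PiM J (\<lambda>_. lborel))"
  proof (rule nn_integral_cmult)
    have "(\<lambda>(x, y). x(i := y)) \<in> measurable (PiM J (\<lambda>_. lborel :: real measure) \<Otimes>\<^sub>M lborel) (leb_Rn d)"
      unfolding J(1) by (rule measurable_add_dim)
    from measurable_comp[OF this iG]
    have "(\<lambda>p. indicator S (?g ((fst p)(i := snd p))) :: ennreal)
        \<in> borel_measurable (PiM J (\<lambda>_. lborel :: real measure) \<Otimes>\<^sub>M lborel)"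
      by (simp add: comp_def case_prod_beta)
    then show "(\<lambda>x. \<integral>\<^sup>+y. indicator S (?g (x(i := y))) \<partial>lborel) \<in> borel_measurable (PiM J (\<lambda>_. lborel))"
      by (intro lborel.borel_measurable_nn_integral) (simp add: case_prod_beta)
  qed
  also have "(\<integral>\<^sup>+x. (\<integral>\<^sup>+y. indicator S (?g (x(i := y))) \<partial>lborel) \<partial>PiM J (\<lambda>_. lborel))
      = (\<integral>\<^sup>+z. indicator S (?g z) \<partial>leb_Rn d)"
    unfolding J(1) by (rule product_nn_integral_insert[symmetric]) (use J iG in auto)
  also have "\<dots> = (\<integral>\<^sup>+z. indicator (?g -` S \<inter> Rn d) z \<partial>leb_Rn d)"
    by (rule nn_integral_cong) (auto simp: indicator_def)
  also have "\<dots> = lvol d (?g -` S \<inter> Rn d)"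
    using measurable_sets[OF g S] by (intro nn_integral_indicator) simp
  finally show "lvol d (?g -` S \<inter> Rn d) * ennreal \<bar>a\<bar> = lvol d S"
    by (simp add: mult.commute)
qed

definition affm :: "nat \<Rightarrow> (nat \<Rightarrow> nat \<Rightarrow> real) \<Rightarrow> (nat \<Rightarrow> real) \<Rightarrow> (nat \<Rightarrow> real) \<Rightarrow> nat \<Rightarrow> real" where
  "affm d T x z = (\<lambda>i\<in>{..<d}. x i + (\<Sum>j<d. T i j * z j))"

lemma affm_in_Rn [simp]: "affm d T x z \<in> Rn d"
  by (simp add: affm_def)

lemma affm_apply: "i < d \<Longrightarrow> affm d T x z i = x i + (\<Sum>j<d. T i j * z j)"
  by (simp add: affm_def)

lemma linear_measurable [measurable]:
  "(\<lambda>z. \<Sum>j\<in>J. c j * z j) \<in> borel_measurable (leb_Rn d)" if "J \<subseteq> {..<d}"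
proof (rule borel_measurable_sum)
  fix j assume "j \<in> J"
  then have [measurable]: "(\<lambda>z. z j) \<in> borel_measurable (leb_Rn d)"
    using that by (intro coordinate_measurable) auto
  show "(\<lambda>z. c j * z j) \<in> borel_measurable (leb_Rn d)" by measurable
qed

text \<open>The map is a composition of coordinate changes, one per row, carried out from the last
  row upwards. When row \<open>k\<close> is replaced, it reads only coordinates up to
  \<open>k\<close>, and these still have their original values.\<close>

lemma scales_affm_triangular:
  assumes "\<And>i j. i < d \<Longrightarrow> j < d \<Longrightarrow> i < j \<Longrightarrow> T i j = 0" and "\<And>i. i < d \<Longrightarrow> T i i \<noteq> 0"
  shows "scales d (affm d T x) (\<Prod>i<d. \<bar>T i i\<bar>)"
proof -
  define g where "g = (\<lambda>k z i. if i < k \<or> \<not> i < d then z i else x i + (\<Sum>j<d. T i j * z j))"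
  have "scales d (g k) (\<Prod>i=k..<d. \<bar>T i i\<bar>)" if "k \<le> d" for k
    using that
  proof (induction rule: inc_induct)
    case base
    then show ?case by (auto simp: g_def intro: scales_cong[OF scales_id])
  next
    case (step k)
    define h where "h = (\<lambda>z::nat \<Rightarrow> real. z(k := T k k * z k + (x k + (\<Sum>j\<in>{..<d} - {k}. T k j * z j))))"
    have "scales d h \<bar>T k k\<bar>" unfolding h_def
    proof (rule scales_coordinate)
      show "(\<lambda>z. x k + (\<Sum>j\<in>{..<d} - {k}. T k j * z j)) \<in> borel_measurable (leb_Rn d)"
        by (intro borel_measurable_add linear_measurable) auto
      show "x k + (\<Sum>j\<in>{..<d} - {k}. T k j * (z(k := t)) j) = x k + (\<Sum>j\<in>{..<d} - {k}. T k j * z j)" for z t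
        by (auto intro!: sum.cong)
    qed (use step assms in auto)
    then have "scales d (\<lambda>z. h (g (Suc k) z)) (\<bar>T k k\<bar> * (\<Prod>i=Suc k..<d. \<bar>T i i\<bar>))"
      using step.IH by (rule scales_comp)
    moreover have "h (g (Suc k) z) = g k z" for z
    proof
      fix i
      show "h (g (Suc k) z) i = g k z i"
      proof (cases "i = k")
        case True
        have "(\<Sum>j\<in>{..<d} - {k}. T k j * g (Suc k) z j) = (\<Sum>j\<in>{..<d} - {k}. T k j * z j)"
          using assms(1) step.hyps by (intro sum.cong) (auto simp: g_def not_less_eq)
        then show ?thesis using True step.hyps
          by (simp add: h_def g_def sum.remove[of "{..<d}" k])
      qed (auto simp: h_def g_def)
    qed
    ultimately show ?case using step.hyps by (simp add: prod.atLeast_Suc_lessThan)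
  qed
  from this[of 0] have "scales d (g 0) (\<Prod>i<d. \<bar>T i i\<bar>)" by (simp add: atLeast0LessThan)
  then show ?thesis
    by (rule scales_cong) (auto simp: g_def affm_def Rn_outside)
qed

text \<open>Gaussian elimination by coordinate changes, where \<open>k\<close> counts the rows not
  yet reduced to rows of the identity. If the pivot \<open>A k k\<close> is nonzero, the map factors
  through the change \<open>h\<close> of coordinate \<open>k\<close> to the value of row
  \<open>k\<close>, and the other factor \<open>A'\<close> has one more identity row. Only the
  existence of a scaling factor is claimed; for orthonormal rows its value will follow from the
  invariance of the unit ball.\<close>

lemma scales_affm_surj_aux:
  assumes "k \<le> d"
    and "\<And>i j. k \<le> i \<Longrightarrow> i < d \<Longrightarrow> j < d \<Longrightarrow> A i j = (if i = j then 1 else 0)"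
    and "\<And>y. y \<in> Rn d \<Longrightarrow> \<exists>z. affm d A (\<lambda>_. 0) z = y"
  shows "\<exists>c. scales d (affm d A (\<lambda>_. 0)) c"
  using assms
proof (induction k arbitrary: A)
  case 0
  have "affm d A (\<lambda>_. 0) z = z" if "z \<in> Rn d" for z
  proof (rule Rn_eqI[of _ d])
    fix i assume i: "i < d"
    have "affm d A (\<lambda>_. 0) z i = (\<Sum>j<d. if i = j then z j else 0)"
      unfolding affm_apply[OF i] add_0 by (rule sum.cong) (use 0(2) i in auto)
    then show "affm d A (\<lambda>_. 0) z i = z i" using i by simp
  qed (use that in auto)
  then have "scales d (affm d A (\<lambda>_. 0)) 1" by (intro scales_cong[OF scales_id]) auto
  then show ?case by blast
next
  case (Suc k)
  have k: "k < d" using Suc.prems by simp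
  have pivot: "\<exists>c. scales d (affm d A (\<lambda>_. 0)) c" if akk: "A k k \<noteq> 0"
    and id: "\<And>i j. Suc k \<le> i \<Longrightarrow> i < d \<Longrightarrow> j < d \<Longrightarrow> A i j = (if i = j then 1 else 0)"
    and surj: "\<And>y. y \<in> Rn d \<Longrightarrow> \<exists>z. affm d A (\<lambda>_. 0) z = y" for A
  proof -
    define h where "h = (\<lambda>z::nat \<Rightarrow> real. z(k := A k k * z k + (\<Sum>j\<in>{..<d} - {k}. A k j * z j)))"
    define A' where "A' = (\<lambda>i j. if j = k then A i k / A k k else A i j - A i k * A k j / A k k)"
    have eq: "affm d A (\<lambda>_. 0) z = affm d A' (\<lambda>_. 0) (h z)" for z
    proof (rule Rn_eqI[of _ d])
      fix i assume i: "i < d"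
      have "(\<Sum>j<d. A' i j * h z j) = A' i k * h z k + (\<Sum>j\<in>{..<d} - {k}. A' i j * h z j)"
        using k by (simp add: sum.remove[of "{..<d}" k])
      also have "(\<Sum>j\<in>{..<d} - {k}. A' i j * h z j) = (\<Sum>j\<in>{..<d} - {k}. A i j * z j - A i k / A k k * (A k j * z j))"
        by (intro sum.cong) (auto simp: A'_def h_def algebra_simps)
      also have "A' i k * h z k = A i k * z k + A i k / A k k * (\<Sum>j\<in>{..<d} - {k}. A k j * z j)"
        using akk by (simp add: A'_def h_def field_simps)
      also have "A i k * z k + A i k / A k k * (\<Sum>j\<in>{..<d} - {k}. A k j * z j)
          + (\<Sum>j\<in>{..<d} - {k}. A i j * z j - A i k / A k k * (A k j * z j)) = (\<Sum>j<d. A i j * z j)"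
        using k by (simp add: sum.remove[of "{..<d}" k] sum_subtractf sum_distrib_left sum_divide_distrib)
      finally show "affm d A (\<lambda>_. 0) z i = affm d A' (\<lambda>_. 0) (h z) i"
        using i by (simp add: affm_apply)
    qed simp_all
    have "\<exists>c. scales d (affm d A' (\<lambda>_. 0)) c"
    proof (rule Suc.IH)
      show "A' i j = (if i = j then 1 else 0)" if "k \<le> i" "i < d" "j < d" for i j
        using that akk id[of i] k by (cases "i = k") (auto simp: A'_def)
      show "\<exists>z. affm d A' (\<lambda>_. 0) z = y" if "y \<in> Rn d" for y
        using surj[OF that] eq by auto
    qed (use k in simp)
    then obtain c where "scales d (affm d A' (\<lambda>_. 0)) c" by blast
    moreover have "scales d h \<bar>A k k\<bar>" unfolding h_def
    proof (rule scales_coordinate)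
      show "(\<lambda>z. \<Sum>j\<in>{..<d} - {k}. A k j * z j) \<in> borel_measurable (leb_Rn d)"
        by (intro linear_measurable) auto
      show "(\<Sum>j\<in>{..<d} - {k}. A k j * (z(k := t)) j) = (\<Sum>j\<in>{..<d} - {k}. A k j * z j)" for z t
        by (auto intro!: sum.cong)
    qed (use k akk in auto)
    ultimately have "scales d (\<lambda>z. affm d A' (\<lambda>_. 0) (h z)) (c * \<bar>A k k\<bar>)" by (rule scales_comp)
    then have "scales d (affm d A (\<lambda>_. 0)) (c * \<bar>A k k\<bar>)" by (rule scales_cong) (simp add: eq)
    then show ?thesis by blast
  qed
  show ?case
  proof (cases "A k k = 0")
    case False
    then show ?thesis using pivot Suc.prems by blast
  next
    case True
    \<comment> \<open>Otherwise row \<open>k\<close> would vanish up to the diagonal, while the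
      identity rows below it force the later coordinates of a preimage of the \<open>k\<close>-th
      unit vector to be 0; there would be no preimage.\<close>
    have "\<exists>m<k. A k m \<noteq> 0"
    proof (rule ccontr)
      assume n: "\<not> ?thesis"
      define y where "y = (\<lambda>i\<in>{..<d}. if i = k then 1 else 0 :: real)"
      have "y \<in> Rn d" unfolding y_def by (rule restrict_in_Rn)
      then obtain z where z: "affm d A (\<lambda>_. 0) z = y" using Suc.prems(3) by blast
      have "z i = 0" if "k < i" "i < d" for i
      proof -
        have "0 = affm d A (\<lambda>_. 0) z i" using that by (simp add: z y_def)
        also have "\<dots> = (\<Sum>j<d. if i = j then z j else 0)"
          unfolding affm_apply[OF that(2)] add_0
          by (rule sum.cong) (use Suc.prems(2)[of i] that in auto)
        finally show ?thesis using that by simp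
      qed
      then have "(\<Sum>j<d. A k j * z j) = 0" using n True
        by (intro sum.neutral) (metis lessThan_iff linorder_neqE_nat mult_eq_0_iff)
      moreover have "affm d A (\<lambda>_. 0) z k = 1" using k by (simp add: z y_def)
      ultimately show False using k by (simp add: affm_apply)
    qed
    then obtain m where m: "m < k" "A k m \<noteq> 0" by blast
    \<comment> \<open>Adding column \<open>m\<close> to column \<open>k\<close> makes the pivot
      nonzero; the shear \<open>h\<close> compensates.\<close>
    define h where "h = (\<lambda>z::nat \<Rightarrow> real. z(m := 1 * z m + - z k))"
    define A' where "A' = (\<lambda>i j. if j = k then A i k + A i m else A i j)"
    have eq: "affm d A (\<lambda>_. 0) z = affm d A' (\<lambda>_. 0) (h z)" for z
    proof (rule Rn_eqI[of _ d])
      fix i assume i: "i < d"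
      have sp: "(\<Sum>j<d. f j) = f k + f m + (\<Sum>j\<in>{..<d} - {k} - {m}. f j)" for f :: "nat \<Rightarrow> real"
        using k m by (simp add: sum.remove[of "{..<d}" k] sum.remove[of "{..<d} - {k}" m])
      have "(\<Sum>j\<in>{..<d} - {k} - {m}. A' i j * h z j) = (\<Sum>j\<in>{..<d} - {k} - {m}. A i j * z j)"
        by (intro sum.cong) (auto simp: A'_def h_def)
      then show "affm d A (\<lambda>_. 0) z i = affm d A' (\<lambda>_. 0) (h z) i"
        using i m by (simp add: affm_apply sp) (simp add: A'_def h_def algebra_simps)
    qed simp_all
    have "\<exists>c. scales d (affm d A' (\<lambda>_. 0)) c"
    proof (rule pivot)
      show "A' k k \<noteq> 0" using m True by (simp add: A'_def)
      show "A' i j = (if i = j then 1 else 0)" if "Suc k \<le> i" "i < d" "j < d" for i j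
        using that Suc.prems(2)[of i] m k by (auto simp: A'_def)
      show "\<exists>z. affm d A' (\<lambda>_. 0) z = y" if "y \<in> Rn d" for y
        using Suc.prems(3)[OF that] eq by auto
    qed
    then obtain c where "scales d (affm d A' (\<lambda>_. 0)) c" by blast
    moreover have "scales d h \<bar>1\<bar>" unfolding h_def
    proof (rule scales_coordinate)
      show "(\<lambda>z. - z k) \<in> borel_measurable (leb_Rn d)"
        using coordinate_measurable[OF k] by simp
    qed (use k m in auto)
    ultimately have "scales d (\<lambda>z. affm d A' (\<lambda>_. 0) (h z)) (c * \<bar>1\<bar>)" by (rule scales_comp)
    then have "scales d (affm d A (\<lambda>_. 0)) (c * \<bar>1\<bar>)" by (rule scales_cong) (simp add: eq)
    then show ?thesis by blast
  qed
qed

lemma scales_affm_surj: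
  assumes "\<And>y. y \<in> Rn d \<Longrightarrow> \<exists>z. affm d A (\<lambda>_. 0) z = y"
  shows "\<exists>c. scales d (affm d A (\<lambda>_. 0)) c"
  using assms by (intro scales_affm_surj_aux[where k=d]) auto

definition uball :: "nat \<Rightarrow> (nat \<Rightarrow> real) set" where
  "uball d = {z\<in>Rn d. (\<Sum>i<d. (z i)\<^sup>2) \<le> 1}"

lemma uball_sets [measurable]: "uball d \<in> sets (leb_Rn d)"
proof -
  have "(\<lambda>z. \<Sum>i<d. (z i)\<^sup>2) \<in> borel_measurable (leb_Rn d)"
  proof (rule borel_measurable_sum)
    fix i assume "i \<in> {..<d}"
    then have [measurable]: "(\<lambda>z. z i) \<in> borel_measurable (leb_Rn d)"
      by (intro coordinate_measurable) auto
    show "(\<lambda>z. (z i)\<^sup>2) \<in> borel_measurable (leb_Rn d)" by measurable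
  qed
  then have "{z \<in> space (leb_Rn d). (\<Sum>i<d. (z i)\<^sup>2) \<le> 1} \<in> sets (leb_Rn d)" by measurable
  then show ?thesis by (simp add: uball_def)
qed

lemma emeasure_uball: "lvol d (uball d) = ennreal (unit_ball_vol (real d))"
proof -
  have "uball d = {f. sqrt (\<Sum>i\<in>{..<d}. (f i)\<^sup>2) \<le> 1} \<inter> space (leb_Rn d)"
    by (auto simp: uball_def)
  then show ?thesis using emeasure_cball_aux[of "{..<d}" 1] by simp
qed

lemma emeasure_simplex:
  assumes "t \<ge> 0"
  shows "{z\<in>Rn d. (\<forall>i<d. 0 \<le> z i) \<and> (\<Sum>i<d. z i) \<le> t} \<in> sets (leb_Rn d)"
    "lvol d {z\<in>Rn d. (\<forall>i<d. 0 \<le> z i) \<and> (\<Sum>i<d. z i) \<le> t} = ennreal (t ^ d / fact d)"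
proof -
  have eq: "{z\<in>Rn d. (\<forall>i<d. 0 \<le> z i) \<and> (\<Sum>i<d. z i) \<le> t}
      = {x. (\<forall>i\<in>{..<d}. 0 \<le> x i) \<and> sum x {..<d} \<le> t} \<inter> space (leb_Rn d)" by auto
  note [measurable] = coordinate_measurable
  have "{z\<in>space (leb_Rn d). (\<forall>i\<in>{..<d}. 0 \<le> z i) \<and> (\<Sum>i\<in>{..<d}. z i) \<le> t} \<in> sets (leb_Rn d)"
    by measurable
  then show "{z\<in>Rn d. (\<forall>i<d. 0 \<le> z i) \<and> (\<Sum>i<d. z i) \<le> t} \<in> sets (leb_Rn d)"
    by (simp only: space_leb_Rn Ball_def lessThan_iff)
  show "lvol d {z\<in>Rn d. (\<forall>i<d. 0 \<le> z i) \<and> (\<Sum>i<d. z i) \<le> t} = ennreal (t ^ d / fact d)"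
    unfolding eq using emeasure_std_simplex_aux[of "{..<d}" t] assms by simp
qed

text \<open>The \<open>d\<close> rows and the \<open>a\<close>-th unit vector are linearly
  dependent. Pairing the dependence with each row reads off its coefficients, so the unit vector
  expands in the rows with coefficients \<open>f l a\<close>; the claim is its \<open>b\<close>-th
  coordinate.\<close>

lemma orthonormal_dual:
  fixes f :: "nat \<Rightarrow> nat \<Rightarrow> real"
  assumes on: "\<And>k l. k < d \<Longrightarrow> l < d \<Longrightarrow> (\<Sum>a<d. f k a * f l a) = (if k = l then 1 else 0)"
    and a: "a < d" and b: "b < d"
  shows "(\<Sum>k<d. f k a * f k b) = (if a = b then 1 else 0)"
proof -
  define v where "v = f(d := (\<lambda>i. if i = a then 1 else 0))"
  obtain c where c: "\<exists>j\<in>{..d}. c j \<noteq> 0" "\<forall>i\<in>{..<d}. (\<Sum>j\<le>d. c j * v j i) = 0"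
    using linear_dependence[of "{..<d}" "{..d}" v] by auto
  have e: "(\<Sum>j<d. c j * f j i) + c d * (if i = a then 1 else 0) = 0" if "i < d" for i
  proof -
    have "(\<Sum>j\<le>d. c j * v j i) = (\<Sum>j<d. c j * v j i) + c d * v d i"
      by (simp add: lessThan_Suc_atMost[symmetric])
    also have "(\<Sum>j<d. c j * v j i) = (\<Sum>j<d. c j * f j i)" by (intro sum.cong) (auto simp: v_def)
    finally show ?thesis using c(2) that by (simp add: v_def)
  qed
  have cl: "c l + c d * f l a = 0" if "l < d" for l
  proof -
    have "0 = (\<Sum>i<d. ((\<Sum>j<d. c j * f j i) + c d * (if i = a then 1 else 0)) * f l i)"
      using e by simp
    also have "\<dots> = (\<Sum>i<d. \<Sum>j<d. c j * (f j i * f l i)) + (\<Sum>i<d. if i = a then c d * f l i else 0)"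
      unfolding sum.distrib[symmetric]
      by (intro sum.cong) (auto simp: distrib_right sum_distrib_right mult.assoc)
    also have "(\<Sum>i<d. \<Sum>j<d. c j * (f j i * f l i)) = (\<Sum>j<d. c j * (\<Sum>i<d. f j i * f l i))"
      by (subst sum.swap) (simp add: sum_distrib_left)
    also have "\<dots> = (\<Sum>j<d. if j = l then c j else 0)"
      using on that by (intro sum.cong) auto
    finally show ?thesis using a that by simp
  qed
  have "c d \<noteq> 0"
  proof
    assume "c d = 0"
    with cl c(1) show False by (metis add_0_right atMost_iff le_neq_implies_less mult_zero_left)
  qed
  have "(\<Sum>j<d. c j * f j b) = (\<Sum>j<d. - c d * (f j a * f j b))"
  proof (rule sum.cong)
    fix j assume "j \<in> {..<d}"
    then have "c j = - c d * f j a" using cl[of j] by simp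
    then show "c j * f j b = - c d * (f j a * f j b)" by simp
  qed simp
  also have "\<dots> = - c d * (\<Sum>k<d. f k a * f k b)" by (simp only: sum_distrib_left)
  finally have "- c d * (\<Sum>k<d. f k a * f k b) + c d * (if b = a then 1 else 0) = 0"
    using e[OF b] by simp
  then show ?thesis using \<open>c d \<noteq> 0\<close> by (auto split: if_splits)
qed

text \<open>The transpose is a right inverse, so the map is onto and some factor exists. The map
  preserves the unit ball, whose volume is positive and finite, so the factor is 1.\<close>

lemma scales_orthonormal:
  fixes f :: "nat \<Rightarrow> nat \<Rightarrow> real"
  assumes on: "\<And>k l. k < d \<Longrightarrow> l < d \<Longrightarrow> (\<Sum>a<d. f k a * f l a) = (if k = l then 1 else 0)"
  shows "scales d (affm d f (\<lambda>_. 0)) 1"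
proof -
  have "\<exists>z. affm d f (\<lambda>_. 0) z = y" if y: "y \<in> Rn d" for y
  proof (intro exI Rn_eqI[of _ d])
    fix i assume i: "i < d"
    have "(\<Sum>j<d. f i j * (\<Sum>k<d. y k * f k j)) = (\<Sum>k<d. y k * (\<Sum>j<d. f i j * f k j))"
      unfolding sum_distrib_left by (subst sum.swap) (simp add: mult_ac)
    also have "\<dots> = (\<Sum>k<d. if i = k then y k else 0)" using on i by (intro sum.cong) auto
    finally show "affm d f (\<lambda>_. 0) (\<lambda>j. \<Sum>k<d. y k * f k j) i = y i" using i by (simp add: affm_apply)
  qed (use y in auto)
  then obtain c where c: "scales d (affm d f (\<lambda>_. 0)) c" using scales_affm_surj by blast
  have parseval: "(\<Sum>k<d. (\<Sum>a<d. f k a * z a)\<^sup>2) = (\<Sum>a<d. (z a)\<^sup>2)" for z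
  proof -
    have "(\<Sum>k<d. (\<Sum>a<d. f k a * z a)\<^sup>2) = (\<Sum>k<d. \<Sum>a<d. \<Sum>b<d. z a * z b * (f k a * f k b))"
      by (simp add: power2_eq_square sum_product mult_ac)
    also have "\<dots> = (\<Sum>a<d. \<Sum>b<d. z a * z b * (\<Sum>k<d. f k a * f k b))"
      by (subst sum.swap, rule sum.cong[OF refl], subst sum.swap) (simp add: sum_distrib_left)
    also have "\<dots> = (\<Sum>a<d. \<Sum>b<d. if a = b then z a * z b else 0)"
      using orthonormal_dual[OF on] by (intro sum.cong) auto
    finally show ?thesis by (simp add: power2_eq_square)
  qed
  have "affm d f (\<lambda>_. 0) -` uball d \<inter> Rn d = uball d"
    by (auto simp: uball_def affm_apply parseval)
  with scalesD(3)[OF c uball_sets] have "ennreal (unit_ball_vol d) * ennreal c = ennreal (unit_ball_vol d)"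
    by (simp add: emeasure_uball)
  then have "unit_ball_vol d * c = unit_ball_vol d"
    using scalesD(1)[OF c] by (simp add: ennreal_mult[symmetric])
  then have "c = 1" using unit_ball_vol_pos[of "real d"] by (auto simp del: unit_ball_vol_pos)
  with c show ?thesis by simp
qed

section \<open>Convex sets in coordinate space\<close>

lemma convex_RnD:
  assumes "convex_Rn d S"
  shows "S \<subseteq> Rn d" "fconvex S"
proof -
  show sub: "S \<subseteq> Rn d" using assms by (simp add: convex_Rn_def)
  show "fconvex S"
  proof (rule fconvexI)
    fix x y and t :: real assume xy: "x \<in> S" "y \<in> S" and t: "0 \<le> t" "t \<le> 1"
    then have "(\<lambda>i\<in>{..<d}. (1 - t) * x i + t * y i) \<in> S"
      using assms unfolding convex_Rn_def by (meson diff_add_cancel diff_ge_0_iff_ge)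
    moreover have "(\<lambda>i\<in>{..<d}. (1 - t) * x i + t * y i) = (\<lambda>i. (1 - t) * x i + t * y i)"
      using xy sub by (intro Rn_eqI[of _ d]) (auto intro!: fconvexD[OF fconvex_Rn] simp: t)
    ultimately show "(\<lambda>i. (1 - t) * x i + t * y i) \<in> S" by simp
  qed
qed

lemma continuous_on_coordinate: "continuous_on A (\<lambda>x::'i \<Rightarrow> real. x i)"
  by (rule continuous_on_product_then_coordinatewise[OF continuous_on_id])

lemma closed_Rn: "closed (Rn d)"
proof -
  have "Rn d = {x. \<forall>i. \<not> i < d \<longrightarrow> x i = undefined}" by (auto simp: Rn_outside intro: Rn_I)
  also have "closed \<dots>"
    by (intro closed_Collect_all closed_Collect_imp closed_Collect_eq continuous_on_coordinate continuous_on_const) simp_all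
  finally show ?thesis .
qed

text \<open>The topology is that of all functions on \<open>nat\<close>, the measure lives on
  extensional functions; padding with \<open>undefined\<close> is a measurable map from the latter
  to the former.\<close>

lemma closed_in_sets_leb_Rn:
  assumes "closed A" shows "A \<inter> Rn d \<in> sets (leb_Rn d)"
proof -
  have "(\<lambda>z i. if i < d then z i else undefined) \<in> measurable (leb_Rn d) (PiM UNIV (\<lambda>_. borel))"
  proof (rule measurable_PiM_single')
    show "(\<lambda>z. if i < d then z i else undefined) \<in> borel_measurable (leb_Rn d)" for i
      by (cases "i < d") (simp_all add: coordinate_measurable)
  qed auto
  then have m: "(\<lambda>z i. if i < d then z i else undefined) \<in> borel_measurable (leb_Rn d)"
    using sets_PiM_equal_borel measurable_cong_sets by blast
  have "(\<lambda>z i. if i < d then z i else undefined) -` A \<inter> space (leb_Rn d) \<in> sets (leb_Rn d)"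
    using assms by (intro measurable_sets[OF m]) auto
  also have "(\<lambda>z i. if i < d then z i else undefined) -` A \<inter> space (leb_Rn d) = A \<inter> Rn d"
  proof -
    have "(\<lambda>i. if i < d then z i else undefined) = z" if "z \<in> Rn d" for z
      using that by (auto simp: Rn_outside)
    then show ?thesis by auto
  qed
  finally show ?thesis .
qed

text \<open>Cubes take the role of balls: as products of intervals they are measurable and compact,
  and a small cube inside a convex set witnesses its interior.\<close>

definition cubeR :: "nat \<Rightarrow> (nat \<Rightarrow> real) \<Rightarrow> real \<Rightarrow> (nat \<Rightarrow> real) set" where
  "cubeR d c r = {z\<in>Rn d. \<forall>i<d. \<bar>z i - c i\<bar> \<le> r}"

lemma cubeR_eq_PiE: "cubeR d c r = PiE {..<d} (\<lambda>i. {c i - r..c i + r})"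
proof -
  have "\<bar>x - a\<bar> \<le> r \<longleftrightarrow> x \<in> {a - r..a + r}" for x a :: real by auto
  then show ?thesis unfolding cubeR_def Rn_def PiE_iff set_eq_iff by auto
qed

lemma cubeR_sets: "cubeR d c r \<in> sets (leb_Rn d)"
  unfolding cubeR_eq_PiE by (rule sets_PiM_I_finite) auto

lemma closed_cubeR: "closed (cubeR d c r)"
proof -
  have "closed {z. \<forall>i. i < d \<longrightarrow> \<bar>z i - c i\<bar> \<le> r}"
    by (intro closed_Collect_all closed_Collect_imp closed_Collect_le continuous_intros continuous_on_coordinate) simp_all
  then have "closed (Rn d \<inter> {z. \<forall>i. i < d \<longrightarrow> \<bar>z i - c i\<bar> \<le> r})" by (intro closed_Int closed_Rn)
  also have "Rn d \<inter> {z. \<forall>i. i < d \<longrightarrow> \<bar>z i - c i\<bar> \<le> r} = cubeR d c r" by (auto simp: cubeR_def)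
  finally show ?thesis .
qed

lemma compact_cubeR: "compact (cubeR d c r)"
proof -
  have "compact (PiE UNIV (\<lambda>i. if i < d then {c i - r..c i + r} else {undefined::real}))"
    by (rule compact_PiE_UNIV) auto
  also have "PiE UNIV (\<lambda>i. if i < d then {c i - r..c i + r} else {undefined::real}) = cubeR d c r"
    unfolding cubeR_eq_PiE PiE_iff set_eq_iff extensional_def by force
  finally show ?thesis .
qed

lemma fconvex_cubeR: "fconvex (cubeR d c r)"
proof (rule fconvexI)
  fix x y and t :: real assume xy: "x \<in> cubeR d c r" "y \<in> cubeR d c r" and t: "0 \<le> t" "t \<le> 1"
  have "\<bar>(1 - t) * x i + t * y i - c i\<bar> \<le> r" if "i < d" for i
  proof -
    have "\<bar>(1 - t) * x i + t * y i - c i\<bar> = \<bar>(1 - t) * (x i - c i) + t * (y i - c i)\<bar>"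
      by (simp add: algebra_simps)
    also have "\<dots> \<le> (1 - t) * \<bar>x i - c i\<bar> + t * \<bar>y i - c i\<bar>"
      using t by (intro abs_triangle_ineq[THEN order_trans]) (simp add: abs_mult)
    also have "\<dots> \<le> (1 - t) * r + t * r"
      using xy t that by (intro add_mono mult_left_mono) (auto simp: cubeR_def)
    finally show ?thesis by (simp add: algebra_simps)
  qed
  then show "(\<lambda>i. (1 - t) * x i + t * y i) \<in> cubeR d c r"
    using xy t fconvexD[OF fconvex_Rn] by (auto simp: cubeR_def)
qed

text \<open>Approximate \<open>y\<close> by some \<open>y'\<close> in \<open>S\<close>. The error,
  scaled down by the contraction towards \<open>c\<close>, can be shifted to the centre, where the
  cube absorbs it.\<close>

lemma closure_shrink:
  assumes S: "fconvex S" "S \<subseteq> Rn d" and c: "c \<in> Rn d" "0 < r" "cubeR d c r \<subseteq> S"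
    and y: "y \<in> closure S" and t: "0 \<le> t" "t < 1"
  shows "(\<lambda>i. (1 - t) * c i + t * y i) \<in> S"
proof -
  define \<eta> where "\<eta> = r * (1 - t)"
  have \<eta>: "\<eta> > 0" using c t by (simp add: \<eta>_def)
  have yR: "y \<in> Rn d" using y closure_minimal[OF S(2) closed_Rn] by blast
  have "open (\<Inter>i\<in>{..<d}. {z. \<bar>z i - y i\<bar> < \<eta>})"
    by (intro open_INT ballI open_Collect_less continuous_intros continuous_on_coordinate) auto
  also have "(\<Inter>i\<in>{..<d}. {z. \<bar>z i - y i\<bar> < \<eta>}) = {z. \<forall>i\<in>{..<d}. \<bar>z i - y i\<bar> < \<eta>}" by auto
  finally have "open {z. \<forall>i\<in>{..<d}. \<bar>z i - y i\<bar> < \<eta>}" .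
  moreover have "y \<in> {z. \<forall>i\<in>{..<d}. \<bar>z i - y i\<bar> < \<eta>}" using \<eta> by simp
  ultimately have "{z. \<forall>i\<in>{..<d}. \<bar>z i - y i\<bar> < \<eta>} \<inter> S \<noteq> {}"
    using y open_Int_closure_eq_empty by blast
  then obtain y' where y': "y' \<in> S" "\<And>i. i < d \<Longrightarrow> \<bar>y' i - y i\<bar> < \<eta>" by auto
  \<comment> \<open>Solves \<open>(1 - t) * q + t * y' = (1 - t) * c + t * y\<close>; the choice of
    \<open>\<eta>\<close> keeps it in the cube.\<close>
  define q where "q = (\<lambda>i\<in>{..<d}. c i + t / (1 - t) * (y i - y' i))"
  have "\<bar>q i - c i\<bar> \<le> r" if "i < d" for i
  proof -
    have "\<bar>q i - c i\<bar> = t / (1 - t) * \<bar>y' i - y i\<bar>"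
      using that t by (simp add: q_def abs_mult abs_minus_commute)
    also have "\<dots> \<le> 1 / (1 - t) * \<eta>"
      using y'(2)[OF that] t by (intro mult_mono divide_right_mono) auto
    also have "\<dots> = r" using t by (simp add: \<eta>_def)
    finally show ?thesis .
  qed
  then have "q \<in> cubeR d c r" by (simp add: cubeR_def q_def)
  then have "(\<lambda>i. (1 - t) * q i + t * y' i) \<in> S"
    using S(1) c(3) y'(1) t by (intro fconvexD) auto
  also have "(\<lambda>i. (1 - t) * q i + t * y' i) = (\<lambda>i. (1 - t) * c i + t * y i)"
  proof
    fix i
    show "(1 - t) * q i + t * y' i = (1 - t) * c i + t * y i"
    proof (cases "i < d")
      case True
      then have "(1 - t) * q i = (1 - t) * c i + t * (y i - y' i)"
        using t by (simp add: q_def field_simps)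
      then show ?thesis by (simp add: algebra_simps)
    next
      case False
      then show ?thesis using c(1) yR y'(1) S(2) by (auto simp: q_def Rn_outside)
    qed
  qed
  finally show ?thesis .
qed

text \<open>Replacing coordinate \<open>k\<close> by the linear form turns the hyperplane into a
  product with a one-point factor.\<close>

lemma hyperplane_null:
  assumes k: "k < d" "a k \<noteq> 0"
  shows "{z\<in>Rn d. (\<Sum>j<d. a j * z j) = b} \<in> null_sets (leb_Rn d)"
proof -
  define h where "h = (\<lambda>z::nat \<Rightarrow> real. z(k := a k * z k + (\<Sum>j\<in>{..<d} - {k}. a j * z j)))"
  have h: "scales d h \<bar>a k\<bar>" unfolding h_def
  proof (rule scales_coordinate)
    show "(\<lambda>z. \<Sum>j\<in>{..<d} - {k}. a j * z j) \<in> borel_measurable (leb_Rn d)"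
      by (intro linear_measurable) auto
    show "(\<Sum>j\<in>{..<d} - {k}. a j * (z(k := t)) j) = (\<Sum>j\<in>{..<d} - {k}. a j * z j)" for z t
      by (auto intro!: sum.cong)
  qed (use k in auto)
  define P where "P = PiE {..<d} (\<lambda>i. if i = k then {b} else UNIV)"
  have P: "P \<in> sets (leb_Rn d)" unfolding P_def by (rule sets_PiM_I_finite) auto
  interpret product_sigma_finite "\<lambda>_::nat. lborel :: real measure" by standard
  have "lvol d P = (\<Prod>i<d. emeasure lborel (if i = k then {b} else UNIV))"
    unfolding P_def by (subst emeasure_PiM) auto
  also have "\<dots> = 0" using k by (intro prod_zero) (auto intro!: bexI[of _ k])
  finally have "lvol d (h -` P \<inter> Rn d) * ennreal \<bar>a k\<bar> = 0"
    using scalesD(3)[OF h P] by simp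
  then have "lvol d (h -` P \<inter> Rn d) = 0" using k by simp
  moreover have "h -` P \<inter> Rn d \<in> sets (leb_Rn d)" using measurable_sets[OF scalesD(2)[OF h] P] by simp
  moreover have "h -` P \<inter> Rn d = {z\<in>Rn d. (\<Sum>j<d. a j * z j) = b}"
  proof -
    have "h z k = (\<Sum>j<d. a j * z j)" for z
      using k by (simp add: h_def sum.remove[of "{..<d}" k])
    moreover have "h z \<in> P \<longleftrightarrow> h z k = b" if "z \<in> Rn d" for z
    proof -
      have "h z \<in> Rn d" using that k by (simp add: h_def Rn_fun_upd)
      then show ?thesis using k by (auto simp: P_def Rn_def PiE_iff split: if_splits)
    qed
    ultimately show ?thesis by auto
  qed
  ultimately show ?thesis by (auto simp: null_sets_def)
qed

text \<open>Take \<open>P\<close> in \<open>S\<close> of maximal size with linearly independent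
  differences \<open>x - p\<close>. If there are fewer than \<open>d\<close>, all of
  \<open>S\<close> lies in a hyperplane, hence is null in the completion, whether or not it was
  known to be measurable. Otherwise \<open>p\<close> and \<open>P\<close> span a simplex, and the
  cube sits around its barycentre.\<close>

lemma pos_volume_contains_cube:
  assumes S: "fconvex S" "S \<subseteq> Rn d" and pos: "vol_Rn d S \<noteq> 0"
  shows "\<exists>c\<in>Rn d. \<exists>r>0. cubeR d c r \<subseteq> S"
proof -
  from pos have "S \<noteq> {}" by (auto simp: vol_Rn_def)
  then obtain p where p: "p \<in> S" by blast
  define ind where "ind = (\<lambda>P. finite P \<and> P \<subseteq> S \<and>
    (\<forall>c. (\<forall>i<d. (\<Sum>x\<in>P. c x * (x i - p i)) = 0) \<longrightarrow> (\<forall>x\<in>P. c x = 0)))"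
  have "card P \<le> d" if "ind P" for P
  proof (rule ccontr)
    assume "\<not> card P \<le> d"
    moreover have "finite P" using that by (simp add: ind_def)
    ultimately have "\<exists>c. (\<exists>x\<in>P. c x \<noteq> 0) \<and> (\<forall>i\<in>{..<d}. (\<Sum>x\<in>P. c x * (x i - p i)) = 0)"
      by (intro linear_dependence) auto
    with that show False by (auto simp: ind_def)
  qed
  moreover have "ind {}" by (simp add: ind_def)
  ultimately obtain P where P: "ind P" and Pmax: "\<And>Q. ind Q \<Longrightarrow> card Q \<le> card P" and Pd: "card P \<le> d"
    using ex_has_greatest_nat[of ind "{}" card "Suc d"] by (metis le_imp_less_Suc)
  have finP: "finite P" and PS: "P \<subseteq> S" using P by (auto simp: ind_def)
  \<comment> \<open>Independence of the differences makes the coefficient \<open>c0\<close> of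
    \<open>y\<close> nonzero, so the relation can be solved for \<open>y\<close>.\<close>
  have expand: "\<exists>b. \<forall>i<d. y i = (\<Sum>x\<in>P. b x * (x i - p i))"
    if nz: "c0 \<noteq> 0 \<or> (\<exists>x\<in>P. c x \<noteq> 0)"
      and eq: "\<And>i. i < d \<Longrightarrow> c0 * y i + (\<Sum>x\<in>P. c x * (x i - p i)) = 0" for y c0 c
  proof -
    have c0: "c0 \<noteq> 0"
    proof
      assume "c0 = 0"
      with eq have "\<forall>i<d. (\<Sum>x\<in>P. c x * (x i - p i)) = 0" by simp
      with P nz \<open>c0 = 0\<close> show False unfolding ind_def by blast
    qed
    have "y i = (\<Sum>x\<in>P. (- c x / c0) * (x i - p i))" if "i < d" for i
    proof -
      have "(\<Sum>x\<in>P. (- c x / c0) * (x i - p i)) = - (\<Sum>x\<in>P. c x * (x i - p i)) / c0"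
        by (simp add: sum_divide_distrib sum_negf)
      also have "(\<Sum>x\<in>P. c x * (x i - p i)) = - (c0 * y i)" using eq[OF that] by (simp only: add_eq_0_iff)
      also have "- (- (c0 * y i)) / c0 = y i" using c0 by simp
      finally show ?thesis by simp
    qed
    then show ?thesis by (intro exI[of _ "\<lambda>x. - c x / c0"] allI impI)
  qed
  show ?thesis
  proof (cases "card P < d")
    case True
    \<comment> \<open>A normal vector of the hyperplane, orthogonal to the fewer than
      \<open>d\<close> differences.\<close>
    then obtain a where a: "\<exists>j\<in>{..<d}. a j \<noteq> 0" "\<forall>x\<in>P. (\<Sum>j\<in>{..<d}. a j * (x j - p j)) = 0"
      using linear_dependence[of P "{..<d}" "\<lambda>j x. x j - p j"] finP by auto
    have "(\<Sum>j<d. a j * y j) = (\<Sum>j<d. a j * p j)" if y: "y \<in> S" for y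
    proof -
      have "\<exists>b. \<forall>i<d. y i - p i = (\<Sum>x\<in>P. b x * (x i - p i))"
      proof (cases "y \<in> P")
        case True
        show ?thesis
          by (rule exI[of _ "\<lambda>x. if x = y then 1 else 0"])
            (use True finP in \<open>simp add: if_distrib[of "\<lambda>a. a * _"] cong: if_cong\<close>)
      next
        case False
        have "\<not> ind (insert y P)" using Pmax[of "insert y P"] False finP by auto
        then obtain c where c: "\<forall>i<d. (\<Sum>x\<in>insert y P. c x * (x i - p i)) = 0" "\<exists>x\<in>insert y P. c x \<noteq> 0"
          using finP PS y by (auto simp: ind_def)
        show ?thesis by (rule expand[of "c y" c]) (use c False finP in auto)
      qed
      then obtain b where b: "\<And>i. i < d \<Longrightarrow> y i - p i = (\<Sum>x\<in>P. b x * (x i - p i))" by blast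
      have "(\<Sum>j<d. a j * y j) - (\<Sum>j<d. a j * p j) = (\<Sum>j<d. a j * (y j - p j))"
        by (simp add: sum_subtractf right_diff_distrib)
      also have "\<dots> = (\<Sum>j<d. \<Sum>x\<in>P. b x * (a j * (x j - p j)))"
        by (intro sum.cong refl) (simp add: b sum_distrib_left mult_ac)
      also have "\<dots> = (\<Sum>x\<in>P. b x * (\<Sum>j<d. a j * (x j - p j)))"
        by (subst sum.swap) (simp add: sum_distrib_left)
      also have "\<dots> = 0" using a(2) by simp
      finally show ?thesis by simp
    qed
    then have sub: "S \<subseteq> {z\<in>Rn d. (\<Sum>j<d. a j * z j) = (\<Sum>j<d. a j * p j)}" using S(2) by auto
    obtain k where "k < d" "a k \<noteq> 0" using a(1) by auto
    then have null: "{z\<in>Rn d. (\<Sum>j<d. a j * z j) = (\<Sum>j<d. a j * p j)} \<in> null_sets (leb_Rn d)"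
      by (rule hyperplane_null)
    have "S \<in> null_sets (completion (leb_Rn d))"
      unfolding null_sets_completion_iff2 using sub null by (rule bexI)
    then have "vol_Rn d S = 0" unfolding vol_Rn_def by (rule null_setsD1)
    with pos show ?thesis by simp
  next
    case False
    then have Pd: "card P = d" using Pd by simp
    \<comment> \<open>The \<open>d\<close> differences form a basis; these coefficients of the unit
      vectors will become the matrix \<open>C\<close> of the barycentric coordinates.\<close>
    have "\<exists>b. \<forall>j<d. (if j = i then 1 else 0) = (\<Sum>x\<in>P. b x * (x j - p j))" if "i < d" for i
    proof -
      define v where "v = (\<lambda>u j. case u of None \<Rightarrow> if j = i then 1 else 0 | Some x \<Rightarrow> x j - p j)"
      have "card {..<d} < card (insert None (Some ` P))"
        using finP Pd by (simp add: card_image card_insert_if)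
      then obtain c where c: "\<exists>u\<in>insert None (Some ` P). c u \<noteq> 0"
          "\<forall>j\<in>{..<d}. (\<Sum>u\<in>insert None (Some ` P). c u * v u j) = 0"
        using linear_dependence[of "{..<d}" "insert None (Some ` P)" v] finP by auto
      have "(\<Sum>u\<in>insert None (Some ` P). c u * v u j)
          = c None * (if j = i then 1 else 0) + (\<Sum>x\<in>P. c (Some x) * (x j - p j))" for j
        using finP by (simp add: v_def sum.reindex)
      with c show ?thesis by (intro expand[of "c None" "\<lambda>x. c (Some x)"]) auto
    qed
    then have "\<exists>C. \<forall>i. i < d \<longrightarrow> (\<forall>j<d. (if j = i then 1 else 0) = (\<Sum>x\<in>P. C i x * (x j - p j)))" by metis
    then obtain C where C: "\<And>i j. i < d \<Longrightarrow> j < d \<Longrightarrow> (if j = i then 1 else 0) = (\<Sum>x\<in>P. C i x * (x j - p j))"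
      by blast
    define m where "m = real d + 1"
    have m: "m > 0" by (simp add: m_def)
    define K where "K = (\<Sum>x\<in>P. \<Sum>i<d. \<bar>C i x\<bar>)"
    have K0: "K \<ge> 0" unfolding K_def by (intro sum_nonneg) auto
    \<comment> \<open>At \<open>c\<close> all \<open>d + 1\<close> barycentric coordinates equal
      \<open>1 / m\<close>; within the cube each of them moves by at most \<open>r * K\<close>,
      which is at most \<open>1 / m\<close>.\<close>
    define r where "r = 1 / (m * (K + 1))"
    have r: "r > 0" using m K0 by (simp add: r_def)
    define c where "c = (\<lambda>j\<in>{..<d}. (p j + (\<Sum>x\<in>P. x j)) / m)"
    have "cubeR d c r \<subseteq> S"
    proof
      fix z assume z: "z \<in> cubeR d c r"
      define s where "s = (\<lambda>x. \<Sum>i<d. (z i - c i) * C i x)"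
      have sb: "\<bar>s x\<bar> \<le> r * (\<Sum>i<d. \<bar>C i x\<bar>)" for x
      proof -
        have "\<bar>s x\<bar> \<le> (\<Sum>i<d. \<bar>(z i - c i) * C i x\<bar>)" unfolding s_def by (rule sum_abs)
        also have "\<dots> \<le> (\<Sum>i<d. r * \<bar>C i x\<bar>)"
          using z by (intro sum_mono) (auto simp: abs_mult cubeR_def intro!: mult_right_mono)
        finally show ?thesis by (simp add: sum_distrib_left)
      qed
      have "K / (K + 1) \<le> 1" using K0 by simp
      then have "1 / m * (K / (K + 1)) \<le> 1 / m * 1" using m by (intro mult_left_mono) auto
      then have rK: "r * K \<le> 1 / m" by (simp add: r_def)
      define w where "w = (\<lambda>u. case u of None \<Rightarrow> 1 / m - (\<Sum>x\<in>P. s x) | Some x \<Rightarrow> 1 / m + s x)"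
      define q where "q = (\<lambda>u. case u of None \<Rightarrow> p | Some x \<Rightarrow> x)"
      have "(\<lambda>i. \<Sum>u\<in>insert None (Some ` P). w u * q u i) \<in> S"
      proof (rule fconvex_sum)
        show "finite (insert None (Some ` P))" using finP by simp
        show "q u \<in> S" if "u \<in> insert None (Some ` P)" for u using that p PS by (auto simp: q_def)
        show "0 \<le> w u" if u: "u \<in> insert None (Some ` P)" for u
        proof (cases u)
          case None
          have "(\<Sum>x\<in>P. s x) \<le> (\<Sum>x\<in>P. r * (\<Sum>i<d. \<bar>C i x\<bar>))"
            using sb by (intro sum_mono) (metis abs_le_D1)
          also have "\<dots> = r * K" by (simp add: K_def sum_distrib_left)
          finally show ?thesis using rK None by (simp add: w_def)
        next
          case (Some x)
          then have "x \<in> P" using u by auto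
          then have "(\<Sum>i<d. \<bar>C i x\<bar>) \<le> K" unfolding K_def
            using finP by (intro member_le_sum[of x P "\<lambda>x. \<Sum>i<d. \<bar>C i x\<bar>"]) (auto intro!: sum_nonneg)
          then have "r * (\<Sum>i<d. \<bar>C i x\<bar>) \<le> 1 / m" using r rK by (meson mult_left_mono order_trans less_imp_le)
          with sb[of x] Some show ?thesis by (simp add: w_def)
        qed
        show "sum w (insert None (Some ` P)) = 1"
        proof -
          have "sum w (insert None (Some ` P)) = 1 / m + real d / m"
            using finP Pd by (simp add: w_def sum.reindex sum.distrib)
          also have "\<dots> = (real d + 1) / m" by (simp add: add_divide_distrib)
          also have "\<dots> = 1" using m by (simp add: m_def)
          finally show ?thesis .
        qed
      qed (rule S)
      also have "(\<lambda>i. \<Sum>u\<in>insert None (Some ` P). w u * q u i) = z"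
      proof (rule Rn_eqI[of _ d])
        show "(\<lambda>i. \<Sum>u\<in>insert None (Some ` P). w u * q u i) \<in> Rn d" using calculation S(2) by blast
        show "z \<in> Rn d" using z by (simp add: cubeR_def)
        fix j assume j: "j < d"
        have "(\<Sum>u\<in>insert None (Some ` P). w u * q u j)
            = (1 / m - (\<Sum>x\<in>P. s x)) * p j + (\<Sum>x\<in>P. (1 / m + s x) * x j)"
          using finP by (simp add: w_def q_def sum.reindex)
        also have "\<dots> = (p j + (\<Sum>x\<in>P. x j)) / m + (\<Sum>x\<in>P. s x * (x j - p j))"
          by (simp add: algebra_simps sum.distrib sum_subtractf sum_distrib_left sum_divide_distrib add_divide_distrib)
        also have "(\<Sum>x\<in>P. s x * (x j - p j)) = (\<Sum>i<d. (z i - c i) * (\<Sum>x\<in>P. C i x * (x j - p j)))"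
          unfolding s_def sum_distrib_right sum_distrib_left by (subst sum.swap) (simp add: mult_ac)
        also have "\<dots> = (\<Sum>i<d. if j = i then z i - c i else 0)"
          by (intro sum.cong refl) (use j in \<open>simp add: C[symmetric]\<close>)
        also have "\<dots> = z j - c j" using j by simp
        finally show "(\<Sum>u\<in>insert None (Some ` P). w u * q u j) = z j" using j by (simp add: c_def)
      qed
      finally show "z \<in> S" .
    qed
    moreover have "c \<in> Rn d" unfolding c_def by (rule restrict_in_Rn)
    ultimately show ?thesis using r by blast
  qed
qed

lemma scales_homothety:
  assumes "t > 0"
  shows "scales d (\<lambda>z. \<lambda>i\<in>{..<d}. (1 - t) * c i + t * z i) (t ^ d)"
proof -
  have "scales d (affm d (\<lambda>i j. if i = j then t else 0) (\<lambda>i. (1 - t) * c i)) (\<Prod>i<d. \<bar>t\<bar>)"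
    using scales_affm_triangular[of d "\<lambda>i j. if i = j then t else 0"] assms by simp
  then have "scales d (\<lambda>z. \<lambda>i\<in>{..<d}. (1 - t) * c i + t * z i) (\<Prod>i<d. \<bar>t\<bar>)"
    by (rule scales_cong) (auto simp: affm_def if_distrib[of "\<lambda>a. a * _"] cong: if_cong)
  then show ?thesis using assms by simp
qed

lemma emeasure_cubeR_finite: "lvol d (cubeR d c r) < \<infinity>"
proof -
  interpret product_sigma_finite "\<lambda>_::nat. lborel :: real measure" by standard
  have "lvol d (cubeR d c r) = (\<Prod>i<d. emeasure lborel {c i - r..c i + r})"
    unfolding cubeR_eq_PiE by (simp add: emeasure_PiM)
  also have "\<dots> < \<infinity>" by (simp add: less_top[symmetric] ennreal_prod_eq_top emeasure_lborel_Icc_eq)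
  finally show ?thesis .
qed

text \<open>\<open>S\<close> lies between its closure \<open>Y\<close> and the contractions of
  \<open>Y\<close> towards \<open>c\<close>. With factors \<open>k n\<close> tending to 1, the
  latter have volume \<open>k n ^ d\<close> times that of \<open>Y\<close>. As this is finite,
  \<open>S\<close> differs from a measurable set by part of a null set.\<close>

lemma convex_measurable_bounded:
  assumes S: "fconvex S" "S \<subseteq> cubeR d c R" and c: "c \<in> Rn d" "0 < r" "cubeR d c r \<subseteq> S"
  shows "S \<in> sets (completion (leb_Rn d))"
proof -
  let ?L = "lvol d"
  have SR: "S \<subseteq> Rn d" using S(2) by (auto simp: cubeR_def)
  define Y where "Y = closure S"
  have YR: "Y \<subseteq> cubeR d c R" unfolding Y_def using S(2) closed_cubeR by (rule closure_minimal)
  then have YRn: "Y \<subseteq> Rn d" by (auto simp: cubeR_def)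
  have Y: "Y \<in> sets (leb_Rn d)" using closed_in_sets_leb_Rn[of Y d] YRn by (simp add: Y_def Int_absorb2)
  have Yfin: "?L Y < \<infinity>"
    using emeasure_mono[OF YR cubeR_sets] emeasure_cubeR_finite by (rule le_less_trans)
  define k where "k = (\<lambda>n. 1 - 1 / (real n + 2))"
  have k: "0 < k n" "k n < 1" for n by (auto simp: k_def field_simps)
  \<comment> \<open>\<open>g n\<close> inverts the contraction by \<open>k n\<close>, so the
    contracted closure appears as a preimage, the form handled by \<open>scales\<close>.\<close>
  define g where "g = (\<lambda>n z. \<lambda>i\<in>{..<d}. (1 - 1 / k n) * c i + 1 / k n * z i)"
  have g: "scales d (g n) ((1 / k n) ^ d)" for n
    unfolding g_def by (rule scales_homothety) (use k[of n] in simp)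
  define A where "A = (\<lambda>n. g n -` Y \<inter> Rn d)"
  have A: "A n \<in> sets (leb_Rn d)" for n
    using measurable_sets[OF scalesD(2)[OF g[of n]] Y] by (simp add: A_def)
  have LA: "?L (A n) = ennreal ((k n) ^ d) * ?L Y" for n
  proof -
    have "?L (A n) * ennreal ((1 / k n) ^ d) = ?L Y" unfolding A_def by (rule scalesD(3)[OF g Y])
    then have "ennreal ((k n) ^ d) * ?L Y = ?L (A n) * (ennreal ((1 / k n) ^ d) * ennreal ((k n) ^ d))"
      by (simp add: mult_ac)
    also have "ennreal ((1 / k n) ^ d) * ennreal ((k n) ^ d) = 1"
      using k[of n] by (simp add: ennreal_mult[symmetric] power_mult_distrib[symmetric])
    finally show ?thesis by simp
  qed
  have AS: "A n \<subseteq> S" for n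
  proof
    fix z assume z: "z \<in> A n"
    then have zR: "z \<in> Rn d" and gz: "g n z \<in> closure S" by (auto simp: A_def Y_def)
    have "(\<lambda>i. (1 - k n) * c i + k n * g n z i) \<in> S"
      by (rule closure_shrink[OF S(1) SR c gz]) (use k[of n] in auto)
    also have "(\<lambda>i. (1 - k n) * c i + k n * g n z i) = z"
    proof
      fix i
      show "(1 - k n) * c i + k n * g n z i = z i"
        using k[of n] zR c(1) by (cases "i < d") (simp_all add: g_def Rn_outside field_simps)
    qed
    finally show "z \<in> S" .
  qed
  define U where "U = (\<Union>n. A n)"
  have U: "U \<in> sets (leb_Rn d)" unfolding U_def using A by auto
  have US: "U \<subseteq> S" unfolding U_def using AS by auto
  have SY: "S \<subseteq> Y" unfolding Y_def by (rule closure_subset)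
  obtain v where v: "?L Y = ennreal v" "v \<ge> 0" using Yfin by (cases "?L Y") auto
  have "k \<longlonglongrightarrow> 1" unfolding k_def by real_asymp
  then have "(\<lambda>n. ennreal ((k n) ^ d * v)) \<longlonglongrightarrow> ennreal (1 ^ d * v)"
    by (intro tendsto_ennrealI tendsto_mult tendsto_power tendsto_const)
  then have "(\<lambda>n. ennreal ((k n) ^ d) * ?L Y) \<longlonglongrightarrow> ?L Y"
    using v k by (simp add: ennreal_mult less_imp_le)
  moreover have "ennreal ((k n) ^ d) * ?L Y \<le> ?L U" for n
    unfolding LA[symmetric] using U by (intro emeasure_mono) (auto simp: U_def)
  ultimately have "?L Y \<le> ?L U" by (intro LIMSEQ_le_const2) auto
  moreover have "?L U \<le> ?L Y" using US SY Y by (intro emeasure_mono) auto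
  ultimately have "?L (Y - U) = 0"
    using emeasure_Diff[of "leb_Rn d" U Y] Y U US SY Yfin by (auto simp: less_top)
  then have N: "Y - U \<in> null_sets (leb_Rn d)" using Y U by auto
  show ?thesis
    by (rule sets_completionI[of _ U "S - U" "Y - U"]) (use U N US SY in auto)
qed

lemma Union_cubeR:
  assumes "S \<subseteq> Rn d"
  shows "(\<Union>n. S \<inter> cubeR d c (real (Suc n))) = S"
proof
  show "S \<subseteq> (\<Union>n. S \<inter> cubeR d c (real (Suc n)))"
  proof
    fix z assume z: "z \<in> S"
    obtain n where n: "(\<Sum>i<d. \<bar>z i - c i\<bar>) \<le> real n" using real_arch_simple by blast
    have "\<bar>z i - c i\<bar> \<le> real (Suc n)" if "i < d" for i
      using member_le_sum[of i "{..<d}" "\<lambda>i. \<bar>z i - c i\<bar>"] n that by auto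
    then have "z \<in> cubeR d c (real (Suc n))" using z assms by (auto simp: cubeR_def)
    with z show "z \<in> (\<Union>n. S \<inter> cubeR d c (real (Suc n)))" by blast
  qed
qed auto

lemma convex_measurable:
  assumes S: "fconvex S" "S \<subseteq> Rn d" and c: "c \<in> Rn d" "0 < r" "cubeR d c r \<subseteq> S"
  shows "S \<in> sets (completion (leb_Rn d))"
proof -
  have "S \<inter> cubeR d c (real (Suc n)) \<in> sets (completion (leb_Rn d))" for n
  proof (rule convex_measurable_bounded[where r="min r 1"])
    \<comment> \<open>The truncating radii start at 1, so a cube of radius at most 1 survives every
      truncation.\<close>
    show "cubeR d c (min r 1) \<subseteq> S \<inter> cubeR d c (real (Suc n))"
      using c(3) by (force simp: cubeR_def)
  qed (use S c in \<open>auto intro: fconvex_Int fconvex_cubeR\<close>)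
  then have "(\<Union>n. S \<inter> cubeR d c (real (Suc n))) \<in> sets (completion (leb_Rn d))"
    by (intro sets.countable_UN image_subsetI)
  also have "(\<Union>n. S \<inter> cubeR d c (real (Suc n))) = S" using S(2) by (rule Union_cubeR)
  finally show ?thesis .
qed

section \<open>Balls of maximal volume\<close>

text \<open>The derivative of the product at 0 is \<open>sum a A\<close>. For a triangular matrix
  this is the fact that the determinant of a perturbed identity grows to first order with the
  trace.\<close>

lemma prod_perturbation:
  fixes a :: "'i \<Rightarrow> real"
  assumes "finite A" "sum a A > 0" "0 < \<delta>"
  shows "\<exists>e. 0 < e \<and> e < \<delta> \<and> (\<forall>i\<in>A. 0 < 1 + e * a i) \<and> 1 < (\<Prod>i\<in>A. 1 + e * a i)"
proof -
  have "((\<lambda>e. \<Prod>i\<in>A. 1 + e * a i) has_real_derivative sum a A) (at 0)"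
    using assms(1)
  proof (induction A rule: finite_induct)
    case (insert k A)
    have "((\<lambda>e. (1 + e * a k) * (\<Prod>i\<in>A. 1 + e * a i)) has_real_derivative
        (1 + 0 * a k) * sum a A + a k * (\<Prod>i\<in>A. 1 + 0 * a i)) (at 0)"
      using insert.IH by (intro DERIV_mult' ) (auto intro!: derivative_eq_intros)
    then show ?case using insert.hyps by (simp add: add.commute)
  qed simp
  from DERIV_pos_inc_right[OF this assms(2)] obtain r where
    r: "r > 0" "\<And>h. 0 < h \<Longrightarrow> h < r \<Longrightarrow> 1 < (\<Prod>i\<in>A. 1 + h * a i)" by auto
  define K where "K = (\<Sum>i\<in>A. \<bar>a i\<bar>)"
  have K: "K \<ge> 0" unfolding K_def by (intro sum_nonneg) auto
  \<comment> \<open>The bound \<open>1 / (K + 1)\<close> keeps all factors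
    \<open>1 + e * a i\<close> positive.\<close>
  define m where "m = min (min r \<delta>) (1 / (K + 1))"
  have m: "0 < m" "m \<le> r" "m \<le> \<delta>" "m \<le> 1 / (K + 1)"
    using r(1) assms(3) K by (auto simp: m_def)
  define e where "e = m / 2"
  have "0 < e" "e < m" using m by (auto simp: e_def)
  then have e: "0 < e" "e < r" "e < \<delta>" "e < 1 / (K + 1)" using m by linarith+
  have "0 < 1 + e * a i" if "i \<in> A" for i
  proof -
    have "\<bar>a i\<bar> \<le> K" unfolding K_def using that assms(1) by (intro member_le_sum[of i A "\<lambda>i. \<bar>a i\<bar>"]) auto
    then have "e * \<bar>a i\<bar> \<le> e * K" using e by (intro mult_left_mono) auto
    also have "\<dots> \<le> 1 / (K + 1) * K" using e K by (intro mult_right_mono) auto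
    also have "\<dots> < 1" using K by (simp add: field_simps)
    finally have "\<bar>e * a i\<bar> < 1" using e by (simp add: abs_mult)
    then show ?thesis by linarith
  qed
  then show ?thesis using e r by blast
qed

lemma compact_uball: "compact (uball d)"
proof -
  have "closed {z::nat \<Rightarrow> real. (\<Sum>i<d. (z i)\<^sup>2) \<le> 1}"
    by (intro closed_Collect_le continuous_intros continuous_on_coordinate)
  then have "compact (cubeR d (\<lambda>_. 0) 1 \<inter> {z. (\<Sum>i<d. (z i)\<^sup>2) \<le> 1})"
    by (intro compact_Int_closed compact_cubeR)
  also have "cubeR d (\<lambda>_. 0) 1 \<inter> {z. (\<Sum>i<d. (z i)\<^sup>2) \<le> 1} = uball d"
  proof -
    have "\<bar>z i\<bar> \<le> 1" if "(\<Sum>i<d. (z i)\<^sup>2) \<le> 1" "i < d" for z :: "nat \<Rightarrow> real" and i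
      using member_le_sum[of i "{..<d}" "\<lambda>i. (z i)\<^sup>2"] that by (simp flip: abs_square_le_1)
    then show ?thesis by (auto simp: cubeR_def uball_def)
  qed
  finally show ?thesis .
qed

text \<open>Moving the entries above the diagonal to their mirror images below keeps the quadratic
  form and yields a lower triangular matrix, the only kind of perturbation against which the ball is
  known to be maximal.\<close>

lemma symmetric_form_lower:
  fixes S :: "nat \<Rightarrow> nat \<Rightarrow> real"
  assumes "\<And>i j. i < d \<Longrightarrow> j < d \<Longrightarrow> S i j = S j i"
  shows "(\<Sum>i<d. \<Sum>j<d. (if i = j then S i i else if j < i then 2 * S i j else 0) * u i * u j)
    = (\<Sum>i<d. \<Sum>j<d. S i j * u i * u j)"
proof -
  let ?Q = "\<lambda>i j. S i j * u i * u j"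
  have "(\<Sum>i<d. \<Sum>j<d. if j < i then ?Q i j else 0) = (\<Sum>j<d. \<Sum>i<d. if j < i then ?Q i j else 0)"
    by (rule sum.swap)
  also have "\<dots> = (\<Sum>i<d. \<Sum>j<d. if i < j then ?Q i j else 0)"
    using assms by (intro sum.cong refl) (auto simp: mult_ac)
  finally have sw: "(\<Sum>i<d. \<Sum>j<d. if j < i then ?Q i j else 0) = (\<Sum>i<d. \<Sum>j<d. if i < j then ?Q i j else 0)" .
  have "(\<Sum>i<d. \<Sum>j<d. (if i = j then S i i else if j < i then 2 * S i j else 0) * u i * u j)
      = (\<Sum>i<d. \<Sum>j<d. (if i = j then ?Q i j else 0) + ((if j < i then ?Q i j else 0) + (if j < i then ?Q i j else 0)))"
    by (intro sum.cong refl) auto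
  also have "\<dots> = (\<Sum>i<d. \<Sum>j<d. (if i = j then ?Q i j else 0) + ((if j < i then ?Q i j else 0) + (if i < j then ?Q i j else 0)))"
    by (simp only: sum.distrib sw)
  also have "\<dots> = (\<Sum>i<d. \<Sum>j<d. ?Q i j)" by (intro sum.cong refl) auto
  finally show ?thesis .
qed

text \<open>The unit ball is a largest ellipsoid in the intersection of the sets \<open>H v\<close>. Every ellipsoid is the
  image of the ball under an affine map with lower triangular linear part, and for these maps
  the determinant is simply the product of the diagonal.\<close>

locale max_ball =
  fixes d :: nat and W :: "'v set" and H :: "'v \<Rightarrow> (nat \<Rightarrow> real) set"
  assumes d: "d > 0" and W: "finite W"
    and H: "\<And>v. v \<in> W \<Longrightarrow> fconvex (H v)" "\<And>v. v \<in> W \<Longrightarrow> H v \<subseteq> Rn d" "\<And>v. v \<in> W \<Longrightarrow> uball d \<subseteq> H v"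
    and maximal: "\<And>T x. (\<And>i j. i < d \<Longrightarrow> j < d \<Longrightarrow> i < j \<Longrightarrow> T i j = 0) \<Longrightarrow> (\<And>i. i < d \<Longrightarrow> 0 < T i i) \<Longrightarrow>
      (\<And>v b. v \<in> W \<Longrightarrow> b \<in> uball d \<Longrightarrow> affm d T x b \<in> H v) \<Longrightarrow> (\<Prod>i<d. T i i) \<le> 1"
begin

text \<open>The dual form of John's decomposition of the identity.\<close>

lemma contact:
  assumes sym: "\<And>i j. i < d \<Longrightarrow> j < d \<Longrightarrow> S i j = S j i" and tr: "0 \<le> (\<Sum>i<d. S i i)"
  shows "\<exists>u v. v \<in> W \<and> (\<Sum>i<d. (u i)\<^sup>2) = 1 \<and> (\<forall>z\<in>H v. (\<Sum>i<d. u i * z i) \<le> 1) \<and>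
    0 \<le> (\<Sum>i<d. \<Sum>j<d. S i j * u i * u j) + (\<Sum>i<d. y i * u i)"
proof -
  \<comment> \<open>The lower triangular version of \<open>S\<close> plus a diagonal term. That term
    makes the trace strictly positive, as the growth of the determinant requires, and disappears as
    \<open>n\<close> grows.\<close>
  define L where "L = (\<lambda>n i j. if i = j then S i i + 1 / real (Suc n) else if j < i then 2 * S i j else 0)"
  have "\<forall>n. \<exists>e. 0 < e \<and> e < 1 / real (Suc n) \<and> (\<forall>i\<in>{..<d}. 0 < 1 + e * L n i i) \<and> 1 < (\<Prod>i\<in>{..<d}. 1 + e * L n i i)"
  proof (rule allI, rule prod_perturbation)
    fix n
    have "(\<Sum>i<d. L n i i) = (\<Sum>i<d. S i i) + real d / real (Suc n)" by (simp add: L_def sum.distrib)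
    then show "0 < sum (\<lambda>i. L n i i) {..<d}" using tr d by (simp add: add_nonneg_pos)
  qed auto
  from choice[OF this] obtain e where E: "\<forall>n. 0 < e n \<and> e n < 1 / real (Suc n) \<and>
      (\<forall>i\<in>{..<d}. 0 < 1 + e n * L n i i) \<and> 1 < (\<Prod>i\<in>{..<d}. 1 + e n * L n i i)" by blast
  then have e: "\<And>n. 0 < e n" "\<And>n. e n < 1 / real (Suc n)" "\<And>n i. i < d \<Longrightarrow> 0 < 1 + e n * L n i i"
      "\<And>n. 1 < (\<Prod>i<d. 1 + e n * L n i i)"
    by auto
  define T where "T = (\<lambda>n i j. (if i = j then 1 else 0) + e n * L n i j)"
  \<comment> \<open>The perturbed ellipsoid has determinant above 1, so by maximality it leaves one
    of the sets, at the image of \<open>b n\<close>.\<close>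
  have "\<exists>v b. v \<in> W \<and> b \<in> uball d \<and> affm d (T n) (\<lambda>i. e n * y i) b \<notin> H v" for n
  proof (rule ccontr)
    assume "\<not> ?thesis"
    then have "(\<Prod>i<d. T n i i) \<le> 1"
      using e(3)[of _ n] by (intro maximal[where x="\<lambda>i. e n * y i"]) (auto simp: T_def L_def)
    with e(4)[of n] show False by (simp add: T_def)
  qed
  then obtain v b where v: "\<And>n. v n \<in> W" and b: "\<And>n. b n \<in> uball d"
    and out: "\<And>n. affm d (T n) (\<lambda>i. e n * y i) (b n) \<notin> H (v n)" by metis
  define w where "w = (\<lambda>n i. y i + (\<Sum>j<d. L n i j * b n j))"
  define z where "z = (\<lambda>n. affm d (T n) (\<lambda>i. e n * y i) (b n))"
  have z: "z n i = b n i + e n * w n i" if "i < d" for n i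
  proof -
    have "(\<Sum>j<d. T n i j * b n j) = (\<Sum>j<d. (if i = j then b n j else 0) + e n * (L n i j * b n j))"
      unfolding T_def by (intro sum.cong refl) (auto simp: algebra_simps)
    also have "\<dots> = b n i + e n * (\<Sum>j<d. L n i j * b n j)"
      using that by (simp add: sum.distrib sum_distrib_left)
    finally show ?thesis using that by (simp add: z_def affm_apply w_def algebra_simps)
  qed
  have "z n \<notin> uball d" for n using H(3)[OF v[of n]] out[of n] by (auto simp: z_def)
  then have z1: "1 < (\<Sum>i<d. (z n i)\<^sup>2)" for n by (auto simp: uball_def z_def not_le)
  obtain u r where u: "u \<in> uball d" "strict_mono r" "(b \<circ> r) \<longlonglongrightarrow> u"
    using compact_uball[of d] b unfolding compact_eq_seq_compact_metric seq_compact_def by metis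
  \<comment> \<open>There are finitely many sets, so one of them is left infinitely often along the
    convergent subsequence.\<close>
  have "\<exists>v0\<in>W. infinite {n. v (r n) = v0}"
    using pigeonhole_infinite[of UNIV "\<lambda>n. v (r n)"] finite_subset[OF _ W, of "range (\<lambda>n. v (r n))"] v
    by (metis (mono_tags, lifting) Collect_cong UNIV_I image_subsetI infinite_UNIV_nat)
  then obtain v0 where v0: "v0 \<in> W" "infinite {n. v (r n) = v0}" by blast
  from infinite_enumerate[OF v0(2)] obtain q :: "nat \<Rightarrow> nat" where
    q: "strict_mono q" and "\<forall>n. q n \<in> {n. v (r n) = v0}" by (elim exE conjE that)
  then have q2: "v (r (q n)) = v0" for n by blast
  define s where "s = (\<lambda>n. r (q n))"
  have s: "strict_mono s" using u(2) q by (simp add: s_def strict_mono_def)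
  have bl: "(\<lambda>n. b (s n) i) \<longlonglongrightarrow> u i" for i
  proof -
    have "(\<lambda>n. b (s n)) \<longlonglongrightarrow> u" using LIMSEQ_subseq_LIMSEQ[OF u(3) q] by (simp add: s_def comp_def)
    from continuous_on_tendsto_compose[OF continuous_on_coordinate[of UNIV i] this] show ?thesis by simp
  qed
  have inv0: "(\<lambda>n. 1 / real (Suc (s n))) \<longlonglongrightarrow> 0"
    using LIMSEQ_subseq_LIMSEQ[OF LIMSEQ_inverse_real_of_nat s] by (simp add: comp_def inverse_eq_divide)
  have e0: "(\<lambda>n. e (s n)) \<longlonglongrightarrow> 0"
    by (rule real_tendsto_sandwich[OF _ _ tendsto_const inv0]) (use e in \<open>auto intro!: always_eventually less_imp_le\<close>)
  define L0 where "L0 = (\<lambda>i j. if i = j then S i i else if j < i then 2 * S i j else 0)"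
  have Ll: "(\<lambda>n. L (s n) i j) \<longlonglongrightarrow> L0 i j" for i j
    using tendsto_add[OF tendsto_const[of "S i i"] inv0] by (auto simp: L_def L0_def)
  define w0 where "w0 = (\<lambda>i. y i + (\<Sum>j<d. L0 i j * u j))"
  have wl: "(\<lambda>n. w (s n) i) \<longlonglongrightarrow> w0 i" for i
    unfolding w_def w0_def by (intro tendsto_intros Ll bl)
  have zl: "(\<lambda>n. z (s n) i) \<longlonglongrightarrow> u i" if "i < d" for i
    using tendsto_add[OF bl[of i] tendsto_mult[OF e0 wl[of i]]] z[OF that] by simp
  have u1: "(\<Sum>i<d. (u i)\<^sup>2) = 1"
  proof (rule antisym)
    show "(\<Sum>i<d. (u i)\<^sup>2) \<le> 1" using u(1) by (simp add: uball_def)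
    have "(\<lambda>n. \<Sum>i<d. (z (s n) i)\<^sup>2) \<longlonglongrightarrow> (\<Sum>i<d. (u i)\<^sup>2)"
      by (intro tendsto_sum tendsto_power zl) auto
    then show "1 \<le> (\<Sum>i<d. (u i)\<^sup>2)"
      by (rule LIMSEQ_le_const) (use z1 in \<open>auto intro: less_imp_le\<close>)
  qed
  \<comment> \<open>\<open>z n\<close> has norm above 1, \<open>b n\<close> at most 1, and they
    differ by \<open>e n * w n\<close>: expand the square, divide by \<open>e n\<close> and pass to
    the limit.\<close>
  have "0 \<le> 2 * (\<Sum>i<d. u i * w0 i) + 0 * (\<Sum>i<d. (w0 i)\<^sup>2)"
  proof (rule LIMSEQ_le_const)
    show "(\<lambda>n. 2 * (\<Sum>i<d. b (s n) i * w (s n) i) + e (s n) * (\<Sum>i<d. (w (s n) i)\<^sup>2))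
        \<longlonglongrightarrow> 2 * (\<Sum>i<d. u i * w0 i) + 0 * (\<Sum>i<d. (w0 i)\<^sup>2)"
      by (intro tendsto_intros bl wl e0)
    have "0 \<le> 2 * (\<Sum>i<d. b n i * w n i) + e n * (\<Sum>i<d. (w n i)\<^sup>2)" for n
    proof -
      have "(\<Sum>i<d. (b n i)\<^sup>2) \<le> (\<Sum>i<d. (z n i)\<^sup>2)" using z1[of n] b[of n] by (simp add: uball_def)
      also have "\<dots> = (\<Sum>i<d. (b n i)\<^sup>2 + e n * (2 * (b n i * w n i) + e n * (w n i)\<^sup>2))"
        by (intro sum.cong refl) (simp add: z power2_eq_square algebra_simps)
      also have "\<dots> = (\<Sum>i<d. (b n i)\<^sup>2) + e n * (2 * (\<Sum>i<d. b n i * w n i) + e n * (\<Sum>i<d. (w n i)\<^sup>2))"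
        by (simp add: sum.distrib sum_distrib_left distrib_left)
      finally have "0 \<le> e n * (2 * (\<Sum>i<d. b n i * w n i) + e n * (\<Sum>i<d. (w n i)\<^sup>2))" by (simp only: le_add_same_cancel1)
      then show ?thesis using e(1)[of n] by (simp only: zero_le_mult_iff) auto
    qed
    then show "\<exists>N. \<forall>n\<ge>N. 0 \<le> 2 * (\<Sum>i<d. b (s n) i * w (s n) i) + e (s n) * (\<Sum>i<d. (w (s n) i)\<^sup>2)" by blast
  qed
  then have "0 \<le> (\<Sum>i<d. u i * w0 i)" by simp
  also have "(\<Sum>i<d. u i * w0 i) = (\<Sum>i<d. \<Sum>j<d. L0 i j * u i * u j) + (\<Sum>i<d. y i * u i)"
    by (simp add: w0_def distrib_left sum.distrib sum_distrib_left mult_ac)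
  also have "(\<Sum>i<d. \<Sum>j<d. L0 i j * u i * u j) = (\<Sum>i<d. \<Sum>j<d. S i j * u i * u j)"
    unfolding L0_def by (rule symmetric_form_lower[OF sym])
  finally have form: "0 \<le> (\<Sum>i<d. \<Sum>j<d. S i j * u i * u j) + (\<Sum>i<d. y i * u i)" .
  \<comment> \<open>If the form exceeded 1 at some \<open>p\<close> in \<open>H v0\<close>, then for
    large \<open>n\<close> the point \<open>z (s n)\<close>, which is outside \<open>H v0\<close>,
    would lie on a segment from \<open>p\<close> to a point \<open>g\<close> of the unit
    ball.\<close>
  have "(\<Sum>i<d. u i * p i) \<le> 1" if p: "p \<in> H v0" for p
  proof (rule ccontr)
    assume np: "\<not> (\<Sum>i<d. u i * p i) \<le> 1"
    define a where "a = (\<Sum>i<d. u i * p i)"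
    define P where "P = (\<Sum>i<d. (p i)\<^sup>2)"
    have a: "a > 1" using np by (simp add: a_def)
    have P: "P \<ge> 0" unfolding P_def by (intro sum_nonneg) auto
    \<comment> \<open>Small enough that \<open>t * p\<close> is closer to \<open>u\<close> than
      \<open>1 - t\<close>; with squares expanded, this says
      \<open>t * (P - 1) < 2 * (a - 1)\<close>.\<close>
    define t where "t = min (1/2) ((a - 1) / (P + 1))"
    have t: "0 < t" "t < 1" using a P by (auto simp: t_def)
    have "t \<le> (a - 1) / (P + 1)" by (simp add: t_def)
    then have "t * (P + 1) \<le> a - 1" using P by (simp add: pos_le_divide_eq)
    then have "t * (P - 1) < 2 * (a - 1)" using t a by (simp add: algebra_simps)
    then have "t * (t * (P - 1)) < t * (2 * (a - 1))" using t by simp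
    then have lim: "1 - 2 * t * a + t\<^sup>2 * P < (1 - t)\<^sup>2" by (simp add: power2_eq_square algebra_simps)
    have "(\<Sum>i<d. (u i - t * p i)\<^sup>2) = (\<Sum>i<d. (u i)\<^sup>2 - 2 * t * (u i * p i) + t\<^sup>2 * (p i)\<^sup>2)"
      by (intro sum.cong refl) (simp add: power2_eq_square algebra_simps)
    also have "\<dots> = 1 - 2 * t * a + t\<^sup>2 * P"
      by (simp add: sum.distrib sum_subtractf sum_distrib_left[symmetric] u1 a_def P_def)
    finally have lim2: "(\<Sum>i<d. (u i - t * p i)\<^sup>2) < (1 - t)\<^sup>2" using lim by simp
    have "(\<lambda>n. \<Sum>i<d. (z (s n) i - t * p i)\<^sup>2) \<longlonglongrightarrow> (\<Sum>i<d. (u i - t * p i)\<^sup>2)"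
      by (intro tendsto_sum tendsto_power tendsto_diff zl tendsto_const) auto
    then have "eventually (\<lambda>n. (\<Sum>i<d. (z (s n) i - t * p i)\<^sup>2) < (1 - t)\<^sup>2) sequentially"
      using lim2 by (rule order_tendstoD)
    then obtain n where n: "(\<Sum>i<d. (z (s n) i - t * p i)\<^sup>2) < (1 - t)\<^sup>2"
      by (auto simp: eventually_sequentially)
    define g where "g = (\<lambda>i\<in>{..<d}. (z (s n) i - t * p i) / (1 - t))"
    have "(\<Sum>i<d. (g i)\<^sup>2) = (\<Sum>i<d. (z (s n) i - t * p i)\<^sup>2) / (1 - t)\<^sup>2"
      by (simp add: g_def power_divide sum_divide_distrib)
    also have "\<dots> \<le> 1" using n t by simp
    finally have "g \<in> uball d" unfolding uball_def by (simp add: g_def)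
    then have "(\<lambda>i. (1 - t) * g i + t * p i) \<in> H v0"
      using H(1,3)[OF v0(1)] p t by (intro fconvexD) auto
    also have "(\<lambda>i. (1 - t) * g i + t * p i) = z (s n)"
    proof (rule Rn_eqI[of _ d])
      show "(\<lambda>i. (1 - t) * g i + t * p i) \<in> Rn d" using calculation H(2)[OF v0(1)] by blast
      show "(1 - t) * g i + t * p i = z (s n) i" if "i < d" for i using that t by (simp add: g_def)
    qed (simp add: z_def)
    finally show False using out[of "s n"] q2[of n] by (simp add: z_def s_def)
  qed
  with u1 form v0 show ?thesis by blast
qed

text \<open>Let \<open>z\<close> have norm \<open>R > d\<close> and test \<open>contact\<close> with
  the form \<open>z z^T - (R + \<delta>) I\<close> and the linear term \<open>(R - 1) z\<close>;
  here \<open>\<delta>\<close> makes the trace 0 and is positive as \<open>R > d\<close>. A contact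
  point whose inner product with \<open>z\<close> is \<open>c\<close> then satisfies
  \<open>(c - 1) * (c + R) \<ge> \<delta>\<close>. But \<open>c \<le> 1\<close> by the half-space
  and \<open>c \<ge> - R\<close> by Cauchy-Schwarz.\<close>

lemma inter_bounded:
  assumes z: "\<And>v. v \<in> W \<Longrightarrow> z \<in> H v"
  shows "(\<Sum>i<d. (z i)\<^sup>2) \<le> (real d)\<^sup>2"
proof (rule ccontr)
  assume n: "\<not> ?thesis"
  define R where "R = sqrt (\<Sum>i<d. (z i)\<^sup>2)"
  have R2: "R\<^sup>2 = (\<Sum>i<d. (z i)\<^sup>2)" unfolding R_def by (simp add: sum_nonneg)
  have R: "R > real d" unfolding R_def using n by (intro real_less_rsqrt) auto
  define \<delta> where "\<delta> = (R\<^sup>2 - R * real d) / real d"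
  have \<delta>: "\<delta> > 0" using R d by (simp add: \<delta>_def power2_eq_square)
  define S where "S = (\<lambda>i j. z i * z j - (if i = j then R + \<delta> else 0))"
  have "(\<Sum>i<d. S i i) = R\<^sup>2 - real d * (R + \<delta>)"
    unfolding R2 by (simp add: S_def sum_subtractf power2_eq_square)
  also have "\<dots> = 0" using d by (simp add: \<delta>_def field_simps)
  finally have tr: "0 \<le> (\<Sum>i<d. S i i)" by simp
  have sym: "S i j = S j i" for i j by (auto simp: S_def mult.commute)
  from contact[of S "\<lambda>i. (R - 1) * z i", OF sym tr]
  obtain u v where uv: "v \<in> W" "(\<Sum>i<d. (u i)\<^sup>2) = 1" "\<forall>z\<in>H v. (\<Sum>i<d. u i * z i) \<le> 1"
    "0 \<le> (\<Sum>i<d. \<Sum>j<d. S i j * u i * u j) + (\<Sum>i<d. ((R - 1) * z i) * u i)"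
    by blast
  define c where "c = (\<Sum>i<d. u i * z i)"
  have c1: "c \<le> 1" using uv z by (simp add: c_def)
  have "(\<Sum>i<d. \<bar>u i\<bar> * \<bar>z i\<bar>) \<le> L2_set u {..<d} * L2_set z {..<d}" by (rule L2_set_mult_ineq)
  then have "(\<Sum>i<d. \<bar>u i * z i\<bar>) \<le> R" using uv(2) by (simp add: L2_set_def R_def abs_mult)
  moreover have "\<bar>c\<bar> \<le> (\<Sum>i<d. \<bar>u i * z i\<bar>)" unfolding c_def by (rule sum_abs)
  ultimately have cR: "- R \<le> c" by linarith
  have "(\<Sum>i<d. \<Sum>j<d. S i j * u i * u j)
      = (\<Sum>i<d. \<Sum>j<d. (u i * z i) * (u j * z j) - (if i = j then (R + \<delta>) * (u i * u j) else 0))"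
    by (intro sum.cong refl) (auto simp: S_def algebra_simps)
  also have "\<dots> = (\<Sum>i<d. \<Sum>j<d. (u i * z i) * (u j * z j)) - (\<Sum>i<d. \<Sum>j<d. if i = j then (R + \<delta>) * (u i * u j) else 0)"
    by (simp only: sum_subtractf)
  also have "(\<Sum>i<d. \<Sum>j<d. (u i * z i) * (u j * z j)) = c\<^sup>2"
    by (simp add: c_def power2_eq_square sum_product)
  also have "(\<Sum>i<d. \<Sum>j<d. if i = j then (R + \<delta>) * (u i * u j) else 0) = (R + \<delta>) * (\<Sum>i<d. (u i)\<^sup>2)"
    by (simp add: power2_eq_square sum_distrib_left)
  finally have "(\<Sum>i<d. \<Sum>j<d. S i j * u i * u j) = c\<^sup>2 - (R + \<delta>)" using uv(2) by simp
  moreover have "(\<Sum>i<d. ((R - 1) * z i) * u i) = (R - 1) * c"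
    by (simp add: c_def sum_distrib_left mult_ac)
  ultimately have "0 \<le> (c - 1) * (c + R) - \<delta>" using uv(4) by (simp add: power2_eq_square algebra_simps)
  moreover have "(c - 1) * (c + R) \<le> 0" using c1 cR by (intro mult_nonpos_nonneg) auto
  ultimately show False using \<delta> by linarith
qed

text \<open>Gram-Schmidt interleaved with the choice of contact points. In step \<open>n\<close> the
  form is \<open>n / d\<close> times the identity minus the projection onto the span of the
  \<open>f i\<close> found so far. Its trace is 0, so some contact point has a projection of squared
  length at most \<open>n / d\<close>; the normalised remainder becomes \<open>f n\<close>.
  \<open>M\<close> collects the triangular coefficients.\<close>

lemma Dvoretzky_Rogers:
  assumes "n \<le> d"
  shows "\<exists>f u v M. (\<forall>k<n. \<forall>l<n. (\<Sum>a<d. f k a * f l a) = (if k = l then 1 else 0)) \<and>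
    (\<forall>k<n. v k \<in> W \<and> (\<forall>z\<in>H (v k). (\<Sum>a<d. u k a * z a) \<le> 1)) \<and>
    (\<forall>k<n. \<forall>a<d. u k a = (\<Sum>i<n. M k i * f i a)) \<and>
    (\<forall>k<n. \<forall>i. k < i \<longrightarrow> M k i = 0) \<and>
    (\<forall>k<n. 0 < M k k \<and> 1 - real k / real d \<le> (M k k)\<^sup>2 \<and> (\<Sum>i<n. (M k i)\<^sup>2) = (1::real))"
  using assms
proof (induction n)
  case (Suc n)
  then have "n \<le> d" by simp
  from Suc.IH[OF this] obtain f u v M where
    IH: "\<forall>k<n. \<forall>l<n. (\<Sum>a<d. f k a * f l a) = (if k = l then 1 else 0)"
      "\<forall>k<n. v k \<in> W \<and> (\<forall>z\<in>H (v k). (\<Sum>a<d. u k a * z a) \<le> 1)"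
      "\<forall>k<n. \<forall>a<d. u k a = (\<Sum>i<n. M k i * f i a)" "\<forall>k<n. \<forall>i. k < i \<longrightarrow> M k i = 0"
      "\<forall>k<n. 0 < M k k \<and> 1 - real k / real d \<le> (M k k)\<^sup>2 \<and> (\<Sum>i<n. (M k i)\<^sup>2) = (1::real)"
    by (elim exE conjE that)
  have on: "\<And>k l. k < n \<Longrightarrow> l < n \<Longrightarrow> (\<Sum>a<d. f k a * f l a) = (if k = l then 1 else (0::real))"
    using IH(1) by blast
  have v: "\<And>k. k < n \<Longrightarrow> v k \<in> W" "\<And>k z. k < n \<Longrightarrow> z \<in> H (v k) \<Longrightarrow> (\<Sum>a<d. u k a * z a) \<le> 1"
    using IH(2) by blast+
  have u: "\<And>k a. k < n \<Longrightarrow> a < d \<Longrightarrow> u k a = (\<Sum>i<n. M k i * f i a)" using IH(3) by blast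
  have M: "\<And>k i. k < n \<Longrightarrow> k < i \<Longrightarrow> M k i = 0" "\<And>k. k < n \<Longrightarrow> 0 < M k k"
      "\<And>k. k < n \<Longrightarrow> 1 - real k / real d \<le> (M k k)\<^sup>2" "\<And>k. k < n \<Longrightarrow> (\<Sum>i<n. (M k i)\<^sup>2) = (1::real)"
    using IH(4,5) by blast+
  define S where "S = (\<lambda>a b. (if a = b then real n / real d else 0) - (\<Sum>i<n. f i a * f i b))"
  have "(\<Sum>a<d. S a a) = real n - (\<Sum>i<n. \<Sum>a<d. f i a * f i a)"
    unfolding S_def sum_subtractf using d by (subst (2) sum.swap) simp
  also have "\<dots> = 0" using on by simp
  finally have tr: "0 \<le> (\<Sum>i<d. S i i)" by simp
  have sym: "S i j = S j i" for i j by (auto simp: S_def mult.commute)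
  from contact[of S "\<lambda>_. 0", OF sym tr]
  obtain u' v' where uv: "v' \<in> W" "(\<Sum>i<d. (u' i)\<^sup>2) = 1" "\<forall>z\<in>H v'. (\<Sum>i<d. u' i * z i) \<le> 1"
    "0 \<le> (\<Sum>i<d. \<Sum>j<d. S i j * u' i * u' j)"
    by auto
  define c where "c = (\<lambda>i. \<Sum>a<d. f i a * u' a)"
  \<comment> \<open>The squared length of the part of \<open>u'\<close> orthogonal to the span; its
    root becomes \<open>M n n\<close>.\<close>
  define q where "q = 1 - (\<Sum>i<n. (c i)\<^sup>2)"
  have "(\<Sum>a<d. \<Sum>b<d. S a b * u' a * u' b)
      = (\<Sum>a<d. \<Sum>b<d. (if a = b then real n / real d * (u' a * u' b) else 0) - (\<Sum>i<n. (f i a * u' a) * (f i b * u' b)))"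
    unfolding S_def mult.assoc left_diff_distrib sum_distrib_right by (intro sum.cong refl) (auto simp: mult_ac)
  also have "\<dots> = (\<Sum>a<d. \<Sum>b<d. (if a = b then real n / real d * (u' a * u' b) else 0))
      - (\<Sum>a<d. \<Sum>b<d. \<Sum>i<n. (f i a * u' a) * (f i b * u' b))"
    by (simp only: sum_subtractf)
  also have "(\<Sum>a<d. \<Sum>b<d. (if a = b then real n / real d * (u' a * u' b) else 0)) = real n / real d * (\<Sum>a<d. (u' a)\<^sup>2)"
    by (simp add: power2_eq_square sum_distrib_left)
  also have "(\<Sum>a<d. \<Sum>b<d. \<Sum>i<n. (f i a * u' a) * (f i b * u' b)) = (\<Sum>a<d. \<Sum>i<n. \<Sum>b<d. (f i a * u' a) * (f i b * u' b))"
    by (intro sum.cong refl sum.swap)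
  also have "\<dots> = (\<Sum>i<n. \<Sum>a<d. \<Sum>b<d. (f i a * u' a) * (f i b * u' b))"
    by (rule sum.swap)
  also have "\<dots> = (\<Sum>i<n. (c i)\<^sup>2)" by (simp add: c_def power2_eq_square sum_product)
  finally have q1: "q \<ge> 1 - real n / real d" using uv by (simp add: q_def)
  have "real n / real d < 1" using Suc.prems d by simp
  then have q0: "q > 0" using q1 by linarith
  define g where "g = (\<lambda>a. (u' a - (\<Sum>i<n. c i * f i a)) / sqrt q)"
  have fu: "(\<Sum>a<d. f l a * (\<Sum>i<n. c i * f i a)) = c l" if "l < n" for l
  proof -
    have "(\<Sum>a<d. f l a * (\<Sum>i<n. c i * f i a)) = (\<Sum>i<n. c i * (\<Sum>a<d. f l a * f i a))"
      unfolding sum_distrib_left by (subst sum.swap) (simp add: mult_ac)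
    also have "\<dots> = (\<Sum>i<n. if l = i then c i else 0)" using on that by (intro sum.cong) auto
    finally show ?thesis using that by simp
  qed
  have gf: "(\<Sum>a<d. f l a * g a) = 0" if "l < n" for l
  proof -
    have "(\<Sum>a<d. f l a * g a) = (c l - (\<Sum>a<d. f l a * (\<Sum>i<n. c i * f i a))) / sqrt q"
      by (simp add: g_def c_def sum_divide_distrib[symmetric] right_diff_distrib sum_subtractf)
    then show ?thesis using fu[OF that] by simp
  qed
  have ug: "u' a = (\<Sum>i<n. c i * f i a) + sqrt q * g a" for a using q0 by (simp add: g_def)
  have gg: "(\<Sum>a<d. g a * g a) = 1"
  proof -
    have hx: "(\<Sum>a<d. (\<Sum>i<n. c i * f i a) * x a) = (\<Sum>l<n. c l * (\<Sum>a<d. f l a * x a))" for x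
      unfolding sum_distrib_right sum_distrib_left by (subst sum.swap) (simp add: mult_ac)
    have "(\<Sum>l<n. c l * (\<Sum>a<d. f l a * (\<Sum>i<n. c i * f i a))) = (\<Sum>l<n. c l * c l)"
      using fu by (intro sum.cong refl) simp
    then have 1: "(\<Sum>a<d. (\<Sum>i<n. c i * f i a) * (\<Sum>i<n. c i * f i a)) = (\<Sum>l<n. (c l)\<^sup>2)"
      by (simp only: hx[of "\<lambda>a. \<Sum>i<n. c i * f i a"] power2_eq_square)
    have 2: "(\<Sum>a<d. (\<Sum>i<n. c i * f i a) * g a) = 0" unfolding hx[of g] using gf by simp
    have "1 = (\<Sum>a<d. (u' a)\<^sup>2)" using uv by simp
    also have "\<dots> = (\<Sum>a<d. (\<Sum>i<n. c i * f i a) * (\<Sum>i<n. c i * f i a) + 2 * sqrt q * ((\<Sum>i<n. c i * f i a) * g a) + q * (g a * g a))"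
      using q0 by (intro sum.cong refl) (simp add: ug power2_eq_square algebra_simps flip: real_sqrt_mult)
    also have "\<dots> = (\<Sum>l<n. (c l)\<^sup>2) + q * (\<Sum>a<d. g a * g a)"
      by (simp add: sum.distrib sum_distrib_left[symmetric] 1 2)
    finally have "1 - (\<Sum>l<n. (c l)\<^sup>2) = q * (\<Sum>a<d. g a * g a)" by (metis add_diff_cancel_left')
    then have "q * (\<Sum>a<d. g a * g a) = q" by (simp only: q_def[symmetric])
    then show ?thesis using q0 by simp
  qed
  define f' where "f' = f(n := g)"
  define M' where "M' = M(n := (\<lambda>i. if i < n then c i else if i = n then sqrt q else 0))"
  define U' where "U' = u(n := u')"
  define v'' where "v'' = v(n := v')"
  have low: "f' k = f k" "M' k = M k" "U' k = u k" "v'' k = v k" if "k < n" for k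
    using that by (auto simp: f'_def M'_def U'_def v''_def)
  have top: "f' n = g" "M' n = (\<lambda>i. if i < n then c i else if i = n then sqrt q else 0)" "U' n = u'" "v'' n = v'"
    by (auto simp: f'_def M'_def U'_def v''_def)
  have A1: "(\<Sum>a<d. f' k a * f' l a) = (if k = l then 1 else 0)" if "k < Suc n" "l < Suc n" for k l
    using that on gf gg by (cases "k = n"; cases "l = n") (auto simp: low top mult.commute less_Suc_eq)
  have A2: "v'' k \<in> W \<and> (\<forall>z\<in>H (v'' k). (\<Sum>a<d. U' k a * z a) \<le> 1)" if "k < Suc n" for k
    using that v uv by (cases "k = n") (auto simp: low top less_Suc_eq)
  have A3: "U' k a = (\<Sum>i<Suc n. M' k i * f' i a)" if "k < Suc n" "a < d" for k a
  proof (cases "k = n")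
    case True
    then show ?thesis by (simp add: top low ug[of a])
  next
    case False
    then have "k < n" using that by simp
    then show ?thesis using u[of k a] that M(1)[of k n] by (simp add: low top)
  qed
  have A4: "M' k i = 0" if "k < Suc n" "k < i" for k i
    using that M(1)[of k i] by (cases "k = n") (auto simp: top low less_Suc_eq)
  have A5: "0 < M' k k \<and> 1 - real k / real d \<le> (M' k k)\<^sup>2 \<and> (\<Sum>i<Suc n. (M' k i)\<^sup>2) = 1" if "k < Suc n" for k
  proof (cases "k = n")
    case True
    then show ?thesis using q0 q1 by (simp add: top q_def[symmetric]) (simp add: q_def)
  next
    case False
    then have "k < n" using that by simp
    then show ?thesis using M(2-4)[of k] M(1)[of k n] by (simp add: low)
  qed
  show ?case
    by (rule exI[of _ f'], rule exI[of _ U'], rule exI[of _ v''], rule exI[of _ M'])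
      (intro conjI allI impI A1 A3 A4 A2[THEN conjunct1] A2[THEN conjunct2] A5[THEN conjunct1]
        A5[THEN conjunct2, THEN conjunct1] A5[THEN conjunct2, THEN conjunct2])
qed simp

end

text \<open>The reciprocal of a bound on the volume of a simplex: \<open>t ^ d / fact d\<close> with
  \<open>t = d + d * \<sigma>\<close>, divided by the determinant of the contact points. The product
  of roots bounds that determinant from below, the inner bracket bounds \<open>\<sigma>\<close>, the
  norm of their sum, from above.\<close>

definition gam :: "nat \<Rightarrow> real" where
  "gam d = fact d * (\<Prod>k<d. sqrt (1 - real k / real d))
    / (real d + real d * (sqrt (real d) + (\<Sum>k<d. sqrt (real k / real d)))) ^ d"

lemma gam_pos: "d > 0 \<Longrightarrow> gam d > 0"
  unfolding gam_def
  by (intro divide_pos_pos mult_pos_pos prod_pos zero_less_power add_pos_nonneg mult_nonneg_nonneg add_nonneg_nonneg sum_nonneg) auto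

lemma L2_set_sum_le:
  "finite K \<Longrightarrow> L2_set (\<lambda>i. \<Sum>k\<in>K. g k i) A \<le> (\<Sum>k\<in>K. L2_set (g k) A)"
proof (induction K rule: finite_induct)
  case empty
  then show ?case by (simp add: L2_set_0')
next
  case (insert k K)
  then show ?case using L2_set_triangle_ineq[of "g k" "\<lambda>i. \<Sum>k\<in>K. g k i" A] by simp
qed

lemma ennreal_eq_divide:
  assumes "X * ennreal c = ennreal y" "0 < c" "0 \<le> y"
  shows "X = ennreal (y / c)"
proof (cases X)
  case (real r)
  then have "r * c = y" using assms by (simp add: ennreal_mult[symmetric])
  then show ?thesis using real assms(2) by (auto simp: field_simps)
next
  case top
  then show ?thesis using assms by (simp add: ennreal_top_mult)
qed

context max_ball begin

text \<open>In the affine coordinates \<open>h z k\<close>, equal to 1 minus the inner product of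
  \<open>u k\<close> and \<open>z\<close>, the contact half-spaces become
  \<open>h z k \<ge> 0\<close>, and the lower bound \<open>- (d * \<sigma>)\<close> for the sum of
  the inner products says that the coordinates sum to at most \<open>d + d * \<sigma>\<close>. The
  linear part of \<open>h\<close> is an orthonormal map followed by a triangular one, so its volume
  factor is the product of the \<open>M k k\<close>.\<close>

lemma few_sets_volume:
  "\<exists>V'\<subseteq>W. card V' \<le> 2 * d \<and> (\<exists>\<Delta>\<in>sets (leb_Rn d). Rn d \<inter> (\<Inter>v\<in>V'. H v) \<subseteq> \<Delta> \<and>
    lvol d \<Delta> \<le> ennreal (1 / gam d))"
proof -
  from Dvoretzky_Rogers[OF order_refl] obtain f u v M where
    DR: "\<forall>k<d. \<forall>l<d. (\<Sum>a<d. f k a * f l a) = (if k = l then 1 else 0)"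
      "\<forall>k<d. v k \<in> W \<and> (\<forall>z\<in>H (v k). (\<Sum>a<d. u k a * z a) \<le> 1)"
      "\<forall>k<d. \<forall>a<d. u k a = (\<Sum>i<d. M k i * f i a)" "\<forall>k<d. \<forall>i. k < i \<longrightarrow> M k i = 0"
      "\<forall>k<d. 0 < M k k \<and> 1 - real k / real d \<le> (M k k)\<^sup>2 \<and> (\<Sum>i<d. (M k i)\<^sup>2) = (1::real)"
    by (elim exE conjE that)
  have on: "\<And>k l. k < d \<Longrightarrow> l < d \<Longrightarrow> (\<Sum>a<d. f k a * f l a) = (if k = l then 1 else (0::real))"
    using DR(1) by blast
  have v: "\<And>k. k < d \<Longrightarrow> v k \<in> W" "\<And>k z. k < d \<Longrightarrow> z \<in> H (v k) \<Longrightarrow> (\<Sum>a<d. u k a * z a) \<le> 1"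
    using DR(2) by blast+
  have u: "\<And>k a. k < d \<Longrightarrow> a < d \<Longrightarrow> u k a = (\<Sum>i<d. M k i * f i a)" using DR(3) by blast
  have M: "\<And>k i. k < d \<Longrightarrow> k < i \<Longrightarrow> M k i = 0" "\<And>k. k < d \<Longrightarrow> 0 < M k k"
      "\<And>k. k < d \<Longrightarrow> 1 - real k / real d \<le> (M k k)\<^sup>2" "\<And>k. k < d \<Longrightarrow> (\<Sum>i<d. (M k i)\<^sup>2) = (1::real)"
    using DR(4,5) by blast+
  define s where "s = (\<lambda>a. \<Sum>k<d. u k a)"
  define \<sigma> where "\<sigma> = L2_set s {..<d}"
  define m where "m = (\<lambda>i. \<Sum>k<d. M k i)"
  have sm: "s a = (\<Sum>i<d. m i * f i a)" if "a < d" for a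
  proof -
    have "s a = (\<Sum>k<d. \<Sum>i<d. M k i * f i a)" unfolding s_def using u that by simp
    also have "\<dots> = (\<Sum>i<d. \<Sum>k<d. M k i * f i a)" by (rule sum.swap)
    finally show ?thesis by (simp add: m_def sum_distrib_right)
  qed
  have "(\<Sum>a<d. (s a)\<^sup>2) = (\<Sum>a<d. (\<Sum>i<d. m i * f i a) * (\<Sum>j<d. m j * f j a))"
    by (intro sum.cong refl) (simp add: sm power2_eq_square)
  also have "\<dots> = (\<Sum>a<d. \<Sum>i<d. \<Sum>j<d. m i * m j * (f i a * f j a))"
    by (simp add: sum_product mult_ac)
  also have "\<dots> = (\<Sum>i<d. \<Sum>a<d. \<Sum>j<d. m i * m j * (f i a * f j a))" by (rule sum.swap)
  also have "\<dots> = (\<Sum>i<d. \<Sum>j<d. \<Sum>a<d. m i * m j * (f i a * f j a))"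
    by (intro sum.cong refl sum.swap)
  also have "\<dots> = (\<Sum>i<d. \<Sum>j<d. m i * m j * (\<Sum>a<d. f i a * f j a))"
    by (simp only: sum_distrib_left)
  also have "\<dots> = (\<Sum>i<d. \<Sum>j<d. if i = j then m i * m j else 0)"
    using on by (intro sum.cong refl) auto
  also have "\<dots> = (\<Sum>i<d. (m i)\<^sup>2)" by (simp add: power2_eq_square)
  finally have \<sigma>m: "\<sigma> = L2_set m {..<d}" by (simp add: \<sigma>_def L2_set_def)
  \<comment> \<open>The strictly lower part of \<open>M\<close>. The diagonal contributes at most
    \<open>sqrt d\<close> to the norm of the sum, and row \<open>k\<close> of the rest at most
    \<open>sqrt (k / d)\<close>, since the row has norm 1 and its diagonal entry is large.\<close>
  define o' where "o' = (\<lambda>k i. if i < k then M k i else 0)"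
  have "m i = M i i + (\<Sum>k<d. o' k i)" if "i < d" for i
  proof -
    have "m i = (\<Sum>k<d. (if k = i then M k i else 0) + o' k i)"
      unfolding m_def using M(1) by (intro sum.cong refl) (auto simp: o'_def not_less_iff_gr_or_eq)
    then show ?thesis using that by (simp add: sum.distrib)
  qed
  then have "L2_set m {..<d} = L2_set (\<lambda>i. M i i + (\<Sum>k<d. o' k i)) {..<d}"
    by (intro L2_set_cong) auto
  also have "\<dots> \<le> L2_set (\<lambda>i. M i i) {..<d} + L2_set (\<lambda>i. \<Sum>k<d. o' k i) {..<d}"
    by (rule L2_set_triangle_ineq)
  also have "\<dots> \<le> sqrt (real d) + (\<Sum>k<d. sqrt (real k / real d))"
  proof (rule add_mono)
    have "(M i i)\<^sup>2 \<le> 1" if "i < d" for i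
      using member_le_sum[of i "{..<d}" "\<lambda>j. (M i j)\<^sup>2"] M(4)[OF that] that by simp
    then have "(\<Sum>i<d. (M i i)\<^sup>2) \<le> (\<Sum>i<d. 1)" by (intro sum_mono) auto
    then show "L2_set (\<lambda>i. M i i) {..<d} \<le> sqrt (real d)" by (simp add: L2_set_def)
    have "L2_set (\<lambda>i. \<Sum>k<d. o' k i) {..<d} \<le> (\<Sum>k<d. L2_set (o' k) {..<d})" by (rule L2_set_sum_le) simp
    also have "\<dots> \<le> (\<Sum>k<d. sqrt (real k / real d))"
    proof (rule sum_mono)
      fix k assume "k \<in> {..<d}"
      then have k: "k < d" by simp
      have "1 = (\<Sum>i<d. (if i = k then (M k i)\<^sup>2 else 0) + (o' k i)\<^sup>2)"
        unfolding M(4)[OF k, symmetric] using M(1)[OF k] by (intro sum.cong refl) (auto simp: o'_def not_less_iff_gr_or_eq)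
      also have "\<dots> = (M k k)\<^sup>2 + (\<Sum>i<d. (o' k i)\<^sup>2)" using k by (simp add: sum.distrib)
      finally have "(\<Sum>i<d. (o' k i)\<^sup>2) \<le> real k / real d" using M(3)[OF k] by linarith
      then show "L2_set (o' k) {..<d} \<le> sqrt (real k / real d)" unfolding L2_set_def by (rule real_sqrt_le_mono)
    qed
    finally show "L2_set (\<lambda>i. \<Sum>k<d. o' k i) {..<d} \<le> (\<Sum>k<d. sqrt (real k / real d))" .
  qed
  finally have \<sigma>: "\<sigma> \<le> sqrt (real d) + (\<Sum>k<d. sqrt (real k / real d))" by (simp only: \<sigma>m)
  have \<sigma>0: "\<sigma> \<ge> 0" by (simp add: \<sigma>_def)
  \<comment> \<open>The region where the wanted lower bound fails. By Cauchy-Schwarz it misses the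
    ball of radius \<open>d\<close>, hence the intersection of all sets.\<close>
  define N where "N = {z\<in>Rn d. (\<Sum>a<d. s a * z a) < - (real d * \<sigma>)}"
  define K where "K = case_option N H"
  have emptyK: "(\<Inter>j\<in>insert None (Some ` W). K j) = {}"
  proof (rule ccontr)
    assume "(\<Inter>j\<in>insert None (Some ` W). K j) \<noteq> {}"
    then obtain z where "z \<in> (\<Inter>j\<in>insert None (Some ` W). K j)" by blast
    then have z: "z \<in> N" "\<And>v. v \<in> W \<Longrightarrow> z \<in> H v" by (auto simp: K_def)
    have "(\<Sum>a<d. \<bar>s a\<bar> * \<bar>z a\<bar>) \<le> \<sigma> * L2_set z {..<d}" unfolding \<sigma>_def by (rule L2_set_mult_ineq)
    also have "L2_set z {..<d} \<le> sqrt ((real d)\<^sup>2)" unfolding L2_set_def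
      using inter_bounded[OF z(2)] by (intro real_sqrt_le_mono) auto
    then have "\<sigma> * L2_set z {..<d} \<le> \<sigma> * real d" using \<sigma>0 by (intro mult_left_mono) auto
    finally have "(\<Sum>a<d. \<bar>s a * z a\<bar>) \<le> real d * \<sigma>" by (simp add: abs_mult mult.commute)
    moreover have "\<bar>\<Sum>a<d. s a * z a\<bar> \<le> (\<Sum>a<d. \<bar>s a * z a\<bar>)" by (rule sum_abs)
    moreover have "(\<Sum>a<d. s a * z a) < - (real d * \<sigma>)" using z(1) by (simp add: N_def)
    ultimately show False by linarith
  qed
  have Ncv: "fconvex N"
  proof (rule fconvexI)
    fix x y and t :: real assume xy: "x \<in> N" "y \<in> N" and t: "0 \<le> t" "t \<le> 1"
    define A where "A = (\<Sum>a<d. s a * x a)"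
    define B where "B = (\<Sum>a<d. s a * y a)"
    have AB: "A < - (real d * \<sigma>)" "B < - (real d * \<sigma>)" using xy by (auto simp: N_def A_def B_def)
    have "(\<Sum>a<d. s a * ((1 - t) * x a + t * y a)) = (1 - t) * A + t * B"
      unfolding A_def B_def sum_distrib_left sum.distrib[symmetric] by (intro sum.cong refl) (simp add: algebra_simps)
    also have "\<dots> < - (real d * \<sigma>)"
      using convex_bound_lt[OF AB, of "1 - t" t] t by simp
    finally show "(\<lambda>i. (1 - t) * x i + t * y i) \<in> N"
      using fconvexD[OF fconvex_Rn] xy t by (auto simp: N_def)
  qed
  have "\<exists>J'\<subseteq>insert None (Some ` W). card J' \<le> Suc d \<and> (\<Inter>j\<in>J'. K j) = {}"
  proof (rule ccontr)
    assume small: "\<not> ?thesis"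
    have "(\<Inter>j\<in>insert None (Some ` W). K j) \<noteq> {}"
    proof (rule Helly_fun[where I="{..<d}" and w="\<lambda>_. undefined"])
      show "finite (insert None (Some ` W))" using W by simp
      show "fconvex (K j)" if "j \<in> insert None (Some ` W)" for j
        using that Ncv H(1) by (auto simp: K_def)
      show "x i = undefined" if "j \<in> insert None (Some ` W)" "x \<in> K j" "i \<notin> {..<d}" for j x i
      proof -
        have "x \<in> Rn d" using that(1,2) H(2) by (cases j) (auto simp: K_def N_def subset_iff)
        then show ?thesis using that(3) by (simp add: Rn_outside)
      qed
      show "(\<Inter>j\<in>J'. K j) \<noteq> {}" if "J' \<subseteq> insert None (Some ` W)" "card J' \<le> Suc (card {..<d})" for J'
        using small that by auto
    qed simp
    with emptyK show False by simp
  qed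
  then obtain J' where J': "J' \<subseteq> insert None (Some ` W)" "card J' \<le> Suc d" "(\<Inter>j\<in>J'. K j) = {}"
    by blast
  \<comment> \<open>All \<open>H v\<close> contain the origin, so a subfamily with empty
    intersection must involve \<open>N\<close>; this leaves at most \<open>d\<close> of the
    \<open>H v\<close>.\<close>
  have "(\<lambda>i\<in>{..<d}. 0) \<in> uball d" by (simp add: uball_def)
  then have zH: "(\<lambda>i\<in>{..<d}. 0) \<in> H v" if "v \<in> W" for v using H(3)[OF that] by blast
  have "None \<in> J'"
  proof (rule ccontr)
    assume "None \<notin> J'"
    then have "(\<lambda>i\<in>{..<d}. 0) \<in> K j" if "j \<in> J'" for j using that J'(1) zH by (auto simp: K_def)
    with J'(3) show False by blast
  qed
  define V1 where "V1 = {v. Some v \<in> J'}"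
  have J'V: "J' = insert None (Some ` V1)"
  proof (rule set_eqI)
    show "j \<in> J' \<longleftrightarrow> j \<in> insert None (Some ` V1)" for j
      using \<open>None \<in> J'\<close> by (cases j) (auto simp: V1_def)
  qed
  have V1W: "V1 \<subseteq> W" using J'(1) by (auto simp: V1_def)
  then have "finite V1" using W finite_subset by blast
  then have V1d: "card V1 \<le> d" using J'(2) by (simp add: J'V card_image card_insert_if)
  define V' where "V' = V1 \<union> v ` {..<d}"
  have V'W: "V' \<subseteq> W" using V1W v(1) by (auto simp: V'_def)
  have "card V' \<le> card V1 + card (v ` {..<d})" unfolding V'_def by (rule card_Un_le)
  also have "\<dots> \<le> d + d" using V1d card_image_le[of "{..<d}" v] by (intro add_mono) auto
  finally have V'd: "card V' \<le> 2 * d" by simp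
  define t where "t = real d + real d * \<sigma>"
  have t0: "t \<ge> 0" using \<sigma>0 by (simp add: t_def)
  define \<Sigma> where "\<Sigma> = {z\<in>Rn d. (\<forall>i<d. 0 \<le> z i) \<and> (\<Sum>i<d. z i) \<le> t}"
  define h where "h = (\<lambda>z. affm d (\<lambda>k i. - M k i) (\<lambda>_. 1) (affm d f (\<lambda>_. 0) z))"
  have h: "h z k = 1 - (\<Sum>a<d. u k a * z a)" if "k < d" for z k
  proof -
    have "(\<Sum>i<d. - M k i * affm d f (\<lambda>_. 0) z i) = - (\<Sum>i<d. \<Sum>a<d. M k i * f i a * z a)"
      by (simp add: affm_apply sum_distrib_left sum_negf mult.assoc)
    also have "(\<Sum>i<d. \<Sum>a<d. M k i * f i a * z a) = (\<Sum>a<d. \<Sum>i<d. M k i * f i a * z a)" by (rule sum.swap)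
    also have "\<dots> = (\<Sum>a<d. u k a * z a)"
      using u[OF that] by (intro sum.cong refl) (simp add: sum_distrib_right)
    finally show ?thesis using that by (simp add: h_def affm_apply)
  qed
  define p where "p = (\<Prod>k<d. M k k)"
  have p0: "p > 0" unfolding p_def using M(2) by (intro prod_pos) auto
  have "scales d (affm d (\<lambda>k i. - M k i) (\<lambda>_. 1)) (\<Prod>i<d. \<bar>- M i i\<bar>)"
  proof (rule scales_affm_triangular)
    show "- M i j = 0" if "i < d" "i < j" for i j using M(1) that by simp
    show "- M i i \<noteq> 0" if "i < d" for i using M(2)[OF that] by simp
  qed
  moreover have "(\<Prod>i<d. \<bar>- M i i\<bar>) = p" unfolding p_def using M(2) by (intro prod.cong refl) (simp add: less_imp_le)
  ultimately have hs: "scales d h (p * 1)"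
    unfolding h_def by (intro scales_comp[OF _ scales_orthonormal]) (simp_all add: on)
  define \<Delta> where "\<Delta> = h -` \<Sigma> \<inter> Rn d"
  have \<Delta>: "\<Delta> \<in> sets (leb_Rn d)"
    using measurable_sets[OF scalesD(2)[OF hs] emeasure_simplex(1)[OF t0]] by (simp add: \<Delta>_def \<Sigma>_def)
  have "lvol d \<Delta> * ennreal p = ennreal (t ^ d / fact d)"
    using scalesD(3)[OF hs emeasure_simplex(1)[OF t0]] emeasure_simplex(2)[OF t0, of d]
    by (simp add: \<Delta>_def \<Sigma>_def)
  then have "lvol d \<Delta> = ennreal (t ^ d / fact d / p)"
    by (rule ennreal_eq_divide) (use p0 t0 in auto)
  also have "t ^ d / fact d / p \<le> 1 / gam d"
  proof -
    define P where "P = (\<Prod>k<d. sqrt (1 - real k / real d))"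
    define t1 where "t1 = real d + real d * (sqrt (real d) + (\<Sum>k<d. sqrt (real k / real d)))"
    have "P \<le> p" unfolding P_def p_def
    proof (rule prod_mono, safe)
      fix k assume k: "k < d"
      show "0 \<le> sqrt (1 - real k / real d)" using k by simp
      show "sqrt (1 - real k / real d) \<le> M k k"
        using M(2,3)[OF k] by (intro real_le_lsqrt) auto
    qed
    moreover have "P > 0" unfolding P_def by (intro prod_pos) auto
    moreover have tt: "t \<le> t1" unfolding t_def t1_def using \<sigma> by (intro add_left_mono mult_left_mono) auto
    then have "t ^ d \<le> t1 ^ d" using t0 by (rule power_mono)
    moreover have "0 \<le> t1 ^ d" using t0 tt by simp
    ultimately have "t ^ d / (fact d * p) \<le> t1 ^ d / (fact d * P)"
      using t0 by (intro frac_le mult_left_mono) auto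
    then show ?thesis by (simp add: gam_def P_def t1_def)
  qed
  finally have vol: "lvol d \<Delta> \<le> ennreal (1 / gam d)" by (simp add: ennreal_leI)
  have "Rn d \<inter> (\<Inter>v\<in>V'. H v) \<subseteq> \<Delta>"
  proof
    fix z assume z: "z \<in> Rn d \<inter> (\<Inter>v\<in>V'. H v)"
    have "z \<notin> N"
    proof
      assume "z \<in> N"
      then have "z \<in> (\<Inter>j\<in>J'. K j)" using z by (auto simp: J'V K_def V'_def)
      with J'(3) show False by simp
    qed
    then have sz: "- (real d * \<sigma>) \<le> (\<Sum>a<d. s a * z a)" using z by (simp add: N_def not_less)
    have "0 \<le> h z k" if "k < d" for k
    proof -
      have "z \<in> H (v k)" using z that by (auto simp: V'_def)
      then show ?thesis using v(2)[OF that] h[OF that] by simp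
    qed
    moreover have "(\<Sum>k<d. h z k) \<le> t"
    proof -
      have "(\<Sum>k<d. h z k) = real d - (\<Sum>k<d. \<Sum>a<d. u k a * z a)" by (simp add: h sum_subtractf)
      also have "(\<Sum>k<d. \<Sum>a<d. u k a * z a) = (\<Sum>a<d. \<Sum>k<d. u k a * z a)" by (rule sum.swap)
      also have "\<dots> = (\<Sum>a<d. s a * z a)" by (simp add: s_def sum_distrib_right)
      finally show ?thesis using sz by (simp add: t_def)
    qed
    ultimately show "z \<in> \<Delta>" using z by (auto simp: \<Delta>_def \<Sigma>_def h_def)
  qed
  with V'W V'd \<Delta> vol show ?thesis by blast
qed

end

section \<open>Largest ellipsoids\<close>

lemma affm_comp:
  "affm d T x (affm d T' x' b)
    = affm d (\<lambda>i j. \<Sum>k<d. T i k * T' k j) (\<lambda>i. x i + (\<Sum>k<d. T i k * x' k)) b"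
proof (rule Rn_eqI[of _ d])
  fix i assume i: "i < d"
  have "(\<Sum>k<d. T i k * affm d T' x' b k) = (\<Sum>k<d. T i k * x' k + (\<Sum>j<d. T i k * T' k j * b j))"
    by (intro sum.cong refl) (simp add: affm_apply distrib_left sum_distrib_left mult.assoc)
  also have "\<dots> = (\<Sum>k<d. T i k * x' k) + (\<Sum>k<d. \<Sum>j<d. T i k * T' k j * b j)"
    by (rule sum.distrib)
  also have "(\<Sum>k<d. \<Sum>j<d. T i k * T' k j * b j) = (\<Sum>j<d. \<Sum>k<d. T i k * T' k j * b j)" by (rule sum.swap)
  finally show "affm d T x (affm d T' x' b) i
    = affm d (\<lambda>i j. \<Sum>k<d. T i k * T' k j) (\<lambda>i. x i + (\<Sum>k<d. T i k * x' k)) b i"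
    using i by (simp add: affm_apply sum_distrib_right)
qed simp_all

lemma affm_mix:
  assumes "s + t = (1::real)"
  shows "affm d T x (\<lambda>i. s * a i + t * b i) = (\<lambda>i. s * affm d T x a i + t * affm d T x b i)"
proof
  fix i
  show "affm d T x (\<lambda>i. s * a i + t * b i) i = s * affm d T x a i + t * affm d T x b i"
  proof (cases "i < d")
    case True
    have "(\<Sum>j<d. T i j * (s * a j + t * b j)) = s * (\<Sum>j<d. T i j * a j) + t * (\<Sum>j<d. T i j * b j)"
      unfolding sum_distrib_left sum.distrib[symmetric] by (intro sum.cong refl) (simp add: algebra_simps)
    moreover have "x i = s * x i + t * x i" using assms by (metis distrib_right mult_1)
    ultimately show ?thesis using True by (simp add: affm_apply algebra_simps)
  next
    case False
    then show ?thesis using assms by (simp add: affm_def distrib_right[symmetric])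
  qed
qed

lemma uball_coord: "b \<in> uball d \<Longrightarrow> i < d \<Longrightarrow> \<bar>b i\<bar> \<le> 1"
  using member_le_sum[of i "{..<d}" "\<lambda>i. (b i)\<^sup>2"] by (simp add: uball_def flip: abs_square_le_1)

definition lower_tri :: "nat \<Rightarrow> (nat \<Rightarrow> nat \<Rightarrow> real) \<Rightarrow> bool" where
  "lower_tri d T \<longleftrightarrow> (\<forall>i<d. \<forall>j<d. i < j \<longrightarrow> T i j = 0)"

lemma scales_lower_tri:
  assumes "lower_tri d T" "\<forall>i<d. 0 < T i i"
  shows "scales d (affm d T x) (\<Prod>i<d. T i i)"
proof -
  have "scales d (affm d T x) (\<Prod>i<d. \<bar>T i i\<bar>)"
    using assms by (intro scales_affm_triangular) (auto simp: lower_tri_def)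
  also have "(\<Prod>i<d. \<bar>T i i\<bar>) = (\<Prod>i<d. T i i)"
    using assms(2) by (intro prod.cong refl) (simp add: less_imp_le)
  finally show ?thesis .
qed

text \<open>With the diagonal only required to be nonnegative, the admissible pairs
  \<open>(T, x)\<close> form a compact set, so the determinant attains its maximum. A small ball is
  admissible, so the maximum is positive, and then so is each diagonal entry.\<close>

lemma max_triangular:
  fixes C :: "(nat \<Rightarrow> real) set"
  assumes C: "closed C" "C \<subseteq> cubeR d c R" "cubeR d c r \<subseteq> C" "0 < r"
  shows "\<exists>T x. lower_tri d T \<and> (\<forall>i<d. 0 < T i i) \<and> (\<forall>b\<in>uball d. affm d T x b \<in> C) \<and>
    (\<forall>T' x'. lower_tri d T' \<longrightarrow> (\<forall>i<d. 0 < T' i i) \<longrightarrow> (\<forall>b\<in>uball d. affm d T' x' b \<in> C) \<longrightarrow>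
      (\<Prod>i<d. T' i i) \<le> (\<Prod>i<d. T i i))"
proof -
  \<comment> \<open>The image of the origin bounds the centre, those of the unit vectors bound the
    matrix entries by \<open>2 * \<bar>R\<bar>\<close>.\<close>
  define B where "B = (\<Sum>i<d. \<bar>c i\<bar>) + 2 * \<bar>R\<bar> + r"
  \<comment> \<open>Pairs \<open>(i, j)\<close> with \<open>j \<le> i\<close> hold the matrix, pairs
    \<open>(i, d)\<close> the centre; all other coordinates are kept at 0 by
    \<open>box\<close>.\<close>
  define I where "I = {(i, j). i < d \<and> (j \<le> i \<or> j = d)}"
  define box where "box = PiE UNIV (\<lambda>p. if p \<in> I then {- B..B} else {0::real})"
  define sh where "sh = (\<lambda>p::nat \<times> nat \<Rightarrow> real. affm d (\<lambda>i j. p (i, j)) (\<lambda>i. p (i, d)))"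
  define Q where "Q = box \<inter> {p. (\<forall>i. i < d \<longrightarrow> 0 \<le> p (i, i))} \<inter> (\<Inter>b\<in>uball d. (\<lambda>p. sh p b) -` C)"
  have "compact box" unfolding box_def by (rule compact_PiE_UNIV) auto
  moreover have "closed {p::nat \<times> nat \<Rightarrow> real. (\<forall>i. i < d \<longrightarrow> 0 \<le> p (i, i))}"
    by (intro closed_Collect_all closed_Collect_imp closed_Collect_le continuous_intros continuous_on_coordinate) simp_all
  moreover have "closed (\<Inter>b\<in>uball d. (\<lambda>p. sh p b) -` C)"
  proof (intro closed_INT ballI closed_vimage C(1) continuous_on_coordinatewise_then_product)
    show "continuous_on UNIV (\<lambda>p. sh p b i)" for b i
      by (cases "i < d") (auto simp: sh_def affm_def intro!: continuous_intros continuous_on_coordinate)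
  qed
  ultimately have Qc: "compact Q" unfolding Q_def by (intro compact_Int_closed)
  have feas: "\<exists>q\<in>Q. (\<Prod>i<d. q (i, i)) = (\<Prod>i<d. T i i)"
    if T: "lower_tri d T" "\<forall>i<d. 0 < T i i" "\<forall>b\<in>uball d. affm d T x b \<in> C" for T x
  proof -
    define p where "p = (\<lambda>(i, j). if (i, j) \<in> I then if j = d then x i else T i j else 0)"
    have sh: "sh p b = affm d T x b" for b
    proof -
      have "p (i, j) = T i j" if "i < d" "j < d" for i j
        using that T(1) by (auto simp: p_def I_def lower_tri_def)
      moreover have "p (i, d) = x i" if "i < d" for i using that by (simp add: p_def I_def)
      ultimately show ?thesis unfolding sh_def affm_def by (intro restrict_ext) auto
    qed
    have bd: "\<bar>affm d T x b i - c i\<bar> \<le> R" if "b \<in> uball d" "i < d" for b i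
      using that T(3) C(2) by (auto simp: cubeR_def)
    have cB: "\<bar>c i\<bar> \<le> (\<Sum>i<d. \<bar>c i\<bar>)" if "i < d" for i
      using that by (intro member_le_sum[of i "{..<d}" "\<lambda>i. \<bar>c i\<bar>"]) auto
    have z: "(\<lambda>i\<in>{..<d}. 0) \<in> uball d" by (simp add: uball_def)
    have xi: "\<bar>x i - c i\<bar> \<le> R" if "i < d" for i
      using bd[OF z that] that by (simp add: affm_apply)
    have xB: "\<bar>x i\<bar> \<le> B" if "i < d" for i
      using xi[OF that] cB[OF that] C(4) by (simp add: B_def)
    have TB: "\<bar>T i j\<bar> \<le> B" if "i < d" "j < d" for i j
    proof -
      have "(\<lambda>k\<in>{..<d}. if k = j then 1 else 0) \<in> uball d"
        using that by (simp add: uball_def if_distrib[of "\<lambda>a. a\<^sup>2"] cong: if_cong)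
      from bd[OF this that(1)] have "\<bar>x i + T i j - c i\<bar> \<le> R"
        using that by (simp add: affm_apply if_distrib[of "\<lambda>a. _ * a"] cong: if_cong)
      with xi[OF that(1)] have "\<bar>T i j\<bar> \<le> 2 * \<bar>R\<bar>" by linarith
      moreover have "0 \<le> (\<Sum>i<d. \<bar>c i\<bar>)" by (intro sum_nonneg) auto
      ultimately show ?thesis using C(4) unfolding B_def by linarith
    qed
    have "p \<in> box"
    proof -
      have "p (i, j) \<in> (if (i, j) \<in> I then {- B..B} else {0})" for i j
        using xB[of i] TB[of i j] by (auto simp: p_def I_def abs_le_iff)
      then show ?thesis by (auto simp: box_def)
    qed
    moreover have "p (i, i) = T i i" if "i < d" for i using that by (simp add: p_def I_def)
    ultimately have "p \<in> Q \<and> (\<Prod>i<d. p (i, i)) = (\<Prod>i<d. T i i)"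
      using T by (auto simp: Q_def sh less_imp_le)
    then show ?thesis by blast
  qed
  define T0 where "T0 = (\<lambda>(i::nat) j. if i = j then r else 0 :: real)"
  have T0: "lower_tri d T0" "\<forall>i<d. 0 < T0 i i" "\<forall>b\<in>uball d. affm d T0 c b \<in> C"
  proof -
    show "lower_tri d T0" by (simp add: lower_tri_def T0_def)
    show "\<forall>i<d. 0 < T0 i i" using C(4) by (simp add: T0_def)
    have "affm d T0 c b \<in> cubeR d c r" if b: "b \<in> uball d" for b
    proof -
      have "\<bar>affm d T0 c b i - c i\<bar> \<le> r" if "i < d" for i
      proof -
        have "(\<Sum>j<d. T0 i j * b j) = r * b i"
          using that by (simp add: T0_def if_distrib[of "\<lambda>a. a * _"] cong: if_cong)
        then show ?thesis using uball_coord[OF b that] C(4) that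
          by (simp add: affm_apply abs_mult mult_left_le)
      qed
      then show ?thesis by (simp add: cubeR_def)
    qed
    then show "\<forall>b\<in>uball d. affm d T0 c b \<in> C" using C(3) by blast
  qed
  have "Q \<noteq> {}" using feas[OF T0] by blast
  moreover have "continuous_on Q (\<lambda>p. \<Prod>i<d. p (i, i))"
    by (intro continuous_intros continuous_on_coordinate)
  ultimately obtain p where p: "p \<in> Q" "\<And>q. q \<in> Q \<Longrightarrow> (\<Prod>i<d. q (i, i)) \<le> (\<Prod>i<d. p (i, i))"
    using continuous_attains_sup[OF Qc] by blast
  have best: "(\<Prod>i<d. T' i i) \<le> (\<Prod>i<d. p (i, i))"
    if "lower_tri d T'" "\<forall>i<d. 0 < T' i i" "\<forall>b\<in>uball d. affm d T' x' b \<in> C" for T' x'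
  proof -
    from feas[OF that] obtain q where "q \<in> Q" "(\<Prod>i<d. q (i, i)) = (\<Prod>i<d. T' i i)" by blast
    with p(2)[of q] show ?thesis by simp
  qed
  have "0 < (\<Prod>i<d. T0 i i)" using C(4) by (simp add: T0_def)
  also have "\<dots> \<le> (\<Prod>i<d. p (i, i))" by (rule best[OF T0])
  finally have pp: "0 < (\<Prod>i<d. p (i, i))" .
  have "0 < p (i, i)" if i: "i < d" for i
  proof -
    have "p (i, i) \<noteq> 0"
    proof
      assume "p (i, i) = 0"
      then have "(\<Prod>i<d. p (i, i)) = 0" using i by (intro prod_zero) auto
      with pp show False by simp
    qed
    moreover have "0 \<le> p (i, i)" using p(1) i by (simp add: Q_def)
    ultimately show ?thesis by simp
  qed
  moreover have "lower_tri d (\<lambda>i j. p (i, j))"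
  proof -
    have "p (i, j) = 0" if "i < j" "j < d" for i j
    proof -
      have "p (i, j) \<in> (if (i, j) \<in> I then {- B..B} else {0})"
        using p(1) by (auto simp: Q_def box_def PiE_iff)
      then show ?thesis using that by (auto simp: I_def)
    qed
    then show ?thesis by (simp add: lower_tri_def)
  qed
  moreover have "\<forall>b\<in>uball d. affm d (\<lambda>i j. p (i, j)) (\<lambda>i. p (i, d)) b \<in> C"
    using p(1) by (simp add: Q_def sh_def)
  ultimately show ?thesis using best
    by (intro exI[of _ "\<lambda>i j. p (i, j)"] exI[of _ "\<lambda>i. p (i, d)"]) blast
qed

text \<open>Pulling the sets back along the map of the largest ellipsoid produces the situation of
  \<open>max_ball\<close>; maximality transfers because lower triangular matrices multiply with
  multiplied diagonals. Some at most \<open>2 * d\<close> of the pulled back sets then meet in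
  volume at most \<open>1 / gam d\<close>, while the hypothesis gives at least
  \<open>\<kappa>\<close> divided by the determinant.\<close>

lemma max_position_volume:
  assumes d: "d > 0" and W: "finite W" "W \<noteq> {}"
    and K: "\<And>v. v \<in> W \<Longrightarrow> fconvex (K v)" "\<And>v. v \<in> W \<Longrightarrow> closed (K v)"
      "\<And>v. v \<in> W \<Longrightarrow> K v \<subseteq> cubeR d c R" "\<And>v. v \<in> W \<Longrightarrow> cubeR d c r \<subseteq> K v" "0 < r"
    and vol: "\<And>V'. V' \<subseteq> W \<Longrightarrow> card V' \<le> 2 * d \<Longrightarrow>
      \<exists>A\<in>sets (leb_Rn d). A \<subseteq> (\<Inter>v\<in>V'. K v) \<and> ennreal \<kappa> \<le> lvol d A"
  shows "\<exists>T x. lower_tri d T \<and> (\<forall>i<d. 0 < T i i) \<and> (\<forall>v\<in>W. \<forall>b\<in>uball d. affm d T x b \<in> K v) \<and>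
    \<kappa> * gam d \<le> (\<Prod>i<d. T i i)"
proof -
  have "\<exists>T x. lower_tri d T \<and> (\<forall>i<d. 0 < T i i) \<and> (\<forall>b\<in>uball d. affm d T x b \<in> (\<Inter>v\<in>W. K v)) \<and>
    (\<forall>T' x'. lower_tri d T' \<longrightarrow> (\<forall>i<d. 0 < T' i i) \<longrightarrow> (\<forall>b\<in>uball d. affm d T' x' b \<in> (\<Inter>v\<in>W. K v)) \<longrightarrow>
      (\<Prod>i<d. T' i i) \<le> (\<Prod>i<d. T i i))"
  proof (rule max_triangular)
    show "closed (\<Inter>v\<in>W. K v)" using K(2) by blast
    show "(\<Inter>v\<in>W. K v) \<subseteq> cubeR d c R" using W(2) K(3) by blast
    show "cubeR d c r \<subseteq> (\<Inter>v\<in>W. K v)" using K(4) by blast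
  qed (rule K)
  then obtain T x where T: "lower_tri d T" "\<forall>i<d. 0 < T i i" "\<forall>b\<in>uball d. affm d T x b \<in> (\<Inter>v\<in>W. K v)"
    and best: "\<And>T' x'. lower_tri d T' \<Longrightarrow> \<forall>i<d. 0 < T' i i \<Longrightarrow> \<forall>b\<in>uball d. affm d T' x' b \<in> (\<Inter>v\<in>W. K v)
      \<Longrightarrow> (\<Prod>i<d. T' i i) \<le> (\<Prod>i<d. T i i)"
    by (elim exE conjE) blast
  define D where "D = (\<Prod>i<d. T i i)"
  have D: "D > 0" unfolding D_def using T(2) by (intro prod_pos) auto
  define H where "H = (\<lambda>v. {b\<in>Rn d. affm d T x b \<in> K v})"
  interpret max_ball d W H
  proof
    show "fconvex (H v)" if "v \<in> W" for v
        proof (rule fconvexI)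
      fix a b and t :: real assume ab: "a \<in> H v" "b \<in> H v" and t: "0 \<le> t" "t \<le> 1"
      have "(\<lambda>i. (1 - t) * affm d T x a i + t * affm d T x b i) \<in> K v"
        using ab t by (intro fconvexD[OF K(1)[OF that]]) (auto simp: H_def)
      then show "(\<lambda>i. (1 - t) * a i + t * b i) \<in> H v"
        using ab t fconvexD[OF fconvex_Rn] by (auto simp: H_def affm_mix)
    qed
    show "uball d \<subseteq> H v" if "v \<in> W" for v
      using T(3) that by (auto simp: H_def uball_def)
    show "(\<Prod>i<d. T' i i) \<le> 1" if low: "\<And>i j. i < d \<Longrightarrow> j < d \<Longrightarrow> i < j \<Longrightarrow> T' i j = 0"
      and pos: "\<And>i. i < d \<Longrightarrow> 0 < T' i i"
      and sub: "\<And>v b. v \<in> W \<Longrightarrow> b \<in> uball d \<Longrightarrow> affm d T' x' b \<in> H v" for T' x'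
    proof -
      let ?U = "\<lambda>i j. \<Sum>k<d. T i k * T' k j"
      have diag: "?U i i = T i i * T' i i" if "i < d" for i
      proof -
        have "?U i i = (\<Sum>k<d. if k = i then T i k * T' k i else 0)"
          using T(1) low that by (intro sum.cong refl) (auto simp: lower_tri_def linorder_neq_iff)
        then show ?thesis using that by simp
      qed
      have "(\<Prod>i<d. ?U i i) \<le> D" unfolding D_def
      proof (rule best[where T'="?U" and x'="\<lambda>i. x i + (\<Sum>k<d. T i k * x' k)"])
        show "lower_tri d ?U" unfolding lower_tri_def
        proof (intro allI impI sum.neutral ballI)
          fix i j k assume "i < d" "j < d" "i < j" "k \<in> {..<d}"
          then show "T i k * T' k j = 0" using T(1) low
            by (cases "i < k") (auto simp: lower_tri_def)
        qed
        show "\<forall>i<d. 0 < ?U i i" using diag T(2) pos by simp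
        show "\<forall>b\<in>uball d. affm d ?U (\<lambda>i. x i + (\<Sum>k<d. T i k * x' k)) b \<in> (\<Inter>v\<in>W. K v)"
          using sub by (simp add: H_def affm_comp)
      qed
      moreover have "(\<Prod>i<d. ?U i i) = D * (\<Prod>i<d. T' i i)"
        unfolding D_def prod.distrib[symmetric] using diag by (intro prod.cong refl) auto
      ultimately show ?thesis using D by simp
    qed
  qed (use d W in \<open>auto simp: H_def\<close>)
  from few_sets_volume obtain V' \<Delta> where V': "V' \<subseteq> W" "card V' \<le> 2 * d" and \<Delta>: "\<Delta> \<in> sets (leb_Rn d)"
    "Rn d \<inter> (\<Inter>v\<in>V'. H v) \<subseteq> \<Delta>" "lvol d \<Delta> \<le> ennreal (1 / gam d)" by blast
  from vol[OF V'] obtain A where A: "A \<in> sets (leb_Rn d)" "A \<subseteq> (\<Inter>v\<in>V'. K v)" "ennreal \<kappa> \<le> lvol d A" by blast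
  have sc: "scales d (affm d T x) D" unfolding D_def using T(1,2) by (rule scales_lower_tri)
  have pre: "affm d T x -` A \<inter> Rn d \<subseteq> \<Delta>"
  proof
    fix b assume b: "b \<in> affm d T x -` A \<inter> Rn d"
    then have "b \<in> H v" if "v \<in> V'" for v using A(2) that by (auto simp: H_def)
    then show "b \<in> \<Delta>" using b \<Delta>(2) by blast
  qed
  have "ennreal \<kappa> \<le> lvol d (affm d T x -` A \<inter> Rn d) * ennreal D"
    using A scalesD(3)[OF sc A(1)] by simp
  also have "\<dots> \<le> ennreal (1 / gam d) * ennreal D"
    using emeasure_mono[OF pre \<Delta>(1)] \<Delta>(3) by (intro mult_right_mono) auto
  also have "\<dots> = ennreal (D / gam d)"
    using D gam_pos[OF d] by (simp add: ennreal_mult[symmetric])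
  finally have "\<kappa> \<le> D / gam d" using D gam_pos[OF d] by (simp add: ennreal_le_iff)
  then have "\<kappa> * gam d \<le> D" using gam_pos[OF d] by (simp add: pos_le_divide_eq)
  with T show ?thesis unfolding D_def by blast
qed

section \<open>A quantitative Helly theorem\<close>

lemma tendsto_coordinatewise:
  fixes f :: "'a \<Rightarrow> 'i \<Rightarrow> 'b::topological_space"
  assumes "\<And>i. ((\<lambda>n. f n i) \<longlongrightarrow> l i) F"
  shows "(f \<longlongrightarrow> l) F"
  using limitin_componentwise[of "\<lambda>_. euclidean" UNIV f l F] assms
  by (simp add: euclidean_product_topology)

text \<open>Helly's theorem for the sets of centres of cubes of one radius \<open>r\<close> inside
  the \<open>F v\<close>. Few of the \<open>F v\<close> share a cube because their intersection has
  positive volume, and as there are finitely many subfamilies, one \<open>r\<close> serves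
  all.\<close>

lemma common_cube:
  assumes d: "d > 0" and W: "finite W"
    and F: "\<And>v. v \<in> W \<Longrightarrow> fconvex (F v)" "\<And>v. v \<in> W \<Longrightarrow> F v \<subseteq> Rn d"
    and vol: "\<And>V'. V' \<subseteq> W \<Longrightarrow> card V' \<le> 2 * d \<Longrightarrow> vol_Rn d (Inter_Rn d F V') \<noteq> 0"
  shows "\<exists>c\<in>Rn d. \<exists>r>0. \<forall>v\<in>W. cubeR d c r \<subseteq> F v"
proof (cases "W = {}")
  case True
  have "restrict (\<lambda>_. 0) {..<d} \<in> Rn d" by (rule restrict_in_Rn)
  then show ?thesis using True by (intro bexI[of _ "restrict (\<lambda>_. 0) {..<d}"] exI[of _ 1]) auto
next
  case False
  define \<V> where "\<V> = {V'. V' \<subseteq> W \<and> card V' \<le> 2 * d}"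
  have fin: "finite \<V>" unfolding \<V>_def using W by auto
  have "\<forall>V'\<in>\<V>. \<exists>c r. c \<in> Rn d \<and> 0 < r \<and> cubeR d c r \<subseteq> Inter_Rn d F V'"
  proof
    fix V' assume V': "V' \<in> \<V>"
    have "fconvex (Inter_Rn d F V')" unfolding Inter_Rn_def
      using V' F(1) by (intro fconvex_Int fconvex_Inter fconvex_Rn) (auto simp: \<V>_def)
    moreover have "Inter_Rn d F V' \<subseteq> Rn d" by (auto simp: Inter_Rn_def)
    ultimately have "\<exists>c\<in>Rn d. \<exists>r>0. cubeR d c r \<subseteq> Inter_Rn d F V'"
      using vol V' by (intro pos_volume_contains_cube) (auto simp: \<V>_def)
    then show "\<exists>c r. c \<in> Rn d \<and> 0 < r \<and> cubeR d c r \<subseteq> Inter_Rn d F V'" by blast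
  qed
  then obtain c \<rho> where "\<forall>V'\<in>\<V>. c V' \<in> Rn d \<and> 0 < \<rho> V' \<and> cubeR d (c V') (\<rho> V') \<subseteq> Inter_Rn d F V'"
    unfolding bchoice_iff by (elim exE that)
  then have c: "c V' \<in> Rn d \<and> 0 < \<rho> V' \<and> cubeR d (c V') (\<rho> V') \<subseteq> Inter_Rn d F V'" if "V' \<in> \<V>" for V'
    using that by blast
  define r where "r = Min (\<rho> ` \<V>)"
  have "{} \<in> \<V>" by (simp add: \<V>_def)
  then have r: "0 < r" unfolding r_def using fin c by (subst Min_gr_iff) auto
  define K where "K = (\<lambda>v. {a\<in>Rn d. cubeR d a r \<subseteq> F v})"
  have "(\<Inter>v\<in>W. K v) \<noteq> {}"
  proof (rule Helly_fun[where I="{..<d}" and w="\<lambda>_. undefined"])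
    show "fconvex (K v)" if v: "v \<in> W" for v
        proof (rule fconvexI)
      fix a b and t :: real assume ab: "a \<in> K v" "b \<in> K v" and t: "0 \<le> t" "t \<le> 1"
      have "cubeR d (\<lambda>i. (1 - t) * a i + t * b i) r \<subseteq> F v"
      proof
        fix z assume z: "z \<in> cubeR d (\<lambda>i. (1 - t) * a i + t * b i) r"
        \<comment> \<open>The offset of \<open>z\<close> from the mixed centre, transported to both
          given cubes.\<close>
        define e where "e = (\<lambda>i. z i - ((1 - t) * a i + t * b i))"
        have "(\<lambda>i\<in>{..<d}. a i + e i) \<in> cubeR d a r" "(\<lambda>i\<in>{..<d}. b i + e i) \<in> cubeR d b r"
          using z by (auto simp: cubeR_def e_def)
        then have abF: "(\<lambda>i\<in>{..<d}. a i + e i) \<in> F v" "(\<lambda>i\<in>{..<d}. b i + e i) \<in> F v"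
          using ab unfolding K_def by blast+
        have "(\<lambda>i. (1 - t) * (\<lambda>i\<in>{..<d}. a i + e i) i + t * (\<lambda>i\<in>{..<d}. b i + e i) i) \<in> F v"
          using t by (intro fconvexD[OF F(1)[OF v] abF]) auto
        also have "(\<lambda>i. (1 - t) * (\<lambda>i\<in>{..<d}. a i + e i) i + t * (\<lambda>i\<in>{..<d}. b i + e i) i) = z"
        proof
          fix i
          show "(1 - t) * (\<lambda>i\<in>{..<d}. a i + e i) i + t * (\<lambda>i\<in>{..<d}. b i + e i) i = z i"
            using z by (cases "i < d") (auto simp: e_def cubeR_def Rn_outside algebra_simps)
        qed
        finally show "z \<in> F v" .
      qed
      then show "(\<lambda>i. (1 - t) * a i + t * b i) \<in> K v"
        using ab t fconvexD[OF fconvex_Rn] by (auto simp: K_def)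
    qed
    show "x i = undefined" if "x \<in> K v" "i \<notin> {..<d}" for v x i
      using that by (auto simp: K_def Rn_outside)
    show "(\<Inter>v\<in>V'. K v) \<noteq> {}" if "V' \<subseteq> W" "card V' \<le> Suc (card {..<d})" for V'
    proof -
      \<comment> \<open>Here \<open>d + 1 \<le> 2 * d\<close> enters: the hypothesis covers the
        subfamilies needed for Helly's theorem.\<close>
      have V': "V' \<in> \<V>" using that d by (simp add: \<V>_def)
      have "r \<le> \<rho> V'" unfolding r_def using fin V' by (intro Min_le) auto
      then have "cubeR d (c V') r \<subseteq> cubeR d (c V') (\<rho> V')" by (auto simp: cubeR_def)
      then have "c V' \<in> K v" if "v \<in> V'" for v using c[OF V'] that by (auto simp: K_def Inter_Rn_def)
      then show ?thesis by blast
    qed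
  qed (use W in auto)
  then obtain a where a: "\<And>v. v \<in> W \<Longrightarrow> a \<in> K v" by blast
  then have "a \<in> Rn d" "\<forall>v\<in>W. cubeR d a r \<subseteq> F v" using False by (auto simp: K_def)
  with r show ?thesis by blast
qed

text \<open>Continuity from below along growing cubes; \<open>\<theta> < 1\<close> leaves room, also
  when \<open>A\<close> has infinite volume.\<close>

lemma truncate_volume:
  assumes "A \<in> sets (leb_Rn d)" "1 \<le> lvol d A" "\<theta> < 1"
  shows "\<exists>n. \<forall>m\<ge>n. ennreal \<theta> \<le> lvol d (A \<inter> cubeR d c (real (Suc m)))"
proof -
  have inc: "incseq (\<lambda>m. A \<inter> cubeR d c (real (Suc m)))" unfolding incseq_def by (force simp: cubeR_def)
  have "(\<lambda>m. lvol d (A \<inter> cubeR d c (real (Suc m)))) \<longlonglongrightarrow> lvol d (\<Union>m. A \<inter> cubeR d c (real (Suc m)))"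
    using assms(1) inc by (intro Lim_emeasure_incseq) (auto intro: cubeR_sets)
  then have lim: "(\<lambda>m. lvol d (A \<inter> cubeR d c (real (Suc m)))) \<longlonglongrightarrow> lvol d A"
    using Union_cubeR[of A d c] sets.sets_into_space[OF assms(1)] by simp
  have "ennreal \<theta> < 1" using assms(3) by (simp add: ennreal_less_one_iff)
  then have "ennreal \<theta> < lvol d A" using assms(2) by (rule less_le_trans)
  from order_tendstoD(1)[OF lim this] obtain n where
    "\<forall>m\<ge>n. ennreal \<theta> < lvol d (A \<inter> cubeR d c (real (Suc m)))" by (auto simp: eventually_sequentially)
  then show ?thesis by (auto intro: less_imp_le)
qed

text \<open>Each \<open>F v\<close> is cut off by a large cube, closed, and contracted by
  \<open>\<theta>\<close> towards the centre of a common cube, which brings it back into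
  \<open>F v\<close>. The cut costs a factor \<open>\<theta>\<close> in volume and the contraction
  \<open>\<theta> ^ d\<close>, together \<open>\<kappa>\<close>.\<close>

theorem quantitative_Helly:
  assumes d: "d > 0" and W: "finite W"
    and F: "\<And>v. v \<in> W \<Longrightarrow> fconvex (F v)" "\<And>v. v \<in> W \<Longrightarrow> F v \<subseteq> Rn d"
    and vol: "\<And>V'. V' \<subseteq> W \<Longrightarrow> card V' \<le> 2 * d \<Longrightarrow> 1 \<le> vol_Rn d (Inter_Rn d F V')"
    and \<kappa>: "0 < \<kappa>" "\<kappa> < 1"
  shows "\<exists>T x. lower_tri d T \<and> (\<forall>i<d. 0 < T i i) \<and> (\<forall>v\<in>W. \<forall>b\<in>uball d. affm d T x b \<in> F v) \<and>
    \<kappa> * gam d \<le> (\<Prod>i<d. T i i)"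
proof (cases "W = {}")
  case True
  \<comment> \<open>Without sets to respect, any large ball will do.\<close>
  define t where "t = max 1 (\<kappa> * gam d)"
  have "t ^ 1 \<le> t ^ d" using d by (intro power_increasing) (auto simp: t_def)
  then have "\<kappa> * gam d \<le> t ^ d" by (simp add: t_def)
  with True show ?thesis
    by (intro exI[of _ "\<lambda>i j. if i = j then t else 0"]) (auto simp: lower_tri_def t_def)
next
  case False
  have "\<exists>c\<in>Rn d. \<exists>r>0. \<forall>v\<in>W. cubeR d c r \<subseteq> F v"
  proof (rule common_cube[OF d W F])
    show "vol_Rn d (Inter_Rn d F V') \<noteq> 0" if "V' \<subseteq> W" "card V' \<le> 2 * d" for V'
      using vol[OF that] by auto
  qed
  then obtain c r where c: "c \<in> Rn d" "0 < r" "\<And>v. v \<in> W \<Longrightarrow> cubeR d c r \<subseteq> F v" by blast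
  define \<theta> where "\<theta> = root (Suc d) \<kappa>"
  have \<theta>: "0 < \<theta>" "\<theta> < 1" "\<theta> ^ d * \<theta> = \<kappa>"
    using \<kappa> real_root_pow_pos[of "Suc d" \<kappa>] by (auto simp: \<theta>_def mult.commute)
  define \<V> where "\<V> = {V'. V' \<subseteq> W \<and> card V' \<le> 2 * d}"
  have fin: "finite \<V>" unfolding \<V>_def using W by auto
  \<comment> \<open>A part of full measure that is measurable without completion, as
    \<open>scales\<close> speaks of the uncompleted measure.\<close>
  define A where "A = (\<lambda>V'. main_part (leb_Rn d) (Inter_Rn d F V'))"
  have A: "A V' \<in> sets (leb_Rn d)" "1 \<le> lvol d (A V')" "A V' \<subseteq> Inter_Rn d F V'" if "V' \<in> \<V>" for V'
  proof -
    have v1: "1 \<le> vol_Rn d (Inter_Rn d F V')" using vol that by (auto simp: \<V>_def)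
    \<comment> \<open>Nonmeasurable sets have measure 0 by convention, so volume at least 1 yields
      measurability.\<close>
    then have m: "Inter_Rn d F V' \<in> sets (completion (leb_Rn d))"
      unfolding vol_Rn_def by (metis emeasure_notin_sets not_one_le_zero)
    show "A V' \<in> sets (leb_Rn d)" unfolding A_def using m by (rule main_part_sets)
    show "1 \<le> lvol d (A V')" using v1 m by (simp add: vol_Rn_def A_def)
    show "A V' \<subseteq> Inter_Rn d F V'" unfolding A_def using main_part_null_part_Un[OF m] by blast
  qed
  have "\<forall>V'\<in>\<V>. \<exists>n. \<forall>m\<ge>n. ennreal \<theta> \<le> lvol d (A V' \<inter> cubeR d c (real (Suc m)))"
    using A truncate_volume[OF _ _ \<theta>(2)] by blast
  then obtain n where n: "\<forall>V'\<in>\<V>. \<forall>m\<ge>n V'. ennreal \<theta> \<le> lvol d (A V' \<inter> cubeR d c (real (Suc m)))"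
    unfolding bchoice_iff by blast
  define R where "R = real (Suc (Max (n ` \<V>)))"
  have R1: "1 \<le> R" by (simp add: R_def)
  have vR: "ennreal \<theta> \<le> lvol d (A V' \<inter> cubeR d c R)" if "V' \<in> \<V>" for V'
  proof -
    have "n V' \<le> Max (n ` \<V>)" using fin that by (intro Max_ge) auto
    then show ?thesis using n that unfolding R_def by blast
  qed
  define \<rho> where "\<rho> = min r 1"
  have \<rho>: "0 < \<rho>" using c(2) by (simp add: \<rho>_def)
  define G where "G = (\<lambda>v. F v \<inter> cubeR d c R)"
  have G: "fconvex (G v)" "G v \<subseteq> Rn d" "cubeR d c \<rho> \<subseteq> G v" "G v \<subseteq> cubeR d c R" if "v \<in> W" for v
  proof -
    show "fconvex (G v)" unfolding G_def using F(1)[OF that] by (intro fconvex_Int fconvex_cubeR)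
    show "G v \<subseteq> Rn d" "G v \<subseteq> cubeR d c R" using F(2)[OF that] by (auto simp: G_def)
    have "cubeR d c \<rho> \<subseteq> cubeR d c r" "cubeR d c \<rho> \<subseteq> cubeR d c R" using R1 by (force simp: cubeR_def \<rho>_def)+
    then show "cubeR d c \<rho> \<subseteq> G v" using c(3)[OF that] by (auto simp: G_def)
  qed
  define g where "g = (\<lambda>z. \<lambda>i\<in>{..<d}. (1 - 1 / \<theta>) * c i + 1 / \<theta> * z i)"
  have gs: "scales d g ((1 / \<theta>) ^ d)" unfolding g_def by (rule scales_homothety) (use \<theta> in simp)
  \<comment> \<open>\<open>g\<close> inverts the contraction by \<open>\<theta>\<close>, so
    \<open>K v\<close> is the contracted closure of \<open>G v\<close>.\<close>
  define K where "K = (\<lambda>v. {z\<in>Rn d. g z \<in> closure (G v)})"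
  have clc: "closure (G v) \<subseteq> cubeR d c R" if "v \<in> W" for v
    using G(4)[OF that] closed_cubeR by (rule closure_minimal)
  have KF: "K v \<subseteq> F v" if "v \<in> W" for v
  proof
    fix z assume z: "z \<in> K v"
    then have zR: "z \<in> Rn d" by (simp add: K_def)
    have "(\<lambda>i. (1 - \<theta>) * c i + \<theta> * g z i) \<in> G v"
      by (rule closure_shrink[OF G(1,2)[OF that] c(1) \<rho> G(3)[OF that]]) (use z \<theta> in \<open>auto simp: K_def\<close>)
    also have "(\<lambda>i. (1 - \<theta>) * c i + \<theta> * g z i) = z"
    proof
      fix i
      show "(1 - \<theta>) * c i + \<theta> * g z i = z i"
        using \<theta> zR c(1) by (cases "i < d") (simp_all add: g_def Rn_outside field_simps)
    qed
    finally show "z \<in> F v" by (simp add: G_def)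
  qed
  have gc: "g z i - c i = (z i - c i) / \<theta>" if "i < d" for z i
    using that \<theta> by (simp add: g_def field_simps)
  have "\<exists>T x. lower_tri d T \<and> (\<forall>i<d. 0 < T i i) \<and> (\<forall>v\<in>W. \<forall>b\<in>uball d. affm d T x b \<in> K v) \<and>
    \<kappa> * gam d \<le> (\<Prod>i<d. T i i)"
  proof (rule max_position_volume[where c=c and R=R and r="\<theta> * \<rho>"])
    show "0 < \<theta> * \<rho>" using \<theta> \<rho> by simp
    fix v assume v: "v \<in> W"
    show "fconvex (K v)"
    proof (rule fconvexI)
      fix a b and t :: real assume ab: "a \<in> K v" "b \<in> K v" and t: "0 \<le> t" "t \<le> 1"
      have cl: "fconvex (closure (G v))"
      proof (rule fconvexI)
        fix a b and t :: real assume ab: "a \<in> closure (G v)" "b \<in> closure (G v)" and t: "0 \<le> t" "t \<le> 1"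
        obtain p q where p: "\<And>n. p n \<in> G v" "p \<longlonglongrightarrow> a" and q: "\<And>n. q n \<in> G v" "q \<longlonglongrightarrow> b"
          using ab unfolding closure_sequential by blast
        have pq: "(\<lambda>n. p n i) \<longlonglongrightarrow> a i" "(\<lambda>n. q n i) \<longlonglongrightarrow> b i" for i
          using continuous_on_tendsto_compose[OF continuous_on_coordinate[of UNIV i] p(2)]
            continuous_on_tendsto_compose[OF continuous_on_coordinate[of UNIV i] q(2)] by simp_all
        have "(\<lambda>n i. (1 - t) * p n i + t * q n i) \<longlonglongrightarrow> (\<lambda>i. (1 - t) * a i + t * b i)"
          by (rule tendsto_coordinatewise) (intro tendsto_intros pq)
        moreover have "(\<lambda>i. (1 - t) * p n i + t * q n i) \<in> G v" for n
          using p(1) q(1) t by (intro fconvexD[OF G(1)[OF v]]) auto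
        ultimately show "(\<lambda>i. (1 - t) * a i + t * b i) \<in> closure (G v)"
          unfolding closure_sequential by (intro exI[of _ "\<lambda>n i. (1 - t) * p n i + t * q n i"]) simp
      qed
      have "(\<lambda>i. (1 - t) * g a i + t * g b i) \<in> closure (G v)"
        using ab t by (intro fconvexD[OF cl]) (auto simp: K_def)
      moreover have "(\<lambda>i. (1 - t) * g a i + t * g b i) = g (\<lambda>i. (1 - t) * a i + t * b i)"
        by (rule ext) (use \<theta>(1) in \<open>auto simp: g_def field_simps\<close>)
      ultimately show "(\<lambda>i. (1 - t) * a i + t * b i) \<in> K v"
        using ab t fconvexD[OF fconvex_Rn] by (auto simp: K_def)
    qed
    show "closed (K v)"
    proof -
      have "continuous_on UNIV g"
      proof (rule continuous_on_coordinatewise_then_product)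
        show "continuous_on UNIV (\<lambda>z. g z i)" for i
          using \<theta>(1) by (cases "i < d") (auto simp: g_def intro!: continuous_intros continuous_on_coordinate)
      qed
      then have "closed (Rn d \<inter> g -` closure (G v))" by (intro closed_Int closed_Rn closed_vimage) auto
      also have "Rn d \<inter> g -` closure (G v) = K v" by (auto simp: K_def)
      finally show ?thesis .
    qed
    show "K v \<subseteq> cubeR d c R"
    proof
      fix z assume z: "z \<in> K v"
      then have "g z \<in> cubeR d c R" using clc[OF v] by (auto simp: K_def)
      then have b: "\<bar>z i - c i\<bar> / \<theta> \<le> R" if "i < d" for i
        using gc[OF that, of z] that \<theta> by (auto simp: cubeR_def abs_divide)
      have "\<bar>z i - c i\<bar> \<le> R" if "i < d" for i
      proof -
        have "\<bar>z i - c i\<bar> \<le> R * \<theta>" using b[OF that] \<theta> by (simp add: pos_divide_le_eq)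
        also have "\<dots> \<le> R" using \<theta> R1 by (simp add: mult_left_le)
        finally show ?thesis .
      qed
      then show "z \<in> cubeR d c R" using z by (simp add: cubeR_def K_def)
    qed
    show "cubeR d c (\<theta> * \<rho>) \<subseteq> K v"
    proof
      fix z assume z: "z \<in> cubeR d c (\<theta> * \<rho>)"
      have "\<bar>g z i - c i\<bar> \<le> \<rho>" if "i < d" for i
        using z that \<theta> by (simp add: gc cubeR_def abs_divide pos_divide_le_eq mult.commute)
      then have "g z \<in> cubeR d c \<rho>" by (simp add: cubeR_def g_def)
      then have "g z \<in> closure (G v)" using G(3)[OF v] closure_subset by blast
      then show "z \<in> K v" using z by (simp add: K_def cubeR_def)
    qed
  next
    fix V' assume "V' \<subseteq> W" "card V' \<le> 2 * d"
    then have V': "V' \<in> \<V>" by (simp add: \<V>_def)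
    define S where "S = g -` (A V' \<inter> cubeR d c R) \<inter> Rn d"
    have AR: "A V' \<inter> cubeR d c R \<in> sets (leb_Rn d)" using A(1)[OF V'] by (intro sets.Int cubeR_sets)
    have S: "S \<in> sets (leb_Rn d)" using measurable_sets[OF scalesD(2)[OF gs] AR] by (simp add: S_def)
    have "lvol d S * ennreal ((1 / \<theta>) ^ d) = lvol d (A V' \<inter> cubeR d c R)"
      unfolding S_def by (rule scalesD(3)[OF gs AR])
    then have "ennreal \<theta> * ennreal (\<theta> ^ d) \<le> lvol d S * ennreal ((1 / \<theta>) ^ d) * ennreal (\<theta> ^ d)"
      using vR[OF V'] by (intro mult_right_mono) auto
    also have "\<dots> = lvol d S"
    proof -
      have "(1 / \<theta>) ^ d * \<theta> ^ d = 1" using \<theta> by (simp add: power_mult_distrib[symmetric])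
      then have "ennreal ((1 / \<theta>) ^ d) * ennreal (\<theta> ^ d) = 1" using \<theta> by (simp add: ennreal_mult[symmetric])
      then show ?thesis by (simp add: mult.assoc)
    qed
    also have "ennreal \<theta> * ennreal (\<theta> ^ d) = ennreal \<kappa>"
      using \<theta> by (simp add: ennreal_mult[symmetric] mult.commute)
    finally have "ennreal \<kappa> \<le> lvol d S" .
    moreover have "S \<subseteq> (\<Inter>v\<in>V'. K v)"
    proof (intro subsetI INT_I)
      fix z v assume z: "z \<in> S" and v: "v \<in> V'"
      have "g z \<in> G v" using z v A(3)[OF V'] by (auto simp: S_def G_def Inter_Rn_def)
      then have "g z \<in> closure (G v)" using closure_subset by blast
      then show "z \<in> K v" using z by (simp add: K_def S_def)
    qed
    ultimately show "\<exists>A\<in>sets (leb_Rn d). A \<subseteq> (\<Inter>v\<in>V'. K v) \<and> ennreal \<kappa> \<le> lvol d A"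
      using S by blast
  qed (use d W False in auto)
  then obtain T x where "lower_tri d T" "\<forall>i<d. 0 < T i i" "\<forall>v\<in>W. \<forall>b\<in>uball d. affm d T x b \<in> K v"
    "\<kappa> * gam d \<le> (\<Prod>i<d. T i i)" by (elim exE conjE that)
  with KF show ?thesis by blast
qed

section \<open>Ellipsoids of fixed volume\<close>

text \<open>The weighted inequality of arithmetic and geometric means, used twice: factor by factor
  to bound the product from below, then for the two reciprocals.\<close>

lemma inverse_prod_convex:
  fixes a b :: "'i \<Rightarrow> real"
  assumes "finite A" "\<And>i. i \<in> A \<Longrightarrow> 0 < a i" "\<And>i. i \<in> A \<Longrightarrow> 0 < b i" "0 \<le> t" "t \<le> 1"
  shows "1 / (\<Prod>i\<in>A. (1 - t) * a i + t * b i) \<le> (1 - t) * (1 / prod a A) + t * (1 / prod b A)"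
proof -
  have pos: "0 < prod a A" "0 < prod b A" using assms by (auto intro: prod_pos)
  have powr_prod: "(prod c A) powr s = (\<Prod>i\<in>A. c i powr s)" if "\<And>i. i \<in> A \<Longrightarrow> 0 < c i" for c :: "'i \<Rightarrow> real" and s
    using assms(1) that
    by (induction A rule: finite_induct) (auto simp: powr_mult prod_nonneg less_imp_le)
  have "(prod a A) powr (1 - t) * (prod b A) powr t = (\<Prod>i\<in>A. a i powr (1 - t) * b i powr t)"
    using assms by (simp add: powr_prod prod.distrib)
  also have "\<dots> \<le> (\<Prod>i\<in>A. (1 - t) * a i + t * b i)"
    using assms by (intro prod_mono conjI Youngs_inequality_0) (auto simp: less_imp_le)
  finally have "1 / (\<Prod>i\<in>A. (1 - t) * a i + t * b i) \<le> 1 / ((prod a A) powr (1 - t) * (prod b A) powr t)"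
    using pos by (intro frac_le) auto
  also have "\<dots> = (1 / prod a A) powr (1 - t) * (1 / prod b A) powr t"
    using pos by (simp add: powr_divide)
  also have "\<dots> \<le> (1 - t) * (1 / prod a A) + t * (1 / prod b A)"
    using pos assms by (intro Youngs_inequality_0) auto
  finally show ?thesis .
qed

text \<open>Decreasing the last diagonal entry of a lower triangular matrix amounts to shrinking the
  last coordinate of its argument, as the last column has no other entry. Hence the thinner
  ellipsoid lies in the thicker one.\<close>

lemma uball_shrink_coord:
  assumes "b \<in> uball d" "k < d" "0 \<le> s" "s \<le> 1"
  shows "b(k := s * b k) \<in> uball d"
proof -
  have "((b(k := s * b k)) i)\<^sup>2 \<le> (b i)\<^sup>2" for i
  proof (cases "i = k")
    case True
    have "s\<^sup>2 * (b k)\<^sup>2 \<le> 1 * (b k)\<^sup>2" using assms by (intro mult_right_mono) (auto simp: power_le_one)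
    then show ?thesis using True by (simp add: power_mult_distrib)
  qed simp
  then have "(\<Sum>i<d. ((b(k := s * b k)) i)\<^sup>2) \<le> (\<Sum>i<d. (b i)\<^sup>2)" by (intro sum_mono)
  moreover have "b(k := s * b k) \<in> Rn d" using assms by (intro Rn_fun_upd) (auto simp: uball_def)
  ultimately show ?thesis using assms(1) unfolding uball_def by auto
qed

text \<open>Ellipsoids of a fixed volume are parametrised by the lower triangular matrix and the centre, the last diagonal
  entry being determined by the volume. This saves one dimension, and the condition of lying in a convex
  set remains convex because the determined entry is a convex function of the others.\<close>

definition ell_index :: "nat \<Rightarrow> (nat \<times> nat) set" where
  "ell_index d = {(i, j). i < d \<and> (j \<le> i \<or> j = d)} - {(d - 1, d - 1)}"

definition ell_matrix :: "nat \<Rightarrow> real \<Rightarrow> (nat \<times> nat \<Rightarrow> real) \<Rightarrow> nat \<Rightarrow> nat \<Rightarrow> real" where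
  "ell_matrix d \<gamma> p i j = (if i = d - 1 \<and> j = d - 1 then \<gamma> * (1 / (\<Prod>k<d - 1. p (k, k))) else p (i, j))"

definition ell_params :: "nat \<Rightarrow> (nat \<times> nat \<Rightarrow> real) set" where
  "ell_params d = {p. (\<forall>k. k \<notin> ell_index d \<longrightarrow> p k = 0) \<and> (\<forall>i<d - 1. 0 < p (i, i))}"

abbreviation ell_map :: "nat \<Rightarrow> real \<Rightarrow> (nat \<times> nat \<Rightarrow> real) \<Rightarrow> (nat \<Rightarrow> real) \<Rightarrow> nat \<Rightarrow> real" where
  "ell_map d \<gamma> p \<equiv> affm d (ell_matrix d \<gamma> p) (\<lambda>i. p (i, d))"

definition ell_in :: "nat \<Rightarrow> real \<Rightarrow> (nat \<Rightarrow> real) set \<Rightarrow> (nat \<times> nat \<Rightarrow> real) set" where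
  "ell_in d \<gamma> S = {p\<in>ell_params d. \<forall>b\<in>uball d. ell_map d \<gamma> p b \<in> S}"

text \<open>Row \<open>i\<close> contributes \<open>i + 1\<close> matrix entries and one coordinate
  of the centre; the last diagonal entry is then removed.\<close>

lemma finite_card_ell_index:
  assumes "d > 0"
  shows "finite (ell_index d)" "real (card (ell_index d)) = real d * (real d + 3) / 2 - 1"
proof -
  define A where "A = (SIGMA i:{..<d}. insert d {..i})"
  have "{(i, j). i < d \<and> (j \<le> i \<or> j = d)} = A" unfolding A_def by force
  then have A: "ell_index d = A - {(d - 1, d - 1)}" by (simp add: ell_index_def)
  have fin: "finite A" by (simp add: A_def)
  then show "finite (ell_index d)" by (simp add: A)
  have "(d - 1, d - 1) \<in> A" using assms by (simp add: A_def)
  then have c: "card A = Suc (card (ell_index d))" using fin unfolding A by (rule card.remove[rotated])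
  have "card A = (\<Sum>i<d. card (insert d {..i}))" unfolding A_def by simp
  also have "\<dots> = (\<Sum>i<d. i + 2)" by (intro sum.cong refl) (simp add: card_insert_if)
  finally have "real (card A) = (\<Sum>i<d. real i + 2)" by (simp add: add.commute)
  also have "\<dots> = real d * (real d + 3) / 2"
    by (induction d) (simp_all add: field_simps)
  finally show "real (card (ell_index d)) = real d * (real d + 3) / 2 - 1" using c by simp
qed

lemma lower_tri_ell_matrix:
  assumes "p \<in> ell_params d" shows "lower_tri d (ell_matrix d \<gamma> p)"
  using assms by (auto simp: lower_tri_def ell_matrix_def ell_params_def ell_index_def)

lemma ell_diag_pos:
  assumes "p \<in> ell_params d" "\<gamma> > 0" "i < d" shows "0 < ell_matrix d \<gamma> p i i"
  using assms by (auto simp: ell_matrix_def ell_params_def intro!: divide_pos_pos mult_pos_pos prod_pos)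

lemma prod_ell_matrix:
  assumes "p \<in> ell_params d" "d > 0"
  shows "(\<Prod>i<d. ell_matrix d \<gamma> p i i) = \<gamma>"
proof -
  have pos: "0 < (\<Prod>k<d - 1. p (k, k))" using assms by (intro prod_pos) (auto simp: ell_params_def)
  have "{..<d} = insert (d - 1) {..<d - 1}" using assms(2) by auto
  then have "(\<Prod>i<d. ell_matrix d \<gamma> p i i) = ell_matrix d \<gamma> p (d - 1) (d - 1) * (\<Prod>i<d - 1. ell_matrix d \<gamma> p i i)" by simp
  also have "(\<Prod>i<d - 1. ell_matrix d \<gamma> p i i) = (\<Prod>k<d - 1. p (k, k))"
    by (intro prod.cong) (auto simp: ell_matrix_def)
  also have "ell_matrix d \<gamma> p (d - 1) (d - 1) = \<gamma> * (1 / (\<Prod>k<d - 1. p (k, k)))" by (simp add: ell_matrix_def)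
  also have "\<gamma> * (1 / P) * P = \<gamma>" if "0 < P" for P :: real using that by simp
  note this[OF pos]
  finally show ?thesis .
qed

lemma fconvex_ell_params: "fconvex (ell_params d)"
  unfolding fconvex_def ell_params_def
proof (intro ballI allI impI)
  fix p q :: "nat \<times> nat \<Rightarrow> real" and t assume pq: "p \<in> {p. (\<forall>k. k \<notin> ell_index d \<longrightarrow> p k = 0) \<and> (\<forall>i<d - 1. 0 < p (i, i))}"
    "q \<in> {p. (\<forall>k. k \<notin> ell_index d \<longrightarrow> p k = 0) \<and> (\<forall>i<d - 1. 0 < p (i, i))}" and t: "0 \<le> t \<and> t \<le> (1::real)"
  have "0 < (1 - t) * p (i, i) + t * q (i, i)" if "i < d - 1" for i
  proof (cases "t = 0")
    case False
    then have "0 < t * q (i, i)" "0 \<le> (1 - t) * p (i, i)" using pq t that by (auto simp: less_imp_le)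
    then show ?thesis by linarith
  qed (use pq that in auto)
  then show "(\<lambda>i. (1 - t) * p i + t * q i) \<in> {p. (\<forall>k. k \<notin> ell_index d \<longrightarrow> p k = 0) \<and> (\<forall>i<d - 1. 0 < p (i, i))}"
    using pq by auto
qed

text \<open>At a mixture \<open>r\<close> of \<open>p\<close> and \<open>q\<close> the determined
  entry is at most the mixture \<open>m\<close> of the determined entries, by
  \<open>inverse_prod_convex\<close>. So the image of \<open>b\<close> under \<open>r\<close> is the
  mixture of the images under \<open>p\<close> and \<open>q\<close> of \<open>b'\<close>, which is
  \<open>b\<close> with its last coordinate shrunk by \<open>s\<close>; both images lie in
  \<open>S\<close>.\<close>

lemma fconvex_ell_in:
  assumes S: "fconvex S" and d: "d > 0" and \<gamma>: "\<gamma> > 0"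
  shows "fconvex (ell_in d \<gamma> S)"
proof (rule fconvexI)
  fix p q and t :: real assume pq: "p \<in> ell_in d \<gamma> S" "q \<in> ell_in d \<gamma> S" and t: "0 \<le> t" "t \<le> 1"
  define r where "r = (\<lambda>i. (1 - t) * p i + t * q i)"
  have P: "p \<in> ell_params d" "q \<in> ell_params d" using pq by (auto simp: ell_in_def)
  then have R: "r \<in> ell_params d" unfolding r_def using t by (intro fconvexD[OF fconvex_ell_params]) auto
  let ?l = "\<lambda>p. ell_matrix d \<gamma> p (d - 1) (d - 1)"
  define m where "m = (1 - t) * ?l p + t * ?l q"
  have "1 / (\<Prod>k<d - 1. (1 - t) * p (k, k) + t * q (k, k))
      \<le> (1 - t) * (1 / (\<Prod>k<d - 1. p (k, k))) + t * (1 / (\<Prod>k<d - 1. q (k, k)))"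
    using P t by (intro inverse_prod_convex) (auto simp: ell_params_def)
  then have "\<gamma> * (1 / (\<Prod>k<d - 1. (1 - t) * p (k, k) + t * q (k, k)))
      \<le> \<gamma> * ((1 - t) * (1 / (\<Prod>k<d - 1. p (k, k))) + t * (1 / (\<Prod>k<d - 1. q (k, k))))"
    using \<gamma> by (intro mult_left_mono) auto
  then have le: "?l r \<le> m" by (simp add: m_def ell_matrix_def r_def algebra_simps)
  have l0: "0 < ?l r" using R \<gamma> d by (intro ell_diag_pos) auto
  then have m0: "0 < m" using le by simp
  define s where "s = ?l r / m"
  have s: "0 \<le> s" "s \<le> 1" "m * s = ?l r" using l0 m0 le by (auto simp: s_def)
  have "ell_map d \<gamma> r b \<in> S" if b: "b \<in> uball d" for b
  proof -
    define b' where "b' = b(d - 1 := s * b (d - 1))"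
    have b': "b' \<in> uball d" unfolding b'_def using b d s by (intro uball_shrink_coord) auto
    have "(\<lambda>i. (1 - t) * ell_map d \<gamma> p b' i
        + t * ell_map d \<gamma> q b' i) \<in> S"
      using pq b' t by (intro fconvexD[OF S]) (auto simp: ell_in_def)
    also have "(\<lambda>i. (1 - t) * ell_map d \<gamma> p b' i
        + t * ell_map d \<gamma> q b' i) = ell_map d \<gamma> r b"
    proof (rule Rn_eqI[of _ d])
      show "(\<lambda>i. (1 - t) * ell_map d \<gamma> p b' i
        + t * ell_map d \<gamma> q b' i) \<in> Rn d"
        using t by (intro fconvexD[OF fconvex_Rn]) auto
      fix i assume i: "i < d"
      have e: "((1 - t) * ell_matrix d \<gamma> p i j + t * ell_matrix d \<gamma> q i j) * b' j = ell_matrix d \<gamma> r i j * b j"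
        if "j < d" for j
      proof (cases "j = d - 1")
        case True
        show ?thesis
        proof (cases "i = d - 1")
          case True
          have "((1 - t) * ?l p + t * ?l q) * (s * b (d - 1)) = ?l r * b (d - 1)"
            using s(3) unfolding m_def by (simp only: mult.assoc[symmetric])
          then show ?thesis by (simp only: b'_def fun_upd_same \<open>j = d - 1\<close> \<open>i = d - 1\<close>)
        next
          case False
          then have "(i, j) \<notin> ell_index d" using True i d by (auto simp: ell_index_def)
          then have "p (i, j) = 0" "q (i, j) = 0" using P by (auto simp: ell_params_def)
          then show ?thesis using False by (simp add: ell_matrix_def r_def)
        qed
      next
        case False
        then show ?thesis by (simp add: ell_matrix_def b'_def r_def)
      qed
      have "(1 - t) * (\<Sum>j<d. ell_matrix d \<gamma> p i j * b' j) + t * (\<Sum>j<d. ell_matrix d \<gamma> q i j * b' j)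
          = (\<Sum>j<d. ((1 - t) * ell_matrix d \<gamma> p i j + t * ell_matrix d \<gamma> q i j) * b' j)"
        unfolding sum_distrib_left sum.distrib[symmetric] by (intro sum.cong refl) (simp add: algebra_simps)
      also have "\<dots> = (\<Sum>j<d. ell_matrix d \<gamma> r i j * b j)" using e by (intro sum.cong) auto
      finally show "(1 - t) * ell_map d \<gamma> p b' i
        + t * ell_map d \<gamma> q b' i = ell_map d \<gamma> r b i"
        using i by (simp add: affm_apply r_def distrib_left add_ac)
    qed simp
    finally show ?thesis .
  qed
  with R show "(\<lambda>i. (1 - t) * p i + t * q i) \<in> ell_in d \<gamma> S" by (simp add: ell_in_def r_def)
qed

text \<open>The ellipsoid is thinned along the last axis until its determinant is exactly
  \<open>\<gamma>\<close>. The same \<open>p\<close> works for every \<open>S\<close>, which puts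
  one parameter into all sets of a family at once.\<close>

lemma ell_in_nonempty:
  assumes d: "d > 0" and \<gamma>: "\<gamma> > 0" and T: "lower_tri d T" "\<forall>i<d. 0 < T i i" "\<gamma> \<le> (\<Prod>i<d. T i i)"
  shows "\<exists>p\<in>ell_params d. \<forall>S. (\<forall>b\<in>uball d. affm d T x b \<in> S) \<longrightarrow> p \<in> ell_in d \<gamma> S"
proof -
  define p where "p = (\<lambda>(i, j). if (i, j) \<in> ell_index d then if j = d then x i else T i j else 0)"
  have pT: "p (i, j) = T i j" if "i < d" "j < d" "\<not> (i = d - 1 \<and> j = d - 1)" for i j
    using that T(1) by (auto simp: p_def ell_index_def lower_tri_def)
  have px: "p (i, d) = x i" if "i < d" for i using that by (auto simp: p_def ell_index_def)
  have P: "p \<in> ell_params d" using pT T(2) by (auto simp: ell_params_def p_def)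
  let ?l = "ell_matrix d \<gamma> p (d - 1) (d - 1)"
  have split: "{..<d} = insert (d - 1) {..<d - 1}" using d by auto
  have pr: "(\<Prod>k<d - 1. p (k, k)) = (\<Prod>k<d - 1. T k k)" using pT by (intro prod.cong) auto
  have pos: "0 < (\<Prod>k<d - 1. T k k)" using T(2) by (intro prod_pos) auto
  have "\<gamma> \<le> T (d - 1) (d - 1) * (\<Prod>k<d - 1. T k k)" using T(3) by (simp add: split)
  then have "\<gamma> / (\<Prod>k<d - 1. T k k) \<le> T (d - 1) (d - 1)" using pos by (simp only: pos_divide_le_eq)
  moreover have "?l = \<gamma> / (\<Prod>k<d - 1. T k k)" unfolding pr[symmetric] by (simp add: ell_matrix_def)
  ultimately have le: "?l \<le> T (d - 1) (d - 1)" by (simp only:)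
  have l0: "0 < ?l" using P \<gamma> d by (intro ell_diag_pos) auto
  define s where "s = ?l / T (d - 1) (d - 1)"
  have s: "0 \<le> s" "s \<le> 1" "T (d - 1) (d - 1) * s = ?l" using l0 le by (auto simp: s_def)
  have "p \<in> ell_in d \<gamma> S" if S: "\<forall>b\<in>uball d. affm d T x b \<in> S" for S
  proof -
    have "ell_map d \<gamma> p b \<in> S" if b: "b \<in> uball d" for b
    proof -
      define b' where "b' = b(d - 1 := s * b (d - 1))"
      have b': "b' \<in> uball d" unfolding b'_def using b d s by (intro uball_shrink_coord) auto
      have "ell_map d \<gamma> p b = affm d T x b'"
      proof (rule Rn_eqI[of _ d])
        fix i assume i: "i < d"
        have "ell_matrix d \<gamma> p i j * b j = T i j * b' j" if j: "j < d" for j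
        proof (cases "j = d - 1")
          case True
          show ?thesis
          proof (cases "i = d - 1")
            case True
            then show ?thesis using \<open>j = d - 1\<close> s(3) by (simp add: b'_def)
          next
            case False
            then have "T i j = 0" using True i d T(1) by (auto simp: lower_tri_def)
            then show ?thesis using False pT[OF i j] by (simp add: ell_matrix_def)
          qed
        next
          case False
          then show ?thesis using pT[OF i j] by (simp add: ell_matrix_def b'_def)
        qed
        then show "ell_map d \<gamma> p b i = affm d T x b' i"
          using i px by (simp add: affm_apply)
      qed simp_all
      then show ?thesis using S b' by simp
    qed
    then show ?thesis using P by (simp add: ell_in_def)
  qed
  with P show ?thesis by blast
qed

lemma fconvex_uball: "fconvex (uball d)"
proof (rule fconvexI)
  fix x y and t :: real assume xy: "x \<in> uball d" "y \<in> uball d" and t: "0 \<le> t" "t \<le> 1"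
  have "(\<Sum>i<d. ((1 - t) * x i + t * y i)\<^sup>2) \<le> (1 - t) * (\<Sum>i<d. (x i)\<^sup>2) + t * (\<Sum>i<d. (y i)\<^sup>2)"
    using t by (intro sum_square_convex) auto
  also have "\<dots> \<le> 1"
    using xy t by (intro convex_bound_le) (auto simp: uball_def)
  finally show "(\<lambda>i. (1 - t) * x i + t * y i) \<in> uball d"
    using xy t fconvexD[OF fconvex_Rn] by (auto simp: uball_def)
qed

text \<open>The issue is measurability of \<open>S\<close>, whose measure would be 0 otherwise. The
  ellipsoid \<open>X\<close> is compact and convex with positive volume, so it contains a cube, and
  a convex set containing a cube is measurable.\<close>

lemma volume_ge_ellipsoid:
  assumes S: "fconvex S" "S \<subseteq> Rn d" and T: "lower_tri d T" "\<forall>i<d. 0 < T i i"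
    and sub: "\<forall>b\<in>uball d. affm d T x b \<in> S"
  shows "ennreal ((\<Prod>i<d. T i i) * unit_ball_vol (real d)) \<le> vol_Rn d S"
proof -
  let ?L = "lvol d"
  define D where "D = (\<Prod>i<d. T i i)"
  have D: "D > 0" unfolding D_def using T(2) by (intro prod_pos) auto
  have sc: "scales d (affm d T x) D" unfolding D_def using T by (rule scales_lower_tri)
  define X where "X = affm d T x ` uball d"
  have XS: "X \<subseteq> S" using sub by (auto simp: X_def)
  then have XR: "X \<subseteq> Rn d" using S(2) by blast
  have "continuous_on (uball d) (affm d T x)"
  proof (rule continuous_on_coordinatewise_then_product)
    show "continuous_on (uball d) (\<lambda>z. affm d T x z i)" for i
      by (cases "i < d") (auto simp: affm_def intro!: continuous_intros continuous_on_coordinate)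
  qed
  then have "compact X" unfolding X_def using compact_uball by (rule compact_continuous_image)
  then have X: "X \<in> sets (leb_Rn d)"
    using closed_in_sets_leb_Rn[of X d] XR by (simp add: compact_imp_closed Int_absorb2)
  have "uball d \<subseteq> affm d T x -` X \<inter> Rn d" by (auto simp: X_def uball_def)
  moreover have "affm d T x -` X \<inter> Rn d \<in> sets (leb_Rn d)" using measurable_sets[OF scalesD(2)[OF sc] X] by simp
  ultimately have "?L (uball d) * ennreal D \<le> ?L (affm d T x -` X \<inter> Rn d) * ennreal D"
    by (intro mult_right_mono emeasure_mono) auto
  then have LX: "ennreal (D * unit_ball_vol (real d)) \<le> ?L X"
    using scalesD(3)[OF sc X] D by (simp add: emeasure_uball ennreal_mult[symmetric] mult.commute)
  have "fconvex X" unfolding fconvex_def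
  proof (intro ballI allI impI)
    fix a b t assume "a \<in> X" "b \<in> X" and t: "0 \<le> t \<and> t \<le> (1::real)"
    then obtain a' b' where ab: "a' \<in> uball d" "b' \<in> uball d" "a = affm d T x a'" "b = affm d T x b'" by (auto simp: X_def)
    have "(\<lambda>i. (1 - t) * a i + t * b i) = affm d T x (\<lambda>i. (1 - t) * a' i + t * b' i)"
      by (simp add: affm_mix ab)
    moreover have "(\<lambda>i. (1 - t) * a' i + t * b' i) \<in> uball d"
      using ab t by (intro fconvexD[OF fconvex_uball]) auto
    ultimately show "(\<lambda>i. (1 - t) * a i + t * b i) \<in> X" by (auto simp: X_def)
  qed
  moreover have "vol_Rn d X \<noteq> 0"
  proof -
    have "0 < D * unit_ball_vol (real d)" using D by simp
    then have "0 < ?L X" using LX by (metis ennreal_less_zero_iff less_le_trans)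
    then show ?thesis using X by (simp add: vol_Rn_def)
  qed
  ultimately obtain c r where "c \<in> Rn d" "0 < r" "cubeR d c r \<subseteq> X"
    using pos_volume_contains_cube[OF _ XR] by blast
  then have "S \<in> sets (completion (leb_Rn d))" using XS by (intro convex_measurable[OF S]) auto
  then have "emeasure (completion (leb_Rn d)) X \<le> vol_Rn d S"
    unfolding vol_Rn_def using XS by (intro emeasure_mono)
  then show ?thesis using LX X by (simp add: D_def)
qed

text \<open>Subsets of an independent set are independent, so the volume hypothesis passes to the
  small subfamilies of \<open>B\<close>, and \<open>quantitative_Helly\<close> gives an ellipsoid
  inside all sets of \<open>B\<close>. This is the nonemptiness that \<open>matroid_Helly\<close>
  asks for; the parameter it returns is an ellipsoid inside all sets of
  \<open>\<tau>\<close>.\<close>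

lemma fixed_dimension_approx:
  assumes d: "d > 0" and mat: "matroid V M" and F: "\<forall>v\<in>V. convex_Rn d (F v)"
    and vol: "\<forall>V'\<in>M. card V' \<le> 2 * d \<longrightarrow> 1 \<le> vol_Rn d (Inter_Rn d F V')"
    and \<kappa>: "0 < \<kappa>" "\<kappa> < 1"
  shows "\<exists>\<tau>\<subseteq>V. real (matroid_rank M (V - \<tau>)) \<le> real d * (real d + 3) / 2 - 1 \<and>
    ennreal (\<kappa> * gam d * unit_ball_vol (real d)) \<le> vol_Rn d (Inter_Rn d F \<tau>)"
proof -
  define \<gamma> where "\<gamma> = \<kappa> * gam d"
  have \<gamma>: "\<gamma> > 0" using \<kappa> gam_pos[OF d] by (simp add: \<gamma>_def)
  note I = finite_card_ell_index[OF d]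
  have finV: "finite V" and MV: "M \<subseteq> Pow V" and Msub: "\<And>A B. A \<subseteq> B \<Longrightarrow> B \<in> M \<Longrightarrow> A \<in> M"
    using mat unfolding matroid_def by blast+
  have Fc: "fconvex (F v)" "F v \<subseteq> Rn d" if "v \<in> V" for v using F that convex_RnD by blast+
  have "\<exists>\<tau>\<subseteq>V. (\<exists>p\<in>ell_params d. \<forall>v\<in>\<tau>. p \<in> ell_in d \<gamma> (F v)) \<and> matroid_rank M (V - \<tau>) \<le> card (ell_index d)"
  proof (rule matroid_Helly[OF mat I(1) fconvex_ell_params, where w="\<lambda>_. 0"])
    show "fconvex (ell_in d \<gamma> (F v))" if "v \<in> V" for v using Fc[OF that] d \<gamma> by (intro fconvex_ell_in)
    show "p k = 0" if "p \<in> ell_params d" "k \<notin> ell_index d" for p k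
      using that unfolding ell_params_def by blast
    show "ell_params d \<inter> (\<Inter>v\<in>B. ell_in d \<gamma> (F v)) \<noteq> {}" if B: "B \<in> M" for B
    proof -
      have BV: "B \<subseteq> V" using B MV by blast
      have "\<exists>T x. lower_tri d T \<and> (\<forall>i<d. 0 < T i i) \<and> (\<forall>v\<in>B. \<forall>b\<in>uball d. affm d T x b \<in> F v) \<and> \<gamma> \<le> (\<Prod>i<d. T i i)"
        unfolding \<gamma>_def
      proof (rule quantitative_Helly[OF d])
        show "finite B" using BV finV finite_subset by blast
        show "1 \<le> vol_Rn d (Inter_Rn d F V')" if "V' \<subseteq> B" "card V' \<le> 2 * d" for V'
          using vol Msub[OF that(1) B] that(2) by blast
      qed (use Fc BV \<kappa> in auto)
      then obtain T x where T: "lower_tri d T" "\<forall>i<d. 0 < T i i" "\<forall>v\<in>B. \<forall>b\<in>uball d. affm d T x b \<in> F v" "\<gamma> \<le> (\<Prod>i<d. T i i)"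
        by (elim exE conjE that)
      from ell_in_nonempty[OF d \<gamma> T(1,2,4), of x] obtain p where
        "p \<in> ell_params d" "\<forall>S. (\<forall>b\<in>uball d. affm d T x b \<in> S) \<longrightarrow> p \<in> ell_in d \<gamma> S" by blast
      with T(3) have "p \<in> ell_params d \<inter> (\<Inter>v\<in>B. ell_in d \<gamma> (F v))" by blast
      then show ?thesis by blast
    qed
  qed
  then obtain \<tau> p where \<tau>: "\<tau> \<subseteq> V" "p \<in> ell_params d" "\<forall>v\<in>\<tau>. p \<in> ell_in d \<gamma> (F v)"
    "matroid_rank M (V - \<tau>) \<le> card (ell_index d)" by blast
  have "ennreal ((\<Prod>i<d. ell_matrix d \<gamma> p i i) * unit_ball_vol (real d)) \<le> vol_Rn d (Inter_Rn d F \<tau>)"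
  proof (rule volume_ge_ellipsoid[where T="ell_matrix d \<gamma> p" and x="\<lambda>i. p (i, d)"])
    show "fconvex (Inter_Rn d F \<tau>)" unfolding Inter_Rn_def
      using \<tau>(1) Fc by (intro fconvex_Int fconvex_Rn fconvex_Inter) blast
    show "Inter_Rn d F \<tau> \<subseteq> Rn d" by (auto simp: Inter_Rn_def)
    show "lower_tri d (ell_matrix d \<gamma> p)" using \<tau>(2) by (rule lower_tri_ell_matrix)
    show "\<forall>i<d. 0 < ell_matrix d \<gamma> p i i" using ell_diag_pos[OF \<tau>(2) \<gamma>] by blast
    show "\<forall>b\<in>uball d. ell_map d \<gamma> p b \<in> Inter_Rn d F \<tau>"
      using \<tau>(3) by (auto simp: Inter_Rn_def ell_in_def)
  qed
  then have "ennreal (\<kappa> * gam d * unit_ball_vol (real d)) \<le> vol_Rn d (Inter_Rn d F \<tau>)"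
    unfolding prod_ell_matrix[OF \<tau>(2) d] by (simp only: \<gamma>_def)
  moreover have "real (matroid_rank M (V - \<tau>)) \<le> real d * (real d + 3) / 2 - 1"
    using \<tau>(4) unfolding I(2)[symmetric] by simp
  ultimately show ?thesis using \<tau>(1) by blast
qed

text \<open>If the finitely many admissible \<open>\<tau>\<close> all had volume below the bound,
  the largest of these volumes would still be below \<open>\<kappa>\<close> times the bound for some
  \<open>\<kappa> < 1\<close>, against the approximate version.\<close>

theorem fixed_dimension:
  assumes d: "d > 0" and mat: "matroid V M" and F: "\<forall>v\<in>V. convex_Rn d (F v)"
    and vol: "\<forall>V'\<in>M. card V' \<le> 2 * d \<longrightarrow> 1 \<le> vol_Rn d (Inter_Rn d F V')"
  shows "\<exists>\<tau>\<subseteq>V. real (matroid_rank M (V - \<tau>)) \<le> real d * (real d + 3) / 2 - 1 \<and>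
    ennreal (gam d * unit_ball_vol (real d)) \<le> vol_Rn d (Inter_Rn d F \<tau>)"
proof (rule ccontr)
  assume neg: "\<not> ?thesis"
  define g where "g = gam d * unit_ball_vol (real d)"
  have g: "g > 0" using gam_pos[OF d] by (simp add: g_def)
  define \<T> where "\<T> = {\<tau>. \<tau> \<subseteq> V \<and> real (matroid_rank M (V - \<tau>)) \<le> real d * (real d + 3) / 2 - 1}"
  let ?v = "\<lambda>\<tau>. vol_Rn d (Inter_Rn d F \<tau>)"
  have ex: "\<exists>\<tau>\<in>\<T>. ennreal (\<kappa> * g) \<le> ?v \<tau>" if "0 < \<kappa>" "\<kappa> < 1" for \<kappa>
    using fixed_dimension_approx[OF d mat F vol that] unfolding \<T>_def g_def by (auto simp: mult.assoc)
  have "finite V" using mat by (simp add: matroid_def)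
  then have fin: "finite \<T>" using finite_subset[of \<T> "Pow V"] by (auto simp: \<T>_def)
  have ne: "\<T> \<noteq> {}" using ex[of "1/2"] by auto
  have lt: "?v \<tau> < ennreal g" if "\<tau> \<in> \<T>" for \<tau> using neg that unfolding \<T>_def g_def by (auto simp: not_le)
  have "Max (?v ` \<T>) < ennreal g" using fin ne lt by (subst Max_less_iff) auto
  then obtain m where m: "Max (?v ` \<T>) = ennreal m" "0 \<le> m" "m < g"
    by (cases "Max (?v ` \<T>)") (auto simp: ennreal_less_iff)
  \<comment> \<open>Places \<open>\<kappa> * g\<close> halfway between \<open>m\<close> and
    \<open>g\<close>.\<close>
  define \<kappa> where "\<kappa> = (1 + m / g) / 2"
  have \<kappa>: "0 < \<kappa>" "\<kappa> < 1" using m g by (auto simp: \<kappa>_def add_pos_nonneg)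
  have "\<kappa> * g = (g + m) / 2" using g by (simp add: \<kappa>_def field_simps)
  then have "m < \<kappa> * g" using m by simp
  from ex[OF \<kappa>] obtain \<tau> where \<tau>: "\<tau> \<in> \<T>" "ennreal (\<kappa> * g) \<le> ?v \<tau>" by blast
  have "?v \<tau> \<le> ennreal m" unfolding m(1)[symmetric] using fin \<tau>(1) by (intro Max_ge) auto
  then have "ennreal (\<kappa> * g) \<le> ennreal m" using \<tau>(2) by (rule order_trans[rotated])
  then have "\<kappa> * g \<le> m" using m by (simp add: ennreal_le_iff)
  with \<open>m < \<kappa> * g\<close> show False by simp
qed

section \<open>The volume constant\<close>

text \<open>A single term of the exponential series at \<open>n\<close>.\<close>

lemma power_le_fact_exp: "real n ^ n \<le> fact n * exp (real n)"
proof -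
  have "(\<Sum>k\<in>{n}. real n ^ k /\<^sub>R fact k) \<le> (\<Sum>k. real n ^ k /\<^sub>R fact k)"
    by (rule sum_le_suminf[OF sums_summable[OF exp_converges[of "real n"]]]) auto
  then have "real n ^ n / fact n \<le> exp (real n)"
    unfolding sums_unique[OF exp_converges[of "real n"], symmetric] by (simp add: field_simps)
  then show ?thesis by (simp add: pos_divide_le_eq mult.commute)
qed

text \<open>Comparison with the integral of the square root. The induction step involves a
  difference of cubes of \<open>a\<close> and \<open>b\<close> with
  \<open>b\<^sup>2 - a\<^sup>2 = 1\<close>; multiplied by \<open>a + b\<close> it becomes a
  quadratic inequality.\<close>

lemma sum_sqrt_le: "(\<Sum>k<n. sqrt (real k)) \<le> 2 / 3 * (real n * sqrt (real n))"
proof (induction n)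
  case (Suc n)
  define a where "a = sqrt (real n)"
  define b where "b = sqrt (real (Suc n))"
  have ab: "0 \<le> a" "a \<le> b" "0 < b" "a\<^sup>2 = real n" "b\<^sup>2 = real n + 1" by (auto simp: a_def b_def)
  have "(2 / 3 * (b * b\<^sup>2 - a * a\<^sup>2) - a) * (a + b) = (b\<^sup>2 - a\<^sup>2) * (2 / 3 * (a\<^sup>2 + a * b + b\<^sup>2)) - a * (a + b)"
    by (simp add: power2_eq_square field_simps)
  also have "\<dots> = 2 / 3 * (a\<^sup>2 + a * b + b\<^sup>2) - a * (a + b)" by (simp add: ab)
  also have "\<dots> = 1 / 3 * ((b - a) * (2 * b + a))" by (simp add: power2_eq_square field_simps)
  also have "\<dots> \<ge> 0" using ab by auto
  finally have "0 \<le> 2 / 3 * (b * b\<^sup>2 - a * a\<^sup>2) - a" using ab by (simp add: zero_le_mult_iff)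
  then have "a \<le> 2 / 3 * (b * b\<^sup>2) - 2 / 3 * (a * a\<^sup>2)" by (simp add: algebra_simps)
  then have "a + 2 / 3 * (real n * a) \<le> 2 / 3 * (real (Suc n) * b)" using ab by (simp add: algebra_simps)
  with Suc.IH show ?case by (simp add: a_def b_def)
qed simp

text \<open>For \<open>z = (n + 1) / 2\<close>, log-convexity gives
  \<open>Gamma (z + 1/2) \<le> sqrt z * Gamma z\<close>, and Legendre's duplication formula
  evaluates \<open>Gamma z * Gamma (z + 1/2)\<close>. Their combination treats even and odd
  \<open>n\<close> alike.\<close>

lemma Gamma_half_square_le:
  "(Gamma (real n / 2 + 1))\<^sup>2 \<le> sqrt ((real n + 1) / 2) * sqrt pi * fact n / 2 ^ n"
proof -
  define z where "z = real n / 2 + 1 / 2"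
  have z: "z > 0" by (simp add: z_def add_nonneg_pos)
  have "(ln \<circ> Gamma) ((1 - 1/2) *\<^sub>R z + (1/2) *\<^sub>R (z + 1)) \<le> (1 - 1/2) * (ln \<circ> Gamma) z + 1/2 * (ln \<circ> Gamma) (z + 1)"
    using z by (intro convex_onD[OF log_convex_Gamma_real]) auto
  then have lc: "2 * ln (Gamma (z + 1/2)) \<le> ln (Gamma z) + ln (Gamma (z + 1))" by (simp add: field_simps)
  have G: "Gamma z > 0" "Gamma (z + 1/2) > 0" "Gamma (z + 1) > 0" using z by auto
  have "z \<notin> \<int>\<^sub>\<le>\<^sub>0" using z nonpos_Ints_nonpos by fastforce
  then have G1: "Gamma (z + 1) = z * Gamma z" by (rule Gamma_plus1)
  have "ln ((Gamma (z + 1/2))\<^sup>2) \<le> ln (z * (Gamma z)\<^sup>2)"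
  proof -
    have l: "ln (x * y\<^sup>2) = ln x + 2 * ln y" "ln (x * y) = ln x + ln y" "ln (y\<^sup>2) = 2 * ln y"
      if "0 < x" "0 < y" for x y :: real using that by (auto simp: ln_mult ln_realpow)
    show ?thesis using lc unfolding G1 l(2)[OF z G(1)] l(1)[OF z G(1)] l(3)[OF z G(2)] by linarith
  qed
  then have "(Gamma (z + 1/2))\<^sup>2 \<le> z * (Gamma z)\<^sup>2" using G z by simp
  then have "sqrt ((Gamma (z + 1/2))\<^sup>2) \<le> sqrt (z * (Gamma z)\<^sup>2)" by (rule real_sqrt_le_mono)
  then have le: "Gamma (z + 1/2) \<le> sqrt z * Gamma z" using G by (simp add: real_sqrt_mult)
  have dup: "Gamma z * Gamma (z + 1/2) = sqrt pi * fact n / 2 ^ n"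
  proof -
    have "Gamma z * Gamma (z + 1/2) = exp ((1 - 2 * z) * ln 2) * sqrt pi * Gamma (2 * z)"
    proof -
      have np: "x \<notin> \<int>\<^sub>\<le>\<^sub>0" if "x > 0" for x :: real using that nonpos_Ints_nonpos by fastforce
      have "complex_of_real z \<notin> \<int>\<^sub>\<le>\<^sub>0" "complex_of_real (z + 1/2) \<notin> \<int>\<^sub>\<le>\<^sub>0"
        unfolding of_real_in_nonpos_Ints_iff using z by (intro np, simp)+
      then have "Gamma (complex_of_real z) * Gamma (complex_of_real (z + 1/2)) =
          exp (complex_of_real ((1 - 2 * z) * ln 2)) * complex_of_real (sqrt pi) * Gamma (complex_of_real (2 * z))"
        using Gamma_legendre_duplication[of "complex_of_real z"] by simp
      then show ?thesis unfolding Gamma_complex_of_real exp_of_real of_real_mult[symmetric] of_real_eq_iff .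
    qed
    also have "2 * z = real n + 1" by (simp add: z_def)
    also have "Gamma (real n + 1) = fact n" using Gamma_fact[of n, where 'a=real] by (simp add: add.commute)
    also have "exp ((1 - (real n + 1)) * ln 2) = 1 / 2 ^ n"
      by (simp add: exp_minus exp_of_nat_mult inverse_eq_divide)
    finally show ?thesis by simp
  qed
  have "(Gamma (z + 1/2))\<^sup>2 \<le> sqrt z * Gamma z * Gamma (z + 1/2)"
    unfolding power2_eq_square using le G by (intro mult_right_mono) auto
  also have "\<dots> = sqrt z * (sqrt pi * fact n / 2 ^ n)" using dup by (simp only: mult.assoc)
  finally show ?thesis by (simp add: z_def add_divide_distrib add_ac mult_ac)
qed

text \<open>Comparing squares removes the roots: \<open>P\<^sup>2\<close> becomes a factorial over a
  power, and \<open>Gamma_half_square_le\<close> applies to the ball. What remains is a comparison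
  of \<open>n\<close>-th powers, up to the subexponential factor \<open>q\<close>.\<close>

lemma volume_constant_lower:
  "eventually (\<lambda>d. real d powr (- (3 * real d / 2)) \<le> gam d * unit_ball_vol (real d)) sequentially"
proof -
  \<comment> \<open>\<open>7 / 10\<close> lies slightly above \<open>2 / 3\<close>; the difference
    absorbs the lower-order terms.\<close>
  have "eventually (\<lambda>d. real d + real d * sqrt (real d) + 2 / 3 * (real d)\<^sup>2 \<le> 7 / 10 * (real d)\<^sup>2) sequentially"
    by real_asymp
  \<comment> \<open>Reserved for the factor \<open>q\<close> of order \<open>sqrt d\<close> from the
    Gamma bound.\<close>
  moreover have "eventually (\<lambda>d. sqrt (2 * (real d + 1)) \<le> (5 / 4) ^ d) sequentially"
    by real_asymp
  moreover have "eventually (\<lambda>d. d > 0) sequentially" by (rule eventually_gt_at_top)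
  ultimately show ?thesis
  proof eventually_elim
    case (elim n)
    then have n: "n > 0" by simp
    define D where "D = real n + real n * (sqrt (real n) + (\<Sum>k<n. sqrt (real k / real n)))"
    have D0: "D > 0" unfolding D_def using n by (intro add_pos_nonneg mult_nonneg_nonneg add_nonneg_nonneg sum_nonneg) auto
    have "(\<Sum>k<n. sqrt (real k / real n)) = (\<Sum>k<n. sqrt (real k)) / sqrt (real n)"
      by (simp add: real_sqrt_divide sum_divide_distrib)
    also have "\<dots> \<le> 2 / 3 * (real n * sqrt (real n)) / sqrt (real n)"
      using sum_sqrt_le by (intro divide_right_mono) auto
    finally have "(\<Sum>k<n. sqrt (real k / real n)) \<le> 2 / 3 * real n" using n by simp
    then have "real n * (\<Sum>k<n. sqrt (real k / real n)) \<le> real n * (2 / 3 * real n)" by (intro mult_left_mono) auto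
    then have "D \<le> real n + real n * sqrt (real n) + 2 / 3 * (real n)\<^sup>2"
      by (simp add: D_def distrib_left power2_eq_square)
    then have D: "D \<le> 7 / 10 * (real n)\<^sup>2" using elim(1) by linarith
    define P where "P = (\<Prod>k<n. sqrt (1 - real k / real n))"
    have P2: "P\<^sup>2 = fact n / real n ^ n"
    proof -
      have "P\<^sup>2 = (\<Prod>k<n. (sqrt (1 - real k / real n))\<^sup>2)" unfolding P_def by (rule prod_power_distrib)
      also have "\<dots> = (\<Prod>k<n. real (n - k) / real n)"
        using n by (intro prod.cong refl) (simp add: of_nat_diff diff_divide_distrib)
      also have "\<dots> = fact n / real n ^ n"
        by (simp add: prod_dividef fact_prod_rev atLeast0LessThan)
      finally show ?thesis .
    qed
    have g2: "(gam n)\<^sup>2 = (fact n) ^ 3 / (real n ^ n * D ^ (2 * n))"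
    proof -
      have "(gam n)\<^sup>2 = (fact n)\<^sup>2 * P\<^sup>2 / (D ^ n)\<^sup>2"
        by (simp add: gam_def D_def P_def power_mult_distrib power_divide)
      also have "(D ^ n)\<^sup>2 = D ^ (2 * n)" by (simp add: power_mult[symmetric] mult.commute)
      finally show ?thesis unfolding P2 by (simp add: power2_eq_square power3_eq_cube)
    qed
    define \<Gamma> where "\<Gamma> = sqrt ((real n + 1) / 2) * sqrt pi * fact n / 2 ^ n"
    have \<Gamma>0: "\<Gamma> > 0" by (simp add: \<Gamma>_def add_nonneg_pos)
    have "(pi powr (real n / 2))\<^sup>2 = pi ^ n" by (simp add: powr_power powr_realpow)
    then have "(unit_ball_vol (real n))\<^sup>2 = pi ^ n / (Gamma (real n / 2 + 1))\<^sup>2"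
      by (simp only: unit_ball_vol_def power_divide)
    also have "\<dots> \<ge> pi ^ n / \<Gamma>"
    proof (rule frac_le)
      show "0 < (Gamma (real n / 2 + 1))\<^sup>2" by (intro zero_less_power Gamma_real_pos) (simp add: add_nonneg_pos)
    qed (use Gamma_half_square_le[of n] in \<open>auto simp: \<Gamma>_def\<close>)
    finally have u2: "pi ^ n / \<Gamma> \<le> (unit_ball_vol (real n))\<^sup>2" .
    define q where "q = sqrt ((real n + 1) / 2) * sqrt pi"
    have q0: "q > 0" by (simp add: q_def add_nonneg_pos)
    have "q = sqrt ((real n + 1) / 2 * pi)" by (simp only: q_def real_sqrt_mult)
    also have "\<dots> \<le> sqrt (2 * (real n + 1))"
    proof (rule real_sqrt_le_mono)
      have "(real n + 1) / 2 * pi \<le> (real n + 1) / 2 * 4" using pi_less_4 by (intro mult_left_mono) auto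
      then show "(real n + 1) / 2 * pi \<le> 2 * (real n + 1)" by simp
    qed
    also have "\<dots> \<le> (5 / 4) ^ n" by (rule elim(2))
    finally have q: "q \<le> (5 / 4) ^ n" .
    have e1: "exp (real n) \<le> 3 ^ n"
    proof -
      have "exp (real n) = exp 1 ^ n" by (simp add: exp_of_nat_mult[symmetric])
      also have "\<dots> \<le> 3 ^ n" using exp_le by (intro power_mono) auto
      finally show ?thesis .
    qed
    have "real n ^ n \<le> fact n * 3 ^ n"
      using power_le_fact_exp[of n] mult_left_mono[OF e1, of "fact n"] by (rule order_trans) simp
    then have f1: "real n ^ n / 3 ^ n \<le> fact n" by (simp add: pos_divide_le_eq)
    have "real n powr (- (3 * real n)) = 1 / real n ^ (3 * n)"
      using n by (simp add: powr_minus_divide powr_realpow[symmetric])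
    also have "\<dots> \<le> (real n ^ n / 3 ^ n)\<^sup>2 * (2 * pi) ^ n / (real n ^ n * (7 / 10 * (real n)\<^sup>2) ^ (2 * n) * (5 / 4) ^ n)"
    proof -
      \<comment> \<open>The surplus per dimension: \<open>2 * pi / 9\<close> with the 9 from
        \<open>exp 1 \<le> 3\<close>, then \<open>100 / 49\<close> from the squared
        \<open>7 / 10\<close>, and \<open>4 / 5\<close> from \<open>q\<close>. Already
        \<open>pi > 3\<close> makes it at least 1.\<close>
      define c :: real where "c = (200 / 441) * (4 / 5) * pi"
      have c: "c \<ge> 1" using pi_gt3 by (simp add: c_def)
      have "(real n ^ n / 3 ^ n)\<^sup>2 * (2 * pi) ^ n / (real n ^ n * (7 / 10 * (real n)\<^sup>2) ^ (2 * n) * (5 / 4) ^ n)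
          = ((real n / 3)\<^sup>2 * (2 * pi) / (real n * ((7 / 10 * (real n)\<^sup>2)\<^sup>2) * (5 / 4))) ^ n"
      proof -
        have a: "(real n ^ n / 3 ^ n)\<^sup>2 = ((real n / 3)\<^sup>2) ^ n"
          by (simp only: power_divide[symmetric] power_mult[symmetric] mult.commute)
        have b: "(7 / 10 * (real n)\<^sup>2) ^ (2 * n) = ((7 / 10 * (real n)\<^sup>2)\<^sup>2) ^ n" by (rule power_mult)
        show ?thesis unfolding a b by (simp only: power_mult_distrib[symmetric] power_divide[symmetric])
      qed
      also have "(real n / 3)\<^sup>2 * (2 * pi) / (real n * ((7 / 10 * (real n)\<^sup>2)\<^sup>2) * (5 / 4)) = c * (1 / real n ^ 3)"
        using n by (simp add: c_def power2_eq_square power3_eq_cube field_simps)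
      also have "(c * (1 / real n ^ 3)) ^ n = c ^ n * (1 / real n ^ (3 * n))"
        by (simp add: power_mult_distrib power_divide power_mult)
      also have "\<dots> \<ge> 1 * (1 / real n ^ (3 * n))" using c by (intro mult_right_mono) auto
      finally show ?thesis by simp
    qed
    also have "\<dots> \<le> (fact n)\<^sup>2 * (2 * pi) ^ n / (real n ^ n * D ^ (2 * n) * q)"
    proof (rule frac_le)
      show "(real n ^ n / 3 ^ n)\<^sup>2 * (2 * pi) ^ n \<le> (fact n)\<^sup>2 * (2 * pi) ^ n"
        using f1 by (intro mult_right_mono power_mono) auto
      show "0 < real n ^ n * D ^ (2 * n) * q" using n D0 q0 by simp
      show "real n ^ n * D ^ (2 * n) * q \<le> real n ^ n * (7 / 10 * (real n)\<^sup>2) ^ (2 * n) * (5 / 4) ^ n"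
        using D D0 q q0 by (intro mult_mono power_mono) auto
    qed simp
    also have "\<dots> = (gam n)\<^sup>2 * (pi ^ n / \<Gamma>)"
    proof -
      have \<Gamma>: "\<Gamma> = q * fact n / 2 ^ n" by (simp add: \<Gamma>_def q_def)
      show ?thesis unfolding g2 \<Gamma> by (simp add: power_mult_distrib power3_eq_cube power2_eq_square mult_ac)
    qed
    also have "\<dots> \<le> (gam n)\<^sup>2 * (unit_ball_vol (real n))\<^sup>2" by (intro mult_left_mono u2) auto
    also have "\<dots> = (gam n * unit_ball_vol (real n))\<^sup>2" by (simp add: power_mult_distrib)
    finally have le: "real n powr (- (3 * real n)) \<le> (gam n * unit_ball_vol (real n))\<^sup>2" .
    have "(real n powr (- (3 * real n / 2)))\<^sup>2 = real n powr (- (3 * real n))"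
      using n by (simp add: power2_eq_square powr_add[symmetric])
    with le have "(real n powr (- (3 * real n / 2)))\<^sup>2 \<le> (gam n * unit_ball_vol (real n))\<^sup>2" by simp
    then show ?case by (rule power2_le_imp_le) (use gam_pos[OF n] in auto)
  qed
qed

theorem theorem1p4:
  "\<exists>\<epsilon> :: nat \<Rightarrow> real. \<epsilon> \<longlonglongrightarrow> 0 \<and>
     (\<forall>d :: nat. \<forall>(V :: 'v set) (M :: 'v set set) (F :: 'v \<Rightarrow> (nat \<Rightarrow> real) set).
        d > 0 \<longrightarrow> matroid V M \<longrightarrow> (\<forall>v\<in>V. convex_Rn d (F v)) \<longrightarrow>
        (\<forall>V'\<in>M. card V' \<le> 2 * d \<longrightarrow> vol_Rn d (Inter_Rn d F V') \<ge> 1) \<longrightarrow>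
        (\<exists>\<tau>\<subseteq>V.
           real (matroid_rank M (V - \<tau>)) \<le> real d * (real d + 3) / 2 - 1 \<and>
           vol_Rn d (Inter_Rn d F \<tau>) \<ge> ennreal (real d powr (- (3 * real d / 2) - \<epsilon> d))))"
proof -
  define g where "g = (\<lambda>d. gam d * unit_ball_vol (real d))"
  \<comment> \<open>The shortfall of the exponent of \<open>g d\<close> to base \<open>d\<close>,
    cut off at 0; by \<open>volume_constant_lower\<close> it vanishes for large
    \<open>d\<close>.\<close>
  define \<epsilon> where "\<epsilon> = (\<lambda>d. max 0 (- (3 * real d / 2) - log (real d) (g d)))"
  have g0: "g d > 0" if "d > 0" for d using gam_pos[OF that] by (simp add: g_def)
  have "eventually (\<lambda>d. \<epsilon> d = 0) sequentially"
    using volume_constant_lower eventually_gt_at_top[of 1]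
  proof eventually_elim
    case (elim d)
    then have "real d powr (- (3 * real d / 2)) \<le> real d powr (log (real d) (g d))" using g0[of d] by (simp add: g_def)
    then have "- (3 * real d / 2) \<le> log (real d) (g d)" using elim(2) by simp
    then show ?case by (simp add: \<epsilon>_def)
  qed
  then have "\<epsilon> \<longlonglongrightarrow> 0" by (rule tendsto_eventually)
  moreover have "real d powr (- (3 * real d / 2) - \<epsilon> d) \<le> g d" if d: "d > 0" for d
  proof (cases "d = 1")
    \<comment> \<open>To base 1 the power is 1 whatever \<open>\<epsilon> 1\<close> is, and
      \<open>g 1 = 1/2 * 2\<close> meets it exactly.\<close>
    case True
    then show ?thesis by (simp add: g_def gam_def)
  next
    case False
    then have "1 < d" using d by simp
    then have "real d powr (- (3 * real d / 2) - \<epsilon> d) \<le> real d powr (log (real d) (g d))"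
      by (intro powr_mono) (auto simp: \<epsilon>_def)
    also have "\<dots> = g d" using \<open>1 < d\<close> g0[OF d] by simp
    finally show ?thesis .
  qed
  then have "\<exists>\<tau>\<subseteq>V. real (matroid_rank M (V - \<tau>)) \<le> real d * (real d + 3) / 2 - 1 \<and>
      vol_Rn d (Inter_Rn d F \<tau>) \<ge> ennreal (real d powr (- (3 * real d / 2) - \<epsilon> d))"
    if "d > 0" "matroid V M" "\<forall>v\<in>V. convex_Rn d (F v)"
      "\<forall>V'\<in>M. card V' \<le> 2 * d \<longrightarrow> vol_Rn d (Inter_Rn d F V') \<ge> 1"
    for d and V :: "'v set" and M and F :: "'v \<Rightarrow> (nat \<Rightarrow> real) set"
    using fixed_dimension[OF that] ennreal_leI[of _ "g d"] that(1) unfolding g_def by (meson order_trans)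
  ultimately show ?thesis by blast
qed

end
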